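(* Let $k$ be a field of characteristic zero, $n\ge1$, and let $M$ and $N$ be bimodules over the Weyl algebra $A_n(k)$. If $M$ is finitely generated as a right $A_n(k)$-module and $N$ is a holonomic bimodule, then the bimodule $M\otimes_{A_n(k)}N$ is holonomic.
   Context: For a field $k$, the Weyl algebra $A_n(k)$ is the $k$-algebra generated by $x_1,\dots,x_n,\partial_1,\dots,\partial_n$ with relations $[x_i,x_j]=0$, $[\partial_i,\partial_j]=0$, $[\partial_i,x_j]=\delta_{ij}$. The monomials $x^\alpha\partial^\beta$ ($\alpha,\beta\in\mathbb{N}^n$) form a $k$-basis; the degree of $x^\alpha\partial^\beta$ is $|\alpha|+|\beta|$, and $B^n_m$ denotes the $k$-span of monomials of degree $\le m$ (Bernstein filtration). A bimodule over a $k$-algebra $A$ is a $k$-vector space $M$ with left and right $A$-module structures compatible with the $k$-vector space structure such that $(a_1m)a_2=a_1(ma_2)$. Bimodules over $A_n(k)$ are identified with left $A_{2n}(k)$-modules via $x_i\cdot m=x_im$, $\partial_i\cdot m=\partial_i m$, $x_{n+i}\cdot m=mx_i$, $\partial_{n+i}\cdot m=-m\partial_i$ for $1\le i\le n$. The tensor product $M\otimes_{A_n(k)}N$ uses the right structure of $M$ and the left structure of $N$, and is a bimodule via the left structure of $M$ and the right structure of $N$. For $k$ of characteristic zero and a finitely generated left $A_N(k)$-module $M\ne0$ with finite generating set $m_1,\dots,m_r$, put $\Gamma_i=B^N_im_1+\cdots+B^N_im_r$. For $i\gg0$, $\dim_k\Gamma_i$ equals $p(i)$ for a polynomial $p=\frac{e}{d!}x^d+\cdots$,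 where $d=\dim(M)$ (the dimension) and $e$ are independent of the choice of generators. $M$ is called holonomic if it is finitely generated and either $M=0$ or $\dim(M)=N$. A bimodule over $A_n(k)$ is called holonomic if it is holonomic as a left $A_{2n}(k)$-module. *)

theory Defs
  imports
    "HOL-Algebra.Free_Abelian_Groups"
    "HOL-Computational_Algebra.Polynomial"
    "Jordan_Normal_Form.VS_Connect"
begin

section \<open>The free algebra\<close>

text \<open>
  Words form a monoid under concatenation.  It is written additively because the
  product on \<open>'g word \<Rightarrow>\<^sub>0 'k\<close> in \<open>HOL-Library.Poly_Mapping\<close> is the convolution product
  with respect to an additive monoid; \<open>'g word \<Rightarrow>\<^sub>0 'k\<close> is thus the free associative
  \<open>'k\<close>-algebra on \<open>'g\<close>.
\<close>

datatype 'g word = Word "'g list"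

instantiation word :: (type) monoid_add
begin

definition "0 = Word []"

fun plus_word :: "'a word \<Rightarrow> 'a word \<Rightarrow> 'a word" where
  "Word u + Word v = Word (u @ v)"

instance
proof
  fix a b c :: "'a word"
  show "a + b + c = a + (b + c)" by (cases a; cases b; cases c) simp
  show "0 + a = a" by (cases a) (simp add: zero_word_def)
  show "a + 0 = a" by (cases a) (simp add: zero_word_def)
qed

end

definition free_gen :: "'g \<Rightarrow> 'g word \<Rightarrow>\<^sub>0 'k::field" where
  "free_gen g = Poly_Mapping.single (Word [g]) 1"

definition free_const :: "'k \<Rightarrow> 'g word \<Rightarrow>\<^sub>0 'k::field" where
  "free_const c = Poly_Mapping.single 0 c"


section \<open>The Weyl algebra\<close>

text \<open>
  The variables are indexed by a type \<open>'n\<close>; for a finite type this is $A_n(k)$ with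
  $n$ the cardinality of \<open>'n\<close>, and \<open>'n + 'n\<close> indexes the variables of $A_{2n}(k)$.
\<close>

datatype 'n weyl_gen = GenX 'n | GenD 'n

definition weyl_relators :: "('n weyl_gen word \<Rightarrow>\<^sub>0 'k::field) set" where
  "weyl_relators =
     {free_gen (GenX i) * free_gen (GenX j) - free_gen (GenX j) * free_gen (GenX i) | i j. True} \<union>
     {free_gen (GenD i) * free_gen (GenD j) - free_gen (GenD j) * free_gen (GenD i) | i j. True} \<union>
     {free_gen (GenD i) * free_gen (GenX j) - free_gen (GenX j) * free_gen (GenD i)
        - (if i = j then 1 else 0) | i j. True}"

inductive_set weyl_ideal :: "('n weyl_gen word \<Rightarrow>\<^sub>0 'k::field) set" where
  relator: "r \<in> weyl_relators \<Longrightarrow> r \<in> weyl_ideal"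
| zero: "0 \<in> weyl_ideal"
| add: "a \<in> weyl_ideal \<Longrightarrow> b \<in> weyl_ideal \<Longrightarrow> a + b \<in> weyl_ideal"
| mult_left: "a \<in> weyl_ideal \<Longrightarrow> f * a \<in> weyl_ideal"
| mult_right: "a \<in> weyl_ideal \<Longrightarrow> a * f \<in> weyl_ideal"

lemma weyl_ideal_uminus: "a \<in> weyl_ideal \<Longrightarrow> - a \<in> weyl_ideal"
  using weyl_ideal.mult_left[of a "- 1"] by simp

lemma weyl_ideal_diff: "a \<in> weyl_ideal \<Longrightarrow> b \<in> weyl_ideal \<Longrightarrow> a - b \<in> weyl_ideal"
  using weyl_ideal.add[of a "- b"] weyl_ideal_uminus[of b] by simp

quotient_type (overloaded) ('n, 'k) weyl = "'n weyl_gen word \<Rightarrow>\<^sub>0 'k::field" / "\<lambda>a b. a - b \<in> weyl_ideal"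
proof (rule equivpI)
  show "reflp (\<lambda>a b :: 'n weyl_gen word \<Rightarrow>\<^sub>0 'k. a - b \<in> weyl_ideal)"
    by (rule reflpI) (simp add: weyl_ideal.zero)
  show "symp (\<lambda>a b :: 'n weyl_gen word \<Rightarrow>\<^sub>0 'k. a - b \<in> weyl_ideal)"
    by (rule sympI) (metis minus_diff_eq weyl_ideal_uminus)
  show "transp (\<lambda>a b :: 'n weyl_gen word \<Rightarrow>\<^sub>0 'k. a - b \<in> weyl_ideal)"
  proof (rule transpI)
    fix a b c :: "'n weyl_gen word \<Rightarrow>\<^sub>0 'k"
    assume "a - b \<in> weyl_ideal" "b - c \<in> weyl_ideal"
    then show "a - c \<in> weyl_ideal" using weyl_ideal.add[of "a - b" "b - c"] by simp
  qed
qed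

lemma weyl_ideal_add_cong:
  "a - a' \<in> weyl_ideal \<Longrightarrow> b - b' \<in> weyl_ideal \<Longrightarrow> (a + b) - (a' + b') \<in> weyl_ideal"
  by (metis add_diff_add weyl_ideal.add)

lemma weyl_ideal_uminus_cong: "a - a' \<in> weyl_ideal \<Longrightarrow> - a - - a' \<in> weyl_ideal"
  using weyl_ideal_uminus[of "a - a'"] by simp

lemma weyl_ideal_mult_cong:
  assumes "a - a' \<in> weyl_ideal" "b - b' \<in> weyl_ideal"
  shows "a * b - a' * b' \<in> weyl_ideal"
proof -
  have "(a - a') * b + a' * (b - b') \<in> weyl_ideal"
    using assms by (intro weyl_ideal.add weyl_ideal.mult_left weyl_ideal.mult_right)
  then show ?thesis by (simp add: algebra_simps)
qed

text \<open>
  Nontriviality of the Weyl algebra: letting the generators act on formal power series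
  by multiplication with a variable and by partial derivatives shows \<open>1 \<notin> weyl_ideal\<close>.
\<close>

lemma poly_mapping_single_induct [case_names single sum]:
  fixes p :: "'a \<Rightarrow>\<^sub>0 'b::monoid_add"
  assumes "\<And>w c. P (Poly_Mapping.single w c)"
    and "\<And>p q. P p \<Longrightarrow> P q \<Longrightarrow> P (p + q)"
  shows "P p"
proof (induction p rule: update_induct)
  case const
  show ?case using assms(1)[of undefined 0] by simp
next
  case (update p w c)
  have "Poly_Mapping.update w c p = p + Poly_Mapping.single w c"
    using update by (intro poly_mapping_eqI) (auto simp: lookup_update lookup_add lookup_single in_keys_iff when_def)
  then show ?case using update assms by metis
qed

primrec gen_act :: "'n weyl_gen \<Rightarrow> (('n \<Rightarrow> nat) \<Rightarrow> 'k::field) \<Rightarrow> ('n \<Rightarrow> nat) \<Rightarrow> 'k" where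
  "gen_act (GenX i) f = (\<lambda>\<alpha>. if \<alpha> i = 0 then 0 else f (\<alpha>(i := \<alpha> i - 1)))"
| "gen_act (GenD i) f = (\<lambda>\<alpha>. of_nat (\<alpha> i + 1) * f (\<alpha>(i := \<alpha> i + 1)))"

fun word_act :: "'n weyl_gen word \<Rightarrow> (('n \<Rightarrow> nat) \<Rightarrow> 'k::field) \<Rightarrow> ('n \<Rightarrow> nat) \<Rightarrow> 'k" where
  "word_act (Word w) f = foldr gen_act w f"

definition free_act :: "('n weyl_gen word \<Rightarrow>\<^sub>0 'k::field) \<Rightarrow> (('n \<Rightarrow> nat) \<Rightarrow> 'k) \<Rightarrow> ('n \<Rightarrow> nat) \<Rightarrow> 'k" where
  "free_act p f = (\<lambda>\<alpha>. \<Sum>w\<in>Poly_Mapping.keys p. Poly_Mapping.lookup p w * word_act w f \<alpha>)"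

lemma gen_act_linear:
  "gen_act g (\<lambda>\<alpha>. \<Sum>x\<in>A. c x * f x \<alpha>) = (\<lambda>\<alpha>. \<Sum>x\<in>A. c x * gen_act g (f x) \<alpha>)"
  by (cases g) (auto simp: fun_eq_iff sum_distrib_left algebra_simps)

lemma word_act_linear:
  "word_act w (\<lambda>\<alpha>. \<Sum>x\<in>A. c x * f x \<alpha>) = (\<lambda>\<alpha>. \<Sum>x\<in>A. c x * word_act w (f x) \<alpha>)"
proof (cases w)
  case (Word u)
  show ?thesis unfolding Word by (induction u) (simp_all add: gen_act_linear)
qed

lemma word_act_zero: "word_act w (\<lambda>_. 0) = (\<lambda>_. 0)"
  using word_act_linear[of w "\<lambda>_::nat. 0" "\<lambda>_ _. 0" "{}"] by simp

lemma word_act_plus: "word_act (u + v) f = word_act u (word_act v f)"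
  by (cases u; cases v) simp

lemma free_act_superset:
  assumes "finite A" "Poly_Mapping.keys p \<subseteq> A"
  shows "free_act p f \<alpha> = (\<Sum>w\<in>A. Poly_Mapping.lookup p w * word_act w f \<alpha>)"
  unfolding free_act_def
  by (rule sum.mono_neutral_left) (use assms in \<open>auto simp: in_keys_iff\<close>)

lemma free_act_plus: "free_act (p + q) f \<alpha> = free_act p f \<alpha> + free_act q f \<alpha>"
proof -
  let ?A = "Poly_Mapping.keys p \<union> Poly_Mapping.keys q"
  have "free_act (p + q) f \<alpha> = (\<Sum>w\<in>?A. Poly_Mapping.lookup (p + q) w * word_act w f \<alpha>)"
    by (rule free_act_superset) (auto simp: keys_add)
  also have "\<dots> = free_act p f \<alpha> + free_act q f \<alpha>"
    by (simp add: free_act_superset[of ?A] lookup_add algebra_simps sum.distrib)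
  finally show ?thesis .
qed

lemma free_act_zero: "free_act 0 f \<alpha> = 0"
  by (simp add: free_act_def)

lemma free_act_single: "free_act (Poly_Mapping.single w c) f \<alpha> = c * word_act w f \<alpha>"
  by (cases "c = 0") (simp_all add: free_act_def)

lemma free_act_diff: "free_act (p - q) f \<alpha> = free_act p f \<alpha> - free_act q f \<alpha>"
  using free_act_plus[of "p - q" q f \<alpha>] by simp

lemma word_act_free_act:
  "word_act u (free_act q f) \<alpha> = (\<Sum>w\<in>Poly_Mapping.keys q. Poly_Mapping.lookup q w * word_act (u + w) f \<alpha>)"
  unfolding free_act_def word_act_linear word_act_plus ..

lemma free_act_mult: "free_act (p * q) f \<alpha> = free_act p (free_act q f) \<alpha>"
proof (induction p rule: poly_mapping_single_induct)
  case (single u c)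
  have *: "free_act (Poly_Mapping.single u c * q) f \<alpha> = c * word_act u (free_act q f) \<alpha>"
  proof (induction q rule: poly_mapping_single_induct)
    case (single v d)
    show ?case
      unfolding word_act_free_act unfolding mult_single free_act_single
      by (cases "d = 0") simp_all
  next
    case (sum q r)
    have "free_act (q + r) f = (\<lambda>\<alpha>. \<Sum>b\<in>UNIV. 1 * (if b then free_act q f else free_act r f) \<alpha>)"
      by (simp add: fun_eq_iff free_act_plus UNIV_bool add.commute)
    then have "word_act u (free_act (q + r) f) \<alpha>
        = word_act u (free_act q f) \<alpha> + word_act u (free_act r f) \<alpha>"
      by (simp only: word_act_linear) (simp add: UNIV_bool add.commute)
    with sum show ?case
      by (simp add: distrib_left
          free_act_plus[of "Poly_Mapping.single u c * q" "Poly_Mapping.single u c * r"])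
  qed
  then show ?case by (simp add: free_act_single)
next
  case (sum p r)
  then show ?case by (simp add: distrib_right free_act_plus)
qed

lemma free_act_gen: "free_act (free_gen g) f = gen_act g f"
  by (simp add: fun_eq_iff free_gen_def free_act_single)

lemma free_act_one: "free_act 1 f = f"
proof -
  have "free_act (Poly_Mapping.single 0 1) f = f"
    by (simp only: fun_eq_iff free_act_single) (simp add: zero_word_def)
  then show ?thesis by simp
qed

lemma free_act_weyl_relators:
  assumes "r \<in> weyl_relators"
  shows "free_act r f = (\<lambda>_. 0)"
proof -
  have twist: "\<alpha>(i := a, j := b) = \<alpha>(j := b, i := a)" if "i \<noteq> j"
    for i j :: 'a and \<alpha> :: "'a \<Rightarrow> nat" and a b
    using that by (rule fun_upd_twist)
  have mult: "free_act (p * q) f = free_act p (free_act q f)"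
    for p q :: "'a weyl_gen word \<Rightarrow>\<^sub>0 'b" and f
    by (simp add: fun_eq_iff free_act_mult)
  note rules = free_act_diff free_act_zero free_act_one mult free_act_gen
  from assms consider
      (x) i j where "r = free_gen (GenX i) * free_gen (GenX j) - free_gen (GenX j) * free_gen (GenX i)"
    | (d) i j where "r = free_gen (GenD i) * free_gen (GenD j) - free_gen (GenD j) * free_gen (GenD i)"
    | (dx) i j where "r = free_gen (GenD i) * free_gen (GenX j) - free_gen (GenX j) * free_gen (GenD i)
        - (if i = j then 1 else 0)"
    unfolding weyl_relators_def by blast
  then show ?thesis
  proof cases
    case x
    show ?thesis unfolding x by (cases "i = j") (auto simp: rules fun_eq_iff twist)
  next
    case d
    show ?thesis unfolding d by (cases "i = j") (auto simp: rules fun_eq_iff twist)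
  next
    case dx
    show ?thesis
    proof (cases "i = j")
      case True
      have "of_nat (\<alpha> j) * f \<alpha> = f \<alpha> * of_nat (\<alpha> j)" for \<alpha>
        by (rule mult.commute)
      with True show ?thesis unfolding dx by (auto simp: rules fun_eq_iff ring_distribs)
    next
      case False
      then show ?thesis unfolding dx by (auto simp: rules fun_eq_iff twist)
    qed
  qed
qed

lemma free_act_weyl_ideal:
  assumes "r \<in> weyl_ideal"
  shows "free_act r f = (\<lambda>_. 0)"
  using assms
proof (induction arbitrary: f)
  case (mult_left a p)
  have "free_act p (\<lambda>_. 0) \<alpha> = 0" for \<alpha>
    unfolding free_act_def by (simp add: word_act_zero)
  then show ?case by (intro ext) (simp add: free_act_mult mult_left.IH)
qed (auto simp: fun_eq_iff free_act_weyl_relators free_act_zero free_act_plus free_act_mult)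

lemma one_not_in_weyl_ideal: "1 \<notin> weyl_ideal"
  using free_act_weyl_ideal[of 1 "\<lambda>_. 1"] by (auto simp: free_act_one fun_eq_iff)

instantiation weyl :: (type, field) ring_1
begin

lift_definition zero_weyl :: "('a, 'b) weyl" is 0 .

lift_definition one_weyl :: "('a, 'b) weyl" is 1 .

lift_definition plus_weyl :: "('a, 'b) weyl \<Rightarrow> ('a, 'b) weyl \<Rightarrow> ('a, 'b) weyl" is "(+)"
  by (rule weyl_ideal_add_cong)

lift_definition uminus_weyl :: "('a, 'b) weyl \<Rightarrow> ('a, 'b) weyl" is uminus
  by (rule weyl_ideal_uminus_cong)

lift_definition minus_weyl :: "('a, 'b) weyl \<Rightarrow> ('a, 'b) weyl \<Rightarrow> ('a, 'b) weyl" is "(-)"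
  using weyl_ideal_add_cong[OF _ weyl_ideal_uminus_cong] by fastforce

lift_definition times_weyl :: "('a, 'b) weyl \<Rightarrow> ('a, 'b) weyl \<Rightarrow> ('a, 'b) weyl" is "(*)"
  by (rule weyl_ideal_mult_cong)

instance
proof
  show "(0 :: ('a, 'b) weyl) \<noteq> 1"
    by transfer (use weyl_ideal_uminus one_not_in_weyl_ideal in force)
qed (transfer; simp add: algebra_simps weyl_ideal.zero)+

end

lift_definition weyl_x :: "'n \<Rightarrow> ('n, 'k::field) weyl" is "\<lambda>i. free_gen (GenX i)" .

lift_definition weyl_d :: "'n \<Rightarrow> ('n, 'k::field) weyl" is "\<lambda>i. free_gen (GenD i)" .

lift_definition weyl_const :: "'k \<Rightarrow> ('n, 'k::field) weyl" is free_const .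

lemma weyl_x_commute: "weyl_x i * weyl_x j = weyl_x j * weyl_x i"
  by transfer (rule weyl_ideal.relator, auto simp: weyl_relators_def)

lemma weyl_d_commute: "weyl_d i * weyl_d j = weyl_d j * weyl_d i"
  by transfer (rule weyl_ideal.relator, auto simp: weyl_relators_def)

lemma weyl_d_x: "weyl_d i * weyl_x j - weyl_x j * weyl_d i = (if i = j then 1 else 0)"
  unfolding if_distrib[of "\<lambda>a. _ = a"]
  by (cases "i = j"; simp; transfer; rule weyl_ideal.relator; force simp: weyl_relators_def)

interpretation weyl: vector_space "\<lambda>c a. weyl_const c * a :: ('n, 'k::field) weyl"
  apply unfold_locales
     apply (transfer, simp add: free_const_def weyl_ideal.zero algebra_simps)
    apply (transfer, simp add: free_const_def weyl_ideal.zero algebra_simps single_add)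
   apply (transfer, simp add: free_const_def weyl_ideal.zero algebra_simps mult_single flip: mult.assoc)
  apply (transfer, simp add: free_const_def weyl_ideal.zero)
  done

text \<open>
  \<open>weyl_monom \<alpha> \<beta>\<close> is $x^\alpha\partial^\beta$.  \<open>Finite_Set.fold\<close> multiplies all factors in
  some order, which is immaterial since the factors commute.
\<close>

definition weyl_monom :: "('n::finite \<Rightarrow> nat) \<Rightarrow> ('n \<Rightarrow> nat) \<Rightarrow> ('n, 'k::field) weyl" where
  "weyl_monom \<alpha> \<beta> =
     Finite_Set.fold (\<lambda>i a. weyl_x i ^ \<alpha> i * a) 1 UNIV *
     Finite_Set.fold (\<lambda>i a. weyl_d i ^ \<beta> i * a) 1 UNIV"

lemma comp_fun_commute_powers:
  fixes g :: "'n \<Rightarrow> 'a::monoid_mult"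
  assumes "\<And>i j. g i * g j = g j * g i"
  shows "comp_fun_commute (\<lambda>i a. g i ^ \<alpha> i * a)"
proof
  fix i j
  have "g i ^ \<alpha> i * g j ^ \<alpha> j = g j ^ \<alpha> j * g i ^ \<alpha> i"
    by (rule power_commuting_commutes, rule sym, rule power_commuting_commutes, rule assms)
  then show "(\<lambda>a. g j ^ \<alpha> j * a) \<circ> (\<lambda>a. g i ^ \<alpha> i * a) = (\<lambda>a. g i ^ \<alpha> i * a) \<circ> (\<lambda>a. g j ^ \<alpha> j * a)"
    by (simp add: fun_eq_iff flip: mult.assoc)
qed

lemmas comp_fun_commute_weyl_x = comp_fun_commute_powers[of weyl_x, OF weyl_x_commute]
lemmas comp_fun_commute_weyl_d = comp_fun_commute_powers[of weyl_d, OF weyl_d_commute]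

definition bernstein :: "nat \<Rightarrow> ('n::finite, 'k::field) weyl set" where
  "bernstein m = weyl.span {weyl_monom \<alpha> \<beta> | \<alpha> \<beta>. sum \<alpha> UNIV + sum \<beta> UNIV \<le> m}"


section \<open>Modules and bimodules over the Weyl algebra\<close>

locale weyl_left_module = vectorspace class_ring M
  for M :: "('k::field, 'm, 'z) module_scheme" (structure) +
  fixes act :: "('n, 'k) weyl \<Rightarrow> 'm \<Rightarrow> 'm"
  assumes act_closed: "m \<in> carrier M \<Longrightarrow> act a m \<in> carrier M"
    and act_add_right: "m \<in> carrier M \<Longrightarrow> m' \<in> carrier M \<Longrightarrow> act a (m \<oplus> m') = act a m \<oplus> act a m'"
    and act_add_left: "m \<in> carrier M \<Longrightarrow> act (a + b) m = act a m \<oplus> act b m"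
    and act_mult: "m \<in> carrier M \<Longrightarrow> act (a * b) m = act a (act b m)"
    and act_one: "m \<in> carrier M \<Longrightarrow> act 1 m = m"
    and act_const: "m \<in> carrier M \<Longrightarrow> act (weyl_const c) m = c \<odot> m"

locale weyl_right_module = vectorspace class_ring M
  for M :: "('k::field, 'm, 'z) module_scheme" (structure) +
  fixes act :: "'m \<Rightarrow> ('n, 'k) weyl \<Rightarrow> 'm"
  assumes act_closed: "m \<in> carrier M \<Longrightarrow> act m a \<in> carrier M"
    and act_add_right: "m \<in> carrier M \<Longrightarrow> act m (a + b) = act m a \<oplus> act m b"
    and act_add_left: "m \<in> carrier M \<Longrightarrow> m' \<in> carrier M \<Longrightarrow> act (m \<oplus> m') a = act m a \<oplus> act m' a"
    and act_mult: "m \<in> carrier M \<Longrightarrow> act m (a * b) = act (act m a) b"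
    and act_one: "m \<in> carrier M \<Longrightarrow> act m 1 = m"
    and act_const: "m \<in> carrier M \<Longrightarrow> act m (weyl_const c) = c \<odot> m"

record (overloaded) ('n, 'k, 'm) bimodule = "('k, 'm) module" +
  lact :: "('n, 'k) weyl \<Rightarrow> 'm \<Rightarrow> 'm"
  ract :: "'m \<Rightarrow> ('n, 'k) weyl \<Rightarrow> 'm"

definition weyl_bimodule :: "('n, 'k::field, 'm) bimodule \<Rightarrow> bool" where
  "weyl_bimodule M \<longleftrightarrow>
     weyl_left_module M (lact M) \<and> weyl_right_module M (ract M) \<and>
     (\<forall>m\<in>carrier M. \<forall>a b. ract M (lact M a m) b = lact M a (ract M m b))"

definition fin_gen_right :: "('n, 'k::field, 'm) bimodule \<Rightarrow> bool" where
  "fin_gen_right M \<longleftrightarrow>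
     (\<exists>S. finite S \<and> S \<subseteq> carrier M \<and>
        (\<forall>m\<in>carrier M. \<exists>b. m = (\<Oplus>\<^bsub>M\<^esub>s\<in>S. ract M s (b s))))"


section \<open>Dimension and holonomicity\<close>

definition left_gen ::
  "('k::field, 'm, 'z) module_scheme \<Rightarrow> (('n, 'k) weyl \<Rightarrow> 'm \<Rightarrow> 'm) \<Rightarrow> 'm set \<Rightarrow> bool" where
  "left_gen M act S \<longleftrightarrow>
     finite S \<and> S \<subseteq> carrier M \<and> (\<forall>m\<in>carrier M. \<exists>b. m = (\<Oplus>\<^bsub>M\<^esub>s\<in>S. act (b s) s))"

definition good_filtration ::
  "('k::field, 'm, 'z) module_scheme \<Rightarrow> (('n::finite, 'k) weyl \<Rightarrow> 'm \<Rightarrow> 'm) \<Rightarrow> 'm set \<Rightarrow> nat \<Rightarrow> 'm set" where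
  "good_filtration M act S i = {\<Oplus>\<^bsub>M\<^esub>s\<in>S. act (b s) s | b. \<forall>s\<in>S. b s \<in> bernstein i}"

definition weyl_dim ::
  "('k::field, 'm, 'z) module_scheme \<Rightarrow> (('n::finite, 'k) weyl \<Rightarrow> 'm \<Rightarrow> 'm) \<Rightarrow> nat" where
  "weyl_dim M act =
     (THE d. \<exists>S (p :: rat poly). left_gen M act S \<and> degree p = d \<and>
        (\<forall>\<^sub>F i in sequentially.
           of_nat (vectorspace.dim class_ring (M\<lparr>carrier := good_filtration M act S i\<rparr>)) =
           poly p (of_nat i)))"

definition holonomic ::
  "('k::field, 'm, 'z) module_scheme \<Rightarrow> (('n::finite, 'k) weyl \<Rightarrow> 'm \<Rightarrow> 'm) \<Rightarrow> bool" where
  "holonomic M act \<longleftrightarrow>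
     weyl_left_module M act \<and> (\<exists>S. left_gen M act S) \<and>
     (carrier M = {\<zero>\<^bsub>M\<^esub>} \<or> weyl_dim M act = card (UNIV :: 'n set))"

text \<open>
  The left $A_{2n}(k)$-module corresponding to a bimodule over $A_n(k)$; on the carrier its
  action is uniquely determined by these values on the generators.
\<close>

definition associated_action ::
  "('n, 'k::field, 'm) bimodule \<Rightarrow> (('n + 'n, 'k) weyl \<Rightarrow> 'm \<Rightarrow> 'm) \<Rightarrow> bool" where
  "associated_action M act \<longleftrightarrow>
     weyl_left_module M act \<and>
     (\<forall>m\<in>carrier M. \<forall>i.
        act (weyl_x (Inl i)) m = lact M (weyl_x i) m \<and>
        act (weyl_d (Inl i)) m = lact M (weyl_d i) m \<and>
        act (weyl_x (Inr i)) m = ract M m (weyl_x i) \<and>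
        act (weyl_d (Inr i)) m = \<ominus>\<^bsub>M\<^esub> ract M m (weyl_d i))"

definition holonomic_bimodule :: "('n::finite, 'k::field, 'm) bimodule \<Rightarrow> bool" where
  "holonomic_bimodule M \<longleftrightarrow>
     weyl_bimodule M \<and> (\<exists>act. associated_action M act \<and> holonomic M act)"


section \<open>Tensor products\<close>

text \<open>
  $M \otimes_{A_n(k)} N$ is the free abelian group on $M \times N$ modulo the subgroup
  generated by the relations of biadditivity and $(ma, n) = (m, an)$.
\<close>

definition tensor_relators ::
  "('n, 'k::field, 'm) bimodule \<Rightarrow> ('n, 'k, 'p) bimodule \<Rightarrow> ('m \<times> 'p \<Rightarrow>\<^sub>0 int) set" where
  "tensor_relators M N =
     {frag_of (x \<oplus>\<^bsub>M\<^esub> x', y) - frag_of (x, y) - frag_of (x', y) | x x' y.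
        x \<in> carrier M \<and> x' \<in> carrier M \<and> y \<in> carrier N} \<union>
     {frag_of (x, y \<oplus>\<^bsub>N\<^esub> y') - frag_of (x, y) - frag_of (x, y') | x y y'.
        x \<in> carrier M \<and> y \<in> carrier N \<and> y' \<in> carrier N} \<union>
     {frag_of (ract M x a, y) - frag_of (x, lact N a y) | x a y.
        x \<in> carrier M \<and> y \<in> carrier N}"

abbreviation tensor_free ::
  "('n, 'k::field, 'm) bimodule \<Rightarrow> ('n, 'k, 'p) bimodule \<Rightarrow> ('m \<times> 'p \<Rightarrow>\<^sub>0 int) monoid" where
  "tensor_free M N \<equiv> free_Abelian_group (carrier M \<times> carrier N)"

definition tensor_subgroup ::
  "('n, 'k::field, 'm) bimodule \<Rightarrow> ('n, 'k, 'p) bimodule \<Rightarrow> ('m \<times> 'p \<Rightarrow>\<^sub>0 int) set" where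
  "tensor_subgroup M N = generate (tensor_free M N) (tensor_relators M N)"

text \<open>
  The map on cosets induced by $m \otimes n \mapsto g(m,n)$.  When $g$ respects the relations,
  the cosets in the union all coincide.
\<close>

definition tensor_map ::
  "('n, 'k::field, 'm) bimodule \<Rightarrow> ('n, 'k, 'p) bimodule \<Rightarrow> ('m \<times> 'p \<Rightarrow> 'm \<times> 'p) \<Rightarrow>
     ('m \<times> 'p \<Rightarrow>\<^sub>0 int) set \<Rightarrow> ('m \<times> 'p \<Rightarrow>\<^sub>0 int) set" where
  "tensor_map M N g C =
     (\<Union>u\<in>C. tensor_subgroup M N #>\<^bsub>tensor_free M N\<^esub> frag_extend (\<lambda>z. frag_of (g z)) u)"

text \<open>The fields \<open>mult\<close> and \<open>one\<close> of a module record play no role.\<close>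

definition tensor_product ::
  "('n, 'k::field, 'm) bimodule \<Rightarrow> ('n, 'k, 'p) bimodule \<Rightarrow>
     ('n, 'k, ('m \<times> 'p \<Rightarrow>\<^sub>0 int) set) bimodule" where
  "tensor_product M N =
     (let Q = tensor_free M N Mod tensor_subgroup M N in
      \<lparr>carrier = carrier Q, mult = undefined, one = undefined,
       zero = \<one>\<^bsub>Q\<^esub>, add = (\<otimes>\<^bsub>Q\<^esub>),
       smult = (\<lambda>c. tensor_map M N (\<lambda>(x, y). (c \<odot>\<^bsub>M\<^esub> x, y))),
       lact = (\<lambda>a. tensor_map M N (\<lambda>(x, y). (lact M a x, y))),
       ract = (\<lambda>C a. tensor_map M N (\<lambda>(x, y). (x, ract N y a)) C)\<rparr>)"

end

theory Submission
  imports Defs "HOL-Library.Function_Algebras"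
begin

text \<open>
  Choose right generators of \<open>M\<close>.  Expanding the left translates of the generators by
  \<open>x\<^sub>i\<close> and \<open>\<partial>\<^sub>i\<close> in terms of them involves coefficients of some degree below a constant \<open>c\<close>, so
  the tensors of the generators with the \<open>c i\<close>-th step of a good filtration of \<open>N\<close> span the \<open>i\<close>-th
  step of a filtration of the tensor product that is compatible with the Bernstein filtration.
  Its dimensions are bounded by a multiple of \<open>(i + 1)\<^bsup>2n\<^esup>\<close>.

  By Bernstein's criterion such a growth bound implies finite generation and holonomicity.  Every
  nonzero cyclic module grows at least like \<open>i\<^bsup>2n\<^esup>\<close>, because an operator that annihilates enough of it
  vanishes (compare dimensions in the action of \<open>B\<^sub>i\<close> as maps from \<open>\<Gamma>\<^sub>i\<close> to \<open>\<Gamma>\<^sub>2\<^sub>i\<close>); hence strict chains of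
  finitely generated submodules have bounded length.  Hilbert polynomials, needed for the dimension
  to be well defined, come from a monomial basis selected greedily along a term order: its exponents form
  down-sets, whose counting functions are eventually polynomial by Dickson's lemma.
\<close>

section \<open>Eventually polynomial functions\<close>

text \<open>The argument therefore runs on arbitrary filtrations compatible with the generators, of
  which only a growth bound is known. Stretching the index of the filtration of \<open>N\<close>
  makes room for coefficients of any fixed degree that cross the tensor sign, and it changes only
  the constant of the growth bound, not the exponent.

  The critical exponent is half the number of generators of the acting algebra: the operators of
  degree at most i form a space of order i to that full number, while a space of linear maps has the
  product of two dimensions. The lower bounds obtained in this way hold along multiples of a
  constant, and this is enough to compare degrees.

  The greedy basis takes the place of the associated graded module. It uses only that a generator
  raises one exponent up to terms of lower degree. Multiplicities never enter: chains of submodules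
  are bounded by the crude constant of the growth bound.\<close>

definition eventually_poly :: "(nat \<Rightarrow> nat) \<Rightarrow> bool" where
  "eventually_poly h \<longleftrightarrow> (\<exists>p :: rat poly. \<forall>\<^sub>F i in sequentially. of_nat (h i) = poly p (of_nat i))"

lemma eventually_poly_cong:
  assumes "\<forall>\<^sub>F i in sequentially. h i = h' i" "eventually_poly h'"
  shows "eventually_poly h"
proof -
  from assms(2) obtain p :: "rat poly" where "\<forall>\<^sub>F i in sequentially. of_nat (h' i) = poly p (of_nat i)"
    by (auto simp: eventually_poly_def)
  with assms(1) have "\<forall>\<^sub>F i in sequentially. of_nat (h i) = poly p (of_nat i)"
    by eventually_elim simp
  then show ?thesis by (auto simp: eventually_poly_def)
qed

lemma eventually_poly_const: "eventually_poly (\<lambda>_. c)"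
  unfolding eventually_poly_def by (rule exI[of _ "[:of_nat c:]"]) simp

lemma eventually_poly_add:
  assumes "eventually_poly f" "eventually_poly g"
  shows "eventually_poly (\<lambda>i. f i + g i)"
proof -
  from assms obtain p q :: "rat poly" where
    "\<forall>\<^sub>F i in sequentially. of_nat (f i) = poly p (of_nat i)"
    "\<forall>\<^sub>F i in sequentially. of_nat (g i) = poly q (of_nat i)"
    by (auto simp: eventually_poly_def)
  then have "\<forall>\<^sub>F i in sequentially. of_nat (f i + g i) = poly (p + q) (of_nat i)"
    by eventually_elim simp
  then show ?thesis unfolding eventually_poly_def by blast
qed

lemma eventually_poly_sum:
  assumes "finite A" "\<And>a. a \<in> A \<Longrightarrow> eventually_poly (f a)"
  shows "eventually_poly (\<lambda>i. \<Sum>a\<in>A. f a i)"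
  using assms by (induction A) (auto intro: eventually_poly_const eventually_poly_add)

lemma eventually_poly_shift:
  assumes "eventually_poly f"
  shows "eventually_poly (\<lambda>i. f (i - c))"
proof -
  from assms obtain p :: "rat poly" where
    "\<forall>\<^sub>F i in sequentially. of_nat (f i) = poly p (of_nat i)"
    by (auto simp: eventually_poly_def)
  then obtain K where K: "\<And>i. i \<ge> K \<Longrightarrow> of_nat (f i) = poly p (of_nat i)"
    by (auto simp: eventually_sequentially)
  \<comment> \<open>From \<open>c\<close> on the truncated subtraction is a true one, so composition
    with x - c gives the polynomial.\<close>
  have "of_nat (f (i - c)) = poly (pcompose p [:- of_nat c, 1:]) (of_nat i)" if "i \<ge> K + c" for i
    using that K[of "i - c"] by (simp add: poly_pcompose of_nat_diff)
  then show ?thesis unfolding eventually_poly_def eventually_sequentially by blast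
qed

text \<open>The difference of the power \<open>Suc d\<close> is \<open>Suc d\<close> times the power
  \<open>d\<close> plus lower powers, by the binomial theorem. Antidifferences of the lower powers
  are known by induction and can be subtracted.\<close>

lemma power_antidifference:
  "\<exists>q :: rat poly. \<forall>x. poly q (x + 1) - poly q x = x ^ d"
proof (induction d rule: less_induct)
  case (less d)
  then obtain Q :: "nat \<Rightarrow> rat poly" where
    Q: "\<And>k x. k < d \<Longrightarrow> poly (Q k) (x + 1) - poly (Q k) x = x ^ k"
    by metis
  let ?c = "\<lambda>k. of_nat (Suc d choose k) :: rat"
  define q where "q = Polynomial.smult (1 / of_nat (Suc d)) (monom 1 (Suc d) - (\<Sum>k<d. Polynomial.smult (?c k) (Q k)))"
  have "poly q (x + 1) - poly q x = x ^ d" for x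
  proof -
    have bin: "(x + 1) ^ Suc d = (\<Sum>k<d. ?c k * x ^ k) + of_nat (Suc d) * x ^ d + x ^ Suc d"
    proof -
      have "(x + 1) ^ Suc d = (\<Sum>k\<le>Suc d. ?c k * x ^ k)"
        using binomial_ring[of x 1 "Suc d"] by simp
      also have "\<dots> = (\<Sum>k<d. ?c k * x ^ k) + ?c d * x ^ d + ?c (Suc d) * x ^ Suc d"
        by (simp add: lessThan_Suc_atMost[symmetric])
      finally show ?thesis using binomial_Suc_n[of d] by simp
    qed
    have "poly q (x + 1) - poly q x = (1 / of_nat (Suc d)) *
       ((x + 1) ^ Suc d - x ^ Suc d - (\<Sum>k<d. ?c k * (poly (Q k) (x + 1) - poly (Q k) x)))"
      by (simp add: q_def poly_sum poly_monom right_diff_distrib sum_subtractf del: power_Suc of_nat_Suc binomial_Suc_Suc)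
    also have "(\<Sum>k<d. ?c k * (poly (Q k) (x + 1) - poly (Q k) x)) = (\<Sum>k<d. ?c k * x ^ k)"
      by (rule sum.cong) (use Q in auto)
    also have "(x + 1) ^ Suc d - x ^ Suc d - (\<Sum>k<d. ?c k * x ^ k) = of_nat (Suc d) * x ^ d"
      by (simp only: bin)
    finally show ?thesis by (simp del: of_nat_Suc)
  qed
  then show ?case by blast
qed

lemma poly_antidifference:
  fixes p :: "rat poly"
  shows "\<exists>q :: rat poly. \<forall>x. poly q (x + 1) - poly q x = poly p x"
proof -
  obtain Q :: "nat \<Rightarrow> rat poly" where Q: "\<And>k x. poly (Q k) (x + 1) - poly (Q k) x = x ^ k"
    using power_antidifference by metis
  let ?q = "\<Sum>k\<le>degree p. Polynomial.smult (coeff p k) (Q k)"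
  have "poly ?q (x + 1) - poly ?q x = (\<Sum>k\<le>degree p. coeff p k * (poly (Q k) (x + 1) - poly (Q k) x))" for x
    by (simp add: poly_sum right_diff_distrib sum_subtractf)
  then have "poly ?q (x + 1) - poly ?q x = poly p x" for x
    by (simp only: Q) (simp add: poly_altdef)
  then show ?thesis by blast
qed

lemma eventually_poly_partial_sums:
  assumes "eventually_poly f"
  shows "eventually_poly (\<lambda>i. \<Sum>m\<le>i. f m)"
proof -
  from assms obtain p :: "rat poly" where
    "\<forall>\<^sub>F i in sequentially. of_nat (f i) = poly p (of_nat i)"
    by (auto simp: eventually_poly_def)
  then obtain K where K: "\<And>i. i \<ge> K \<Longrightarrow> of_nat (f i) = poly p (of_nat i)"
    by (auto simp: eventually_sequentially)
  \<comment> \<open>The shift by one is needed because passing from i to \<open>Suc i\<close> adds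
    the summand at \<open>Suc i\<close>.\<close>
  obtain q :: "rat poly" where q: "\<And>x. poly q (x + 1) - poly q x = poly (pcompose p [:1, 1:]) x"
    using poly_antidifference by metis
  \<comment> \<open>The constant absorbs the summands up to \<open>K\<close>, where \<open>f\<close>
    and \<open>p\<close> may disagree.\<close>
  let ?r = "[:of_nat (\<Sum>m\<le>K. f m) - poly q (of_nat K):] + q"
  have "of_nat (\<Sum>m\<le>i. f m) = poly ?r (of_nat i)" if "i \<ge> K" for i
    using that
  proof (induction i rule: dec_induct)
    case (step i)
    have "poly q (of_nat (Suc i)) = poly q (of_nat i) + of_nat (f (Suc i))"
      using q[of "of_nat i"] K[of "Suc i"] step.hyps by (simp add: poly_pcompose add.commute)
    with step.IH show ?case by simp
  qed simp
  then show ?thesis unfolding eventually_poly_def eventually_sequentially by blast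
qed

section \<open>Degrees of polynomials and growth bounds\<close>

lemma poly_bound:
  fixes p :: "rat poly"
  shows "\<exists>C. \<forall>i. \<bar>poly p (of_nat i)\<bar> \<le> of_nat (C * (i + 1) ^ degree p)"
proof -
  let ?C = "\<Sum>k\<le>degree p. nat \<lceil>\<bar>coeff p k\<bar>\<rceil>"
  have "\<bar>poly p (of_nat i)\<bar> \<le> of_nat (?C * (i + 1) ^ degree p)" for i
  proof -
    have "\<bar>poly p (of_nat i)\<bar> \<le> (\<Sum>k\<le>degree p. \<bar>coeff p k * of_nat i ^ k\<bar>)"
      unfolding poly_altdef by (rule sum_abs)
    also have "\<dots> \<le> (\<Sum>k\<le>degree p. of_nat (nat \<lceil>\<bar>coeff p k\<bar>\<rceil>) * of_nat ((i + 1) ^ degree p))"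
    proof (rule sum_mono)
      fix k assume "k \<in> {..degree p}"
      have 1: "\<bar>coeff p k\<bar> \<le> of_nat (nat \<lceil>\<bar>coeff p k\<bar>\<rceil>)"
        by (rule of_nat_ceiling)
      have "i ^ k \<le> (i + 1) ^ k" by (simp add: power_mono)
      also have "\<dots> \<le> (i + 1) ^ degree p"
        using \<open>k \<in> _\<close> by (intro power_increasing) auto
      finally have "(of_nat (i ^ k) :: rat) \<le> of_nat ((i + 1) ^ degree p)"
        by (rule of_nat_mono)
      with 1 show "\<bar>coeff p k * of_nat i ^ k\<bar> \<le> of_nat (nat \<lceil>\<bar>coeff p k\<bar>\<rceil>) * of_nat ((i + 1) ^ degree p)"
        by (auto simp: abs_mult intro!: mult_mono)
    qed
    finally show ?thesis by (simp add: sum_distrib_right)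
  qed
  then show ?thesis by blast
qed

text \<open>Horner's scheme: once the inner polynomial stays above \<epsilon>, its product with i
  outgrows the constant term. Mere positivity of the inner polynomial would not survive this step,
  hence the uniform \<epsilon>.\<close>

lemma poly_pos_at_top:
  fixes p :: "rat poly"
  assumes "lead_coeff p > 0"
  shows "\<exists>\<epsilon>>0. \<exists>n. \<forall>i\<ge>n. \<epsilon> \<le> poly p (of_nat i)"
  using assms
proof (induction p)
  case (pCons a q)
  show ?case
  proof (cases "q = 0")
    case True
    then show ?thesis using pCons.prems by (intro exI[of _ a]) simp
  next
    case False
    then obtain \<epsilon> n where \<epsilon>: "\<epsilon> > 0" "\<And>i. i \<ge> n \<Longrightarrow> \<epsilon> \<le> poly q (of_nat i)"
      using pCons by auto
    obtain m where m: "(\<epsilon> - a) / \<epsilon> \<le> of_nat m" using real_arch_simple by blast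
    have "\<epsilon> \<le> poly (pCons a q) (of_nat i)" if "i \<ge> max m n" for i
    proof -
      have "(\<epsilon> - a) / \<epsilon> \<le> of_nat i"
        using m that by (meson max.boundedE of_nat_mono order.trans)
      then have "\<epsilon> - a \<le> of_nat i * \<epsilon>" using \<epsilon>(1) by (simp add: pos_divide_le_eq)
      also have "\<dots> \<le> of_nat i * poly q (of_nat i)"
        using \<epsilon>(2) that by (intro mult_left_mono) auto
      finally show ?thesis by simp
    qed
    with \<epsilon>(1) show ?thesis by blast
  qed
qed simp

text \<open>A negative leading coefficient contradicts the lower bound by 0. With a positive one and
  too large a degree, \<open>p\<close> minus the bound keeps the leading coefficient of
  \<open>p\<close> and becomes positive.\<close>

lemma degree_le_of_bound:
  fixes p :: "rat poly"
  assumes "\<forall>\<^sub>F i in sequentially. poly p (of_nat i) \<le> of_nat (C * (i + 1) ^ d)"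
    and "\<forall>\<^sub>F i in sequentially. 0 \<le> poly p (of_nat i)"
  shows "degree p \<le> d"
proof (rule ccontr)
  assume "\<not> degree p \<le> d"
  then have d: "d < degree p" by simp
  let ?r = "Polynomial.smult (of_nat C) ([:1, 1:] ^ d) :: rat poly"
  have deg_r: "degree ?r \<le> d"
    by (rule order.trans[OF degree_smult_le]) (use degree_power_le[of "[:1, 1:] :: rat poly" d] in simp)
  have r: "poly ?r (of_nat i) = of_nat (C * (i + 1) ^ d)" for i
    by (simp add: add.commute)
  have lc: "lead_coeff p \<noteq> 0" using d by auto
  show False
  proof (cases "lead_coeff p > 0")
    case True
    let ?q = "p + - (?r + 1)"
    have deg: "degree (?r + 1) < degree p"
      using deg_r d degree_add_le[of ?r d 1] by simp
    have "degree ?q = degree p"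
      by (rule degree_add_eq_left) (use deg in \<open>simp only: degree_minus\<close>)
    moreover have "coeff ?q (degree p) = coeff p (degree p)"
      using coeff_eq_0[OF deg] by (simp only: coeff_add coeff_minus)
    ultimately have "lead_coeff ?q > 0" using True by simp
    then obtain \<epsilon> n where n: "\<epsilon> > 0" "\<And>i. i \<ge> n \<Longrightarrow> \<epsilon> \<le> poly ?q (of_nat i)"
      using poly_pos_at_top[of ?q] by blast
    from assms(1) obtain K where K: "\<And>i. i \<ge> K \<Longrightarrow> poly p (of_nat i) \<le> of_nat (C * (i + 1) ^ d)"
      by (auto simp: eventually_sequentially)
    have "poly ?r (of_nat (max n K)) < poly p (of_nat (max n K))"
      using n(1) n(2)[of "max n K"] by simp
    with K[of "max n K"] show False unfolding r by simp
  next
    case False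
    with lc have "lead_coeff (- p) > 0" by (simp only: lead_coeff_minus)
    then obtain \<epsilon> n where n: "\<epsilon> > 0" "\<And>i. i \<ge> n \<Longrightarrow> \<epsilon> \<le> poly (- p) (of_nat i)"
      using poly_pos_at_top[of "- p"] by blast
    from assms(2) obtain K where K: "\<And>i. i \<ge> K \<Longrightarrow> 0 \<le> poly p (of_nat i)"
      by (auto simp: eventually_sequentially)
    show False using n(1) n(2)[of "max n K"] K[of "max n K"] by simp
  qed
qed

lemma eventually_poly_growth:
  fixes p :: "rat poly"
  assumes "\<forall>\<^sub>F i in sequentially. of_nat (h i) = poly p (of_nat i)"
  shows "\<exists>C. \<forall>i. h i \<le> C * (i + 1) ^ degree p"
proof -
  obtain K where K: "\<And>i. i \<ge> K \<Longrightarrow> of_nat (h i) = poly p (of_nat i)"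
    using assms by (auto simp: eventually_sequentially)
  obtain C where C: "\<And>i. \<bar>poly p (of_nat i)\<bar> \<le> of_nat (C * (i + 1) ^ degree p)"
    using poly_bound by blast
  \<comment> \<open>The finitely many exceptional values are paid for by adding their sum to the
    constant, so that the bound holds for every i.\<close>
  have "h i \<le> (C + (\<Sum>j<K. h j)) * (i + 1) ^ degree p" for i
  proof (cases "i < K")
    case True
    then have "h i \<le> (\<Sum>j<K. h j) * 1" using member_le_sum[of i "{..<K}" h] by simp
    also have "\<dots> \<le> (C + (\<Sum>j<K. h j)) * (i + 1) ^ degree p"
      by (intro mult_mono) auto
    finally show ?thesis .
  next
    case False
    then have "(of_nat (h i) :: rat) \<le> of_nat (C * (i + 1) ^ degree p)"
      using K[of i] C[of i] by linarith
    then have "h i \<le> C * (i + 1) ^ degree p" by (simp only: of_nat_le_iff)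
    also have "\<dots> \<le> (C + (\<Sum>j<K. h j)) * (i + 1) ^ degree p"
      by (intro mult_right_mono) auto
    finally show ?thesis .
  qed
  then show ?thesis by blast
qed

text \<open>The lower bounds on dimensions proved below are available only along multiples of a
  constant; this is the role of \<open>a\<close>.\<close>

lemma degree_ge_of_bound:
  fixes p :: "rat poly"
  assumes "a > 0" "\<And>q. q \<ge> K \<Longrightarrow> of_nat (q ^ d) \<le> poly p (of_nat (a * q))"
  shows "d \<le> degree p"
proof (rule ccontr)
  assume "\<not> d \<le> degree p"
  then have lt: "degree p < d" by simp
  obtain C where C: "\<And>i. \<bar>poly p (of_nat i)\<bar> \<le> of_nat (C * (i + 1) ^ degree p)"
    using poly_bound by blast
  let ?D = "degree p"
  \<comment> \<open>The first summand lets one factor \<open>q\<close> beat the constant that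
    remains after \<open>q\<close> to the power \<open>?D\<close> is split off; \<open>K\<close>
    makes the hypothesis applicable, and 1 gives strictness and \<open>q\<close> at least 1.\<close>
  define q where "q = C * (a + 1) ^ ?D + K + 1"
  have "of_nat (q ^ d) \<le> (of_nat (C * (a * q + 1) ^ ?D) :: rat)"
    using assms(2)[of q] C[of "a * q"] by (simp only: q_def) linarith
  then have "q ^ d \<le> C * (a * q + 1) ^ ?D" by (simp only: of_nat_le_iff)
  also have "\<dots> \<le> C * ((a + 1) * q) ^ ?D"
    by (intro mult_left_mono power_mono) (auto simp: q_def)
  also have "\<dots> = (C * (a + 1) ^ ?D) * q ^ ?D" by (simp only: power_mult_distrib mult.assoc)
  also have "\<dots> < q * q ^ ?D" by (rule mult_strict_right_mono) (simp_all add: q_def)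
  also have "\<dots> = q ^ Suc ?D" by simp
  also have "\<dots> \<le> q ^ d" using lt by (intro power_increasing) (auto simp: q_def)
  finally show False by simp
qed

section \<open>Down-sets of exponent vectors\<close>

text \<open>Every sequence has a monotone subsequence, and a decreasing one of natural numbers is
  eventually constant.\<close>

lemma nat_seq_mono_subseq:
  fixes f :: "nat \<Rightarrow> nat"
  shows "\<exists>r :: nat \<Rightarrow> nat. strict_mono r \<and> (\<forall>i j. i \<le> j \<longrightarrow> f (r i) \<le> f (r j))"
proof -
  obtain r where r: "strict_mono r" "monoseq (\<lambda>n. f (r n))"
    using seq_monosub[of f] by blast
  show ?thesis
  proof (cases "\<forall>m n. m \<le> n \<longrightarrow> f (r m) \<le> f (r n)")
    case True
    with r show ?thesis by blast
  next
    case False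
    then have dec: "\<And>m n. m \<le> n \<Longrightarrow> f (r n) \<le> f (r m)"
      using r(2) unfolding monoseq_def by blast
    define v where "v = (LEAST x. \<exists>n. x = f (r n))"
    have "\<exists>n. v = f (r n)" unfolding v_def by (rule LeastI_ex) blast
    then obtain n0 where n0: "v = f (r n0)" by blast
    have "v \<le> f (r n)" for n unfolding v_def by (rule Least_le) blast
    then have const: "f (r n) = v" if "n \<ge> n0" for n
      using dec[OF that] n0 by (simp add: le_antisym)
    have "strict_mono (\<lambda>n. r (n0 + n))"
      using r(1) by (simp add: strict_mono_def)
    then show ?thesis using const by (intro exI[of _ "\<lambda>n. r (n0 + n)"]) simp
  qed
qed

text \<open>Dickson's lemma as a statement on sequences. Subsequences are extracted one coordinate
  at a time, and refinement preserves monotonicity in the coordinates already treated.\<close>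

lemma dickson:
  fixes f :: "nat \<Rightarrow> 'v \<Rightarrow> nat"
  assumes "finite A"
  shows "\<exists>r :: nat \<Rightarrow> nat. strict_mono r \<and> (\<forall>i j. i \<le> j \<longrightarrow> (\<forall>v\<in>A. f (r i) v \<le> f (r j) v))"
  using assms
proof (induction A)
  case empty
  show ?case by (rule exI[of _ id]) (simp add: strict_mono_def)
next
  case (insert a A)
  then obtain r :: "nat \<Rightarrow> nat" where r: "strict_mono r" "\<And>i j v. i \<le> j \<Longrightarrow> v \<in> A \<Longrightarrow> f (r i) v \<le> f (r j) v"
    by auto
  obtain s :: "nat \<Rightarrow> nat" where s: "strict_mono s" "\<And>i j. i \<le> j \<Longrightarrow> f (r (s i)) a \<le> f (r (s j)) a"
    using nat_seq_mono_subseq[of "\<lambda>n. f (r n) a"] by blast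
  have "strict_mono (r \<circ> s)" using r(1) s(1) by (simp add: strict_mono_def)
  moreover have "f ((r \<circ> s) i) v \<le> f ((r \<circ> s) j) v" if "i \<le> j" "v \<in> insert a A" for i j v
    using that s(2) r(2) s(1) by (auto simp: strict_mono_less_eq)
  ultimately show ?case by blast
qed

text \<open>These are the complements of monomial ideals.\<close>

definition down_set :: "('v \<Rightarrow> nat) set \<Rightarrow> bool" where
  "down_set D \<longleftrightarrow> (\<forall>\<mu>\<in>D. \<forall>\<nu>. \<nu> \<le> \<mu> \<longrightarrow> \<nu> \<in> D)"

text \<open>Keeps all exponents in one type while the set of active variables varies, so that an
  induction over the variables is possible.\<close>

definition supported :: "'v set \<Rightarrow> ('v \<Rightarrow> nat) set" where
  "supported A = {\<mu>. \<forall>v. v \<notin> A \<longrightarrow> \<mu> v = 0}"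

text \<open>If the sets dropped infinitely often, choose an exponent lost at each drop. Dickson's
  lemma finds a later lost exponent above an earlier one. It still lies in the set after the earlier
  drop, which would then contain the earlier exponent too.\<close>

lemma decreasing_down_sets_stabilize:
  assumes "finite A" "\<And>c. D c \<subseteq> supported A" "\<And>c. down_set (D c)" "\<And>c. D (Suc c) \<subseteq> D c"
  shows "\<exists>c0. \<forall>c\<ge>c0. D c = D c0"
proof -
  have anti: "D c \<subseteq> D b" if "b \<le> c" for b c
    using that by (induction c rule: dec_induct) (use assms(4) in auto)
  have "\<exists>c0. \<forall>c\<ge>c0. D (Suc c) = D c"
  proof (rule ccontr)
    assume "\<not> ?thesis"
    then have "\<forall>c0. \<exists>c\<ge>c0. \<exists>\<mu>. \<mu> \<in> D c \<and> \<mu> \<notin> D (Suc c)" using assms(4) by blast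
    then obtain g \<mu> where g: "\<And>c0. g c0 \<ge> c0" "\<And>c0. \<mu> c0 \<in> D (g c0)" "\<And>c0. \<mu> c0 \<notin> D (Suc (g c0))"
      by metis
    obtain r :: "nat \<Rightarrow> nat" where r: "strict_mono r" "\<And>i j v. i \<le> j \<Longrightarrow> v \<in> A \<Longrightarrow> \<mu> (r i) v \<le> \<mu> (r j) v"
      using dickson[OF assms(1), of \<mu>] by auto
    \<comment> \<open>The subsequence is followed until its index has passed the first drop.\<close>
    obtain j where j: "j \<ge> 0" "r j \<ge> Suc (g (r 0))"
      using r(1) by (metis le0 seq_suble)
    have "\<mu> (r 0) \<le> \<mu> (r j)"
    proof (rule le_funI)
      fix v
      show "\<mu> (r 0) v \<le> \<mu> (r j) v"
      proof (cases "v \<in> A")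
        case False
        then have "\<mu> (r 0) v = 0" using g(2)[of "r 0"] assms(2) unfolding supported_def by blast
        then show ?thesis by simp
      qed (use r(2)[OF j(1)] in blast)
    qed
    moreover have "\<mu> (r j) \<in> D (Suc (g (r 0)))"
      using g(1)[of "r j"] g(2)[of "r j"] j(2) anti[of "Suc (g (r 0))" "g (r j)"] by auto
    ultimately have "\<mu> (r 0) \<in> D (Suc (g (r 0)))" using assms(3) unfolding down_set_def by blast
    with g(3) show False by blast
  qed
  then obtain c0 where c0: "\<And>c. c \<ge> c0 \<Longrightarrow> D (Suc c) = D c" by blast
  have "D c = D c0" if "c \<ge> c0" for c
    using that by (induction c rule: dec_induct) (use c0 in auto)
  then show ?thesis by blast
qed

lemma finite_bounded_exponents:
  fixes A :: "'v set"
  assumes "finite A"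
  shows "finite {\<mu> \<in> supported A. sum \<mu> A \<le> i}"
proof (rule finite_subset)
  show "{\<mu> \<in> supported A. sum \<mu> A \<le> i} \<subseteq> {\<mu>. \<forall>v. (v \<in> A \<longrightarrow> \<mu> v \<in> {..i}) \<and> (v \<notin> A \<longrightarrow> \<mu> v = 0)}"
  proof clarify
    fix \<mu> v assume "\<mu> \<in> supported A" "sum \<mu> A \<le> i"
    then show "(v \<in> A \<longrightarrow> \<mu> v \<in> {..i}) \<and> (v \<notin> A \<longrightarrow> \<mu> v = 0)"
      using member_le_sum[of v A \<mu>] assms by (auto simp: supported_def)
  qed
  show "finite {\<mu>. \<forall>v. (v \<in> A \<longrightarrow> \<mu> v \<in> {..i}) \<and> (v \<notin> A \<longrightarrow> \<mu> v = (0::nat))}"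
    using assms by (intro finite_set_of_finite_funs) auto
qed

text \<open>Slice along one variable: the slices decrease and hence stabilise, so the count is a finite sum
  of shifted counts plus a partial sum of a single count.\<close>

lemma down_set_count_eventually_poly:
  assumes "finite A" "D \<subseteq> supported A" "down_set D"
  shows "eventually_poly (\<lambda>i. card {\<mu> \<in> D. sum \<mu> A \<le> i})"
  using assms
proof (induction A arbitrary: D)
  case empty
  show ?case by (rule eventually_poly_cong[OF _ eventually_poly_const[of "card D"]]) simp
next
  case (insert a A)
  \<comment> \<open>Slices are recorded with coordinate \<open>a\<close> reset to 0, so that all of
    them lie in \<open>supported A\<close> and can be compared.\<close>
  define S where "S c = {\<mu> \<in> supported A. \<mu>(a := c) \<in> D}" for c
  have S_sub: "S c \<subseteq> supported A" for c by (auto simp: S_def)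
  have S_down: "down_set (S c)" for c
    unfolding down_set_def
  proof (intro ballI allI impI)
    fix \<mu> \<nu> assume "\<mu> \<in> S c" and le: "\<nu> \<le> \<mu>"
    then have \<mu>: "\<mu> \<in> supported A" "\<mu>(a := c) \<in> D" by (auto simp: S_def)
    have "\<nu> \<in> supported A"
      unfolding supported_def
    proof clarify
      fix v assume "v \<notin> A"
      then show "\<nu> v = 0" using \<mu>(1) le_funD[OF le, of v] by (simp add: supported_def)
    qed
    moreover have "\<nu>(a := c) \<le> \<mu>(a := c)" using le by (simp add: le_fun_def)
    ultimately show "\<nu> \<in> S c" using \<mu>(2) insert.prems(2) by (auto simp: S_def down_set_def)
  qed
  have S_dec: "S (Suc c) \<subseteq> S c" for c
  proof
    fix \<mu> assume "\<mu> \<in> S (Suc c)"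
    moreover have "\<mu>(a := c) \<le> \<mu>(a := Suc c)" by (simp add: le_fun_def)
    ultimately show "\<mu> \<in> S c" using insert.prems(2) by (auto simp: S_def down_set_def)
  qed
  obtain c0 where c0: "\<And>c. c \<ge> c0 \<Longrightarrow> S c = S c0"
    using decreasing_down_sets_stabilize[of A S, OF insert.hyps(1) S_sub S_down S_dec] by blast
  define h where "h c i = card {\<mu> \<in> S c. sum \<mu> A \<le> i}" for c i
  have hc: "h c = h c0" if "c \<ge> c0" for c
    unfolding h_def c0[OF that] ..
  have h_poly: "eventually_poly (h c)" for c
    unfolding h_def by (rule insert.IH[OF S_sub S_down])
  have sumA: "sum (\<mu>(a := c)) A = sum \<mu> A" for \<mu> :: "'a \<Rightarrow> nat" and c
    using insert.hyps(2) by (intro sum.cong) auto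
  have count: "card {\<mu> \<in> D. sum \<mu> (insert a A) \<le> i} = (\<Sum>c\<le>i. h c (i - c))" for i
  proof -
    let ?F = "\<lambda>c. (\<lambda>\<mu>. \<mu>(a := c)) ` {\<mu> \<in> S c. sum \<mu> A \<le> i - c}"
    have "{\<mu> \<in> D. sum \<mu> (insert a A) \<le> i} = (\<Union>c\<in>{..i}. ?F c)"
    proof (intro equalityI subsetI)
      fix \<mu> assume "\<mu> \<in> {\<mu> \<in> D. sum \<mu> (insert a A) \<le> i}"
      then have \<mu>: "\<mu> \<in> D" "\<mu> a + sum \<mu> A \<le> i" using insert.hyps by auto
      then have "\<mu>(a := 0) \<in> supported A" using insert.prems(1) by (auto simp: supported_def)
      with \<mu> have "\<mu>(a := 0) \<in> S (\<mu> a)" by (simp add: S_def)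
      moreover have "sum (\<mu>(a := 0)) A \<le> i - \<mu> a" using \<mu>(2) by (simp only: sumA)
      moreover have "\<mu> = (\<mu>(a := 0))(a := \<mu> a)" by simp
      ultimately have "\<mu> \<in> ?F (\<mu> a)" by (intro image_eqI[of \<mu> _ "\<mu>(a := 0)"]) auto
      then show "\<mu> \<in> (\<Union>c\<in>{..i}. ?F c)" using \<mu>(2) by auto
    next
      fix \<mu> assume "\<mu> \<in> (\<Union>c\<in>{..i}. ?F c)"
      then obtain c \<nu> where "c \<le> i" "\<nu> \<in> S c" "sum \<nu> A \<le> i - c" "\<mu> = \<nu>(a := c)" by auto
      then show "\<mu> \<in> {\<mu> \<in> D. sum \<mu> (insert a A) \<le> i}"
        using insert.hyps sumA[of \<nu> c] by (auto simp: S_def)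
    qed
    also have "card \<dots> = (\<Sum>c\<le>i. card (?F c))"
    proof (rule card_UN_disjoint)
      show "\<forall>c\<in>{..i}. finite (?F c)"
      proof
        fix c
        have "finite {\<mu> \<in> S c. sum \<mu> A \<le> i - c}"
          by (rule finite_subset[OF _ finite_bounded_exponents[OF insert.hyps(1), of "i - c"]]) (use S_sub in auto)
        then show "finite (?F c)" by simp
      qed
      show "\<forall>c\<in>{..i}. \<forall>d\<in>{..i}. c \<noteq> d \<longrightarrow> ?F c \<inter> ?F d = {}"
        by (force dest: fun_cong[of _ _ a])
    qed simp
    also have "\<dots> = (\<Sum>c\<le>i. h c (i - c))"
    proof (rule sum.cong[OF refl])
      fix c
      have "inj_on (\<lambda>\<mu>. \<mu>(a := c)) {\<mu> \<in> S c. sum \<mu> A \<le> i - c}"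
      proof (rule inj_onI)
        fix \<mu> \<nu> assume "\<mu> \<in> {\<mu> \<in> S c. sum \<mu> A \<le> i - c}" "\<nu> \<in> {\<mu> \<in> S c. sum \<mu> A \<le> i - c}"
          and eq: "\<mu>(a := c) = \<nu>(a := c)"
        then have "\<mu> a = 0" "\<nu> a = 0" using insert.hyps(2) by (auto simp: S_def supported_def)
        then show "\<mu> = \<nu>" using eq by (metis fun_upd_triv fun_upd_upd)
      qed
      then show "card (?F c) = h c (i - c)" unfolding h_def by (rule card_image)
    qed
    finally show ?thesis .
  qed
  have "(\<Sum>c\<le>i. h c (i - c)) = (\<Sum>c<c0. h c (i - c)) + (\<Sum>m\<le>i - c0. h c0 m)" if "i \<ge> c0" for i
  proof -
    have "{..i} = {..<c0} \<union> {c0..i}" using that by auto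
    then have "(\<Sum>c\<le>i. h c (i - c)) = (\<Sum>c<c0. h c (i - c)) + (\<Sum>c=c0..i. h c (i - c))"
      by (simp only:) (rule sum.union_disjoint, auto)
    also have "(\<Sum>c=c0..i. h c (i - c)) = (\<Sum>c=c0..i. h c0 (i - c))"
      by (intro sum.cong refl) (metis atLeastAtMost_iff hc)
    also have "\<dots> = (\<Sum>m\<le>i - c0. h c0 m)"
      by (rule sum.reindex_bij_witness[of _ "\<lambda>m. i - m" "\<lambda>c. i - c"]) (use that in auto)
    finally show ?thesis .
  qed
  then have "\<forall>\<^sub>F i in sequentially. card {\<mu> \<in> D. sum \<mu> (insert a A) \<le> i}
      = (\<Sum>c<c0. h c (i - c)) + (\<Sum>m\<le>i - c0. h c0 m)"
    unfolding eventually_sequentially count by blast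
  moreover have "eventually_poly (\<lambda>i. (\<Sum>c<c0. h c (i - c)) + (\<Sum>m\<le>i - c0. h c0 m))"
    by (intro eventually_poly_add eventually_poly_sum eventually_poly_shift[of "h _"]
        eventually_poly_shift[of "\<lambda>j. \<Sum>m\<le>j. h c0 m"] eventually_poly_partial_sums h_poly) simp
  ultimately show ?case by (rule eventually_poly_cong)
qed

text \<open>Descends by unit steps, along an induction on the difference of degrees. The greedy
  selection controls only a single increment at a time.\<close>

lemma down_setI_step:
  fixes D :: "('v::finite \<Rightarrow> nat) set"
  assumes step: "\<And>\<mu> v. \<mu>(v := Suc (\<mu> v)) \<in> D \<Longrightarrow> \<mu> \<in> D"
  shows "down_set D"
proof -
  have "\<nu> \<in> D" if "\<mu> \<in> D" "\<nu> \<le> \<mu>" for \<mu> \<nu>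
    using that
  proof (induction "sum \<mu> UNIV - sum \<nu> UNIV" arbitrary: \<nu> rule: less_induct)
    case less
    show ?case
    proof (cases "\<nu> = \<mu>")
      case False
      then obtain v where v: "\<nu> v < \<mu> v"
        using less.prems(2) by (metis antisym_conv2 ext le_funD)
      let ?\<nu> = "\<nu>(v := Suc (\<nu> v))"
      have le: "?\<nu> \<le> \<mu>" using v less.prems(2) by (auto simp: le_fun_def)
      have "sum \<nu> UNIV < sum ?\<nu> UNIV"
        by (rule sum_strict_mono_ex1) (auto intro: exI[of _ v])
      moreover have "sum ?\<nu> UNIV \<le> sum \<mu> UNIV"
        using le by (intro sum_mono) (auto simp: le_fun_def)
      ultimately have "?\<nu> \<in> D" using less.hyps[of ?\<nu>] less.prems(1) le by linarith
      then show ?thesis by (rule step)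
    qed (use less in simp)
  qed
  then show ?thesis by (auto simp: down_set_def)
qed

section \<open>Dimension of finitely spanned subsets\<close>

context vector_space
begin

text \<open>Finiteness matters: an infinite basis has \<open>card\<close> 0, and the dimension would
  not increase.\<close>

lemma dim_insert_finite:
  assumes "finite S"
  shows "dim (insert v S) = (if v \<in> span S then dim S else Suc (dim S))"
proof (cases "v \<in> span S")
  case True
  then show ?thesis using span_eq_dim[OF span_redundant[OF True]] by simp
next
  case False
  obtain B where B: "B \<subseteq> S" "independent B" "S \<subseteq> span B" "card B = dim S"
    using basis_exists[of S] by blast
  have "span B = span S"
    using span_mono[OF B(1)] span_minimal[OF B(3) subspace_span] by blast
  then have v: "v \<notin> span B" using False by simp
  then have vB: "v \<notin> B" using span_base by blast
  have "dim (insert v S) = card (insert v B)"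
  proof (rule dim_unique[OF _ _ _ refl])
    show "insert v B \<subseteq> insert v S" using B(1) by blast
    show "insert v S \<subseteq> span (insert v B)"
      using B(3) span_mono[of B "insert v B"] span_base[of v "insert v B"] by blast
    show "independent (insert v B)" using independent_insertI[OF v B(2)] .
  qed
  also have "\<dots> = Suc (dim S)" using vB B(4) finite_subset[OF B(1) assms] by simp
  finally show ?thesis using False by simp
qed

text \<open>The ambient space may have infinite dimension; \<open>W\<close> certifies that both
  spans are finite-dimensional, where \<open>dim\<close> is monotone.\<close>

lemma dim_mono_finite_span:
  assumes "V \<subseteq> span U" "U \<subseteq> span W" "finite W"
  shows "dim V \<le> dim U"
proof -
  obtain B where B: "B \<subseteq> U" "independent B" "U \<subseteq> span B" "card B = dim U"
    by (rule basis_exists)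
  have "finite B" using independent_span_bound[OF assms(3) B(2)] B(1) assms(2) by blast
  moreover have "V \<subseteq> span B" using assms(1) span_minimal[OF B(3) subspace_span] by blast
  ultimately show ?thesis using dim_le_card[of V B] B(4) by simp
qed

text \<open>A linear \<open>P\<close> as below is a projection along \<open>K\<close>, so its range serves as the quotient by \<open>K\<close>.\<close>

lemma projection_along_exists:
  assumes "subspace K"
  obtains P where "Vector_Spaces.linear scale scale P" "\<And>v. P v = 0 \<longleftrightarrow> v \<in> K" "\<And>v. v - P v \<in> K"
proof -
  interpret pr: vector_space_pair scale scale ..
  obtain B where B: "B \<subseteq> K" "independent B" "K \<subseteq> span B" "card B = dim K"
    by (rule basis_exists)
  have spB: "span B = K" using B assms by (simp add: span_minimal subset_antisym)
  obtain C where C: "B \<subseteq> C" "independent C" "UNIV \<subseteq> span C"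
    using maximal_independent_subset_extend[of B UNIV] B(2) by auto
  define P where "P = pr.construct C (\<lambda>b. if b \<in> B then 0 else b)"
  have lin: "Vector_Spaces.linear scale scale P"
    unfolding P_def by (rule pr.linear_construct[OF C(2)])
  then interpret P: Vector_Spaces.linear scale scale P .
  have P_C: "P b = (if b \<in> B then 0 else b)" if "b \<in> C" for b
    unfolding P_def by (rule pr.construct_basis[OF C(2) that])
  have diff: "v - P v \<in> K" for v
  proof -
    have "v \<in> span C" using C(3) by blast
    then show ?thesis
    proof (induction rule: span_induct_alt)
      case base
      show ?case using assms by (simp add: P.zero subspace_0)
    next
      case (step c x y)
      have "x - P x \<in> K" using P_C[OF step(1)] B(1) assms by (auto simp: subspace_0)
      then have "scale c (x - P x) + (y - P y) \<in> K"
        using step(2) assms by (simp add: subspace_add subspace_scale)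
      then show ?case by (simp add: P.add P.scale scale_right_diff_distrib algebra_simps)
    qed
  qed
  have "P v = 0 \<longleftrightarrow> v \<in> K" for v
  proof
    assume "P v = 0" then show "v \<in> K" using diff[of v] by simp
  next
    assume "v \<in> K"
    then have "v \<in> span B" using spB by simp
    then show "P v = 0"
      by (induction rule: span_induct_alt) (use P_C C(1) in \<open>auto simp: P.zero P.add P.scale\<close>)
  qed
  with lin diff that show thesis by blast
qed

text \<open>Lifts of vectors that are independent in the image are independent of anything in the
  kernel, so each of them raises the dimension by one.\<close>

lemma dim_Un_kernel:
  assumes P: "Vector_Spaces.linear scale scale P" "\<And>r. r \<in> R \<Longrightarrow> P r = 0"
    and fin: "finite R" "finite Q" and Q: "inj_on P Q" "independent (P ` Q)"
  shows "dim (Q \<union> R) = card Q + dim R"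
  using fin(2) Q
proof (induction Q)
  case (insert q Q)
  interpret P: Vector_Spaces.linear scale scale P by (rule P(1))
  interpret pr: vector_space_pair scale scale ..
  have ind: "P q \<notin> span (P ` Q)" "independent (P ` Q)"
  proof -
    have "P q \<notin> P ` Q" using insert.prems(1) insert.hyps(2) by (auto simp: inj_on_def)
    then show "P q \<notin> span (P ` Q)" "independent (P ` Q)"
      using insert.prems(2) by (auto simp: independent_insert)
  qed
  have "q \<notin> span (Q \<union> R)"
  proof
    assume "q \<in> span (Q \<union> R)"
    then have "P q \<in> span (P ` (Q \<union> R))" using pr.linear_span_image[OF P(1)] by blast
    also have "P ` (Q \<union> R) \<subseteq> span (P ` Q)" using P(2) by (auto intro: span_base span_zero)
    then have "span (P ` (Q \<union> R)) \<subseteq> span (P ` Q)" by (simp add: span_minimal)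
    finally show False using ind by blast
  qed
  then have "dim (insert q (Q \<union> R)) = Suc (dim (Q \<union> R))"
    using insert.hyps fin(1) by (simp add: dim_insert_finite)
  then show ?case using insert ind(2) by (simp add: inj_on_insert)
qed simp

text \<open>One half of rank-nullity, for sets in place of subspaces: lift a basis of
  \<open>C\<close> to \<open>A\<close> and join it with a basis of \<open>B\<close>.\<close>

lemma dim_image_add_kernel_le:
  assumes P: "Vector_Spaces.linear scale scale P" and A: "A \<subseteq> span W" "finite W"
    and B: "B \<subseteq> span A" "\<And>b. b \<in> B \<Longrightarrow> P b = 0" and C: "C \<subseteq> P ` A"
  shows "dim C + dim B \<le> dim A"
proof -
  interpret P: Vector_Spaces.linear scale scale P by (rule P(1))
  interpret pr: vector_space_pair scale scale ..
  obtain R where R: "R \<subseteq> B" "independent R" "B \<subseteq> span R" "card R = dim B"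
    by (rule basis_exists)
  obtain E where E: "E \<subseteq> C" "independent E" "C \<subseteq> span E" "card E = dim C"
    by (rule basis_exists)
  have "R \<subseteq> span W" using R(1) B(1) span_minimal[OF A(1) subspace_span] by blast
  then have finR: "finite R" using independent_span_bound[OF A(2) R(2)] by simp
  have "P ` A \<subseteq> span (P ` W)" using A(1) pr.linear_span_image[OF P] by blast
  then have "E \<subseteq> span (P ` W)" using E(1) C by blast
  then have finE: "finite E" using independent_span_bound[of "P ` W" E] E(2) A(2) by simp
  obtain Q where Q: "Q \<subseteq> A" "inj_on P Q" "E = P ` Q"
    using subset_image_inj[of E P A] E(1) C by blast
  have finQ: "finite Q" using finE Q by (simp add: finite_image_iff)
  have "dim (Q \<union> R) = card Q + dim R"
    by (rule dim_Un_kernel[OF P]) (use B(2) R(1) finR finQ Q E(2) in auto)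
  also have "\<dots> = dim C + dim B"
    using E(4) R(2,4) Q by (simp add: card_image dim_eq_card_independent)
  finally have "dim C + dim B = dim (Q \<union> R)" ..
  also have "\<dots> \<le> dim A"
    by (rule dim_mono_finite_span[OF _ A]) (use Q(1) R(1) B(1) in \<open>auto intro: span_base\<close>)
  finally show ?thesis .
qed

section \<open>Hilbert functions\<close>

text \<open>When the indices are added in increasing order, the dimension rises exactly at the
  vectors outside the span of their predecessors.\<close>

lemma dim_greedy:
  fixes t :: "'o::linorder \<Rightarrow> 'b"
  assumes "finite A"
  shows "dim (t ` A) = card {x \<in> A. t x \<notin> span (t ` {y \<in> A. y < x})}"
  using assms
proof (induction A rule: finite_linorder_max_induct)
  case empty
  show ?case by (simp add: dim_eq_card_independent[OF independent_empty])
next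
  case (insert b A)
  let ?G = "\<lambda>A. {x \<in> A. t x \<notin> span (t ` {y \<in> A. y < x})}"
  have b: "b \<notin> A" "{y \<in> insert b A. y < b} = A" using insert.hyps by auto
  have below: "{y \<in> insert b A. y < x} = {y \<in> A. y < x}" if "x \<in> A" for x
    using insert.hyps(2) that by (blast dest: order.asym)
  define F where "F x = span (t ` {y \<in> insert b A. y < x})" for x
  have F: "F x = span (t ` {y \<in> A. y < x})" if "x \<in> A" for x
    unfolding F_def below[OF that] ..
  have Fb: "F b = span (t ` A)" unfolding F_def b(2) ..
  have "?G (insert b A) = {x \<in> insert b A. t x \<notin> F x}" unfolding F_def ..
  also have "\<dots> = (if t b \<in> F b then {} else {b}) \<union> {x \<in> A. t x \<notin> F x}" by auto
  also have "{x \<in> A. t x \<notin> F x} = ?G A" using F by blast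
  finally have G: "?G (insert b A) = (if t b \<in> span (t ` A) then ?G A else insert b (?G A))"
    unfolding Fb by simp
  have "dim (t ` insert b A) = (if t b \<in> span (t ` A) then dim (t ` A) else Suc (dim (t ` A)))"
    using insert.hyps by (simp add: dim_insert_finite)
  also have "\<dots> = card (?G (insert b A))"
    unfolding G using insert b(1) by simp
  finally show ?case .
qed

text \<open>A term order on the exponents selects, greedily, a basis among the \<open>t \<mu> j\<close>.  The exponents of
  the selected elements form down-sets because the operators \<open>G v\<close> shift exponents up to terms
  of lower degree.\<close>

lemma hilbert_function_eventually_poly:
  fixes t :: "('v::finite \<Rightarrow> nat) \<Rightarrow> nat \<Rightarrow> 'b" and G :: "'v \<Rightarrow> 'b \<Rightarrow> 'b"
  assumes lin: "\<And>v. Vector_Spaces.linear scale scale (G v)"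
    and G: "\<And>\<mu> v j. j < r \<Longrightarrow> G v (t \<mu> j) - t (\<mu>(v := Suc (\<mu> v))) j
        \<in> span {t \<nu> l | \<nu> l. l < r \<and> sum \<nu> UNIV \<le> sum \<mu> UNIV}"
  shows "eventually_poly (\<lambda>i. dim {t \<mu> j | \<mu> j. j < r \<and> sum \<mu> UNIV \<le> i})"
proof -
  interpret pr: vector_space_pair scale scale ..
  obtain e :: "'v \<Rightarrow> nat" where e: "inj e" using finite_imp_inj_to_nat_seg[of "UNIV :: 'v set"] by auto
  \<comment> \<open>The order on \<open>nat \<Rightarrow>\<^sub>0 nat\<close> is decided by the smallest index, so the degree comes first.\<close>
  define \<kappa> :: "('v \<Rightarrow> nat) \<Rightarrow> nat \<Rightarrow> (nat \<Rightarrow>\<^sub>0 nat)" where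
    "\<kappa> \<mu> j = Poly_Mapping.single 0 (sum \<mu> UNIV) + Poly_Mapping.single 1 j
       + (\<Sum>v\<in>UNIV. Poly_Mapping.single (e v + 2) (\<mu> v))" for \<mu> j
  have look0: "Poly_Mapping.lookup (\<kappa> \<mu> j) 0 = sum \<mu> UNIV" for \<mu> j
    by (simp add: \<kappa>_def lookup_add lookup_sum lookup_single)
  have look1: "Poly_Mapping.lookup (\<kappa> \<mu> j) 1 = j" for \<mu> j
    by (simp add: \<kappa>_def lookup_add lookup_sum lookup_single)
  have look2: "Poly_Mapping.lookup (\<kappa> \<mu> j) (e v + 2) = \<mu> v" for \<mu> j v
  proof -
    have "Poly_Mapping.lookup (\<kappa> \<mu> j) (e v + 2) = (\<Sum>w\<in>UNIV. if w = v then \<mu> w else 0)"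
      unfolding \<kappa>_def lookup_add lookup_sum lookup_single
      by (simp add: when_def inj_eq[OF e])
    then show ?thesis by simp
  qed
  have inj: "\<mu> = \<nu> \<and> j = l" if "\<kappa> \<mu> j = \<kappa> \<nu> l" for \<mu> \<nu> j l
    using that look1 look2 by (metis ext)
  have less_deg: "\<kappa> \<mu> j < \<kappa> \<nu> l" if "sum \<mu> UNIV < sum \<nu> UNIV" for \<mu> \<nu> j l
    using that look0[of \<mu> j] look0[of \<nu> l]
    by (auto simp: less_poly_mapping.rep_eq less_fun_def intro!: exI[of _ 0])
  have deg_le: "sum \<mu> UNIV \<le> sum \<nu> UNIV" if "\<kappa> \<mu> j < \<kappa> \<nu> l" for \<mu> \<nu> j l
    using less_deg[of \<nu> \<mu> l j] that by (metis not_less_iff_gr_or_eq not_le_imp_less)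
  have sum_up: "sum (\<mu>(v := Suc (\<mu> v))) UNIV = Suc (sum \<mu> UNIV)" for \<mu> and v :: 'v
    by (simp add: sum.remove[of UNIV v])
  have \<kappa>_up: "\<kappa> (\<mu>(v := Suc (\<mu> v))) j
      = \<kappa> \<mu> j + (Poly_Mapping.single 0 1 + Poly_Mapping.single (e v + 2) 1)" for \<mu> v j
  proof -
    have "(\<Sum>w\<in>UNIV. Poly_Mapping.single (e w + 2) ((\<mu>(v := Suc (\<mu> v))) w))
      = (\<Sum>w\<in>UNIV. Poly_Mapping.single (e w + 2) (\<mu> w)) + Poly_Mapping.single (e v + 2) 1"
      by (simp add: sum.remove[of UNIV v] single_add[symmetric] add_ac)
         (simp add: single_add[symmetric] flip: add.assoc)
    moreover have "Poly_Mapping.single (0 :: nat) (Suc n)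
      = Poly_Mapping.single 0 n + Poly_Mapping.single 0 1" for n
      by (simp add: single_add[symmetric])
    ultimately show ?thesis unfolding \<kappa>_def sum_up by (simp only: add_ac)
  qed
  have \<kappa>_mono: "\<kappa> (\<mu>(v := Suc (\<mu> v))) j < \<kappa> (\<nu>(v := Suc (\<nu> v))) l" if "\<kappa> \<mu> j < \<kappa> \<nu> l" for \<mu> \<nu> v j l
    unfolding \<kappa>_up using that by simp
  define I where "I i = {(\<mu> :: 'v \<Rightarrow> nat, j). j < r \<and> sum \<mu> UNIV \<le> i}" for i
  have finI: "finite (I i)" for i
  proof (rule finite_subset)
    show "I i \<subseteq> {\<mu> \<in> supported UNIV. sum \<mu> UNIV \<le> i} \<times> {..<r}"
      by (auto simp: I_def supported_def)
    show "finite ({\<mu> \<in> supported (UNIV :: 'v set). sum \<mu> UNIV \<le> i} \<times> {..<r})"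
      using finite_bounded_exponents[of "UNIV :: 'v set" i] by simp
  qed
  define below where "below \<mu> j = {t \<nu> l | \<nu> l. l < r \<and> \<kappa> \<nu> l < \<kappa> \<mu> j}" for \<mu> j
  define D where "D j = {\<mu>. t \<mu> j \<notin> span (below \<mu> j)}" for j
  \<comment> \<open>By contraposition: a dependence of \<open>t \<mu> j\<close> on smaller elements
    is pushed through \<open>G v\<close>. Shifting preserves the order, and the error terms have
    lower degree and so come earlier; hence the shifted element depends on smaller ones too.\<close>
  have D_down: "down_set (D j)" if j: "j < r" for j
  proof (rule down_setI_step, rule ccontr)
    fix \<mu> v assume up: "\<mu>(v := Suc (\<mu> v)) \<in> D j" and "\<mu> \<notin> D j"
    let ?\<mu> = "\<mu>(v := Suc (\<mu> v))"
    have low: "span {t \<nu> l | \<nu> l. l < r \<and> sum \<nu> UNIV \<le> n} \<subseteq> span (below ?\<mu> j)"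
      if "n \<le> sum \<mu> UNIV" for n
    proof (rule span_mono, rule subsetI)
      fix x assume "x \<in> {t \<nu> l | \<nu> l. l < r \<and> sum \<nu> UNIV \<le> n}"
      then obtain \<nu> l where x: "x = t \<nu> l" "l < r" "sum \<nu> UNIV \<le> n" by blast
      have "\<kappa> \<nu> l < \<kappa> ?\<mu> j" using x(3) that by (intro less_deg) (simp only: sum_up)
      then show "x \<in> below ?\<mu> j" unfolding below_def using x by blast
    qed
    have "t \<mu> j \<in> span (below \<mu> j)" using \<open>\<mu> \<notin> D j\<close> by (simp add: D_def)
    then have "G v (t \<mu> j) \<in> span (G v ` below \<mu> j)" using pr.linear_span_image[OF lin] by blast
    moreover have "G v ` below \<mu> j \<subseteq> span (below ?\<mu> j)"
    proof
      fix x assume "x \<in> G v ` below \<mu> j"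
      then obtain \<nu> l where x: "x = G v (t \<nu> l)" "l < r" "\<kappa> \<nu> l < \<kappa> \<mu> j"
        by (auto simp: below_def)
      have "t (\<nu>(v := Suc (\<nu> v))) l \<in> span (below ?\<mu> j)"
        unfolding below_def using x \<kappa>_mono by (intro span_base) blast
      moreover have "x - t (\<nu>(v := Suc (\<nu> v))) l \<in> span (below ?\<mu> j)"
        using G[OF x(2), of v \<nu>] low[OF deg_le[OF x(3)]] x(1) by blast
      ultimately show "x \<in> span (below ?\<mu> j)" using span_add by fastforce
    qed
    ultimately have "G v (t \<mu> j) \<in> span (below ?\<mu> j)"
      using span_minimal[OF _ subspace_span] by blast
    moreover have "G v (t \<mu> j) - t ?\<mu> j \<in> span (below ?\<mu> j)" using G[OF j, of v \<mu>] low[OF order.refl] by blast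
    ultimately have "t ?\<mu> j \<in> span (below ?\<mu> j)" using span_diff by fastforce
    with up show False by (simp add: D_def)
  qed
  have count: "dim {t \<mu> j | \<mu> j. j < r \<and> sum \<mu> UNIV \<le> i} = (\<Sum>j<r. card {\<mu> \<in> D j. sum \<mu> UNIV \<le> i})" for i
  proof -
    let ?\<kappa> = "\<lambda>(\<mu>, j). \<kappa> \<mu> j"
    have inj': "inj ?\<kappa>" using inj by (auto simp: inj_def)
    define T where "T k = (case inv_into UNIV ?\<kappa> k of (\<mu>, j) \<Rightarrow> t \<mu> j)" for k
    have T: "T (\<kappa> \<mu> j) = t \<mu> j" for \<mu> j
      unfolding T_def using inv_f_f[OF inj', of "(\<mu>, j)"] by simp
    have "{t \<mu> j | \<mu> j. j < r \<and> sum \<mu> UNIV \<le> i} = T ` ?\<kappa> ` I i"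
      by (force simp: I_def T image_def)
    then have "dim {t \<mu> j | \<mu> j. j < r \<and> sum \<mu> UNIV \<le> i}
        = card {x \<in> ?\<kappa> ` I i. T x \<notin> span (T ` {y \<in> ?\<kappa> ` I i. y < x})}"
      using dim_greedy[of "?\<kappa> ` I i" T] finI by simp
    also have "{x \<in> ?\<kappa> ` I i. T x \<notin> span (T ` {y \<in> ?\<kappa> ` I i. y < x})}
        = ?\<kappa> ` {(\<mu>, j). j < r \<and> \<mu> \<in> D j \<and> sum \<mu> UNIV \<le> i}"
    proof -
      \<comment> \<open>Cutting off at degree i loses no predecessors, because the order compares
        degrees first. One selection therefore serves all i.\<close>
      have "T ` {y \<in> ?\<kappa> ` I i. y < \<kappa> \<mu> j} = below \<mu> j" if "sum \<mu> UNIV \<le> i" for \<mu> j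
      proof (intro equalityI subsetI)
        fix x assume "x \<in> T ` {y \<in> ?\<kappa> ` I i. y < \<kappa> \<mu> j}"
        then show "x \<in> below \<mu> j" by (auto simp: below_def I_def T) blast
      next
        fix x assume "x \<in> below \<mu> j"
        then obtain \<nu> l where x: "x = t \<nu> l" "l < r" "\<kappa> \<nu> l < \<kappa> \<mu> j" by (auto simp: below_def)
        then have "(\<nu>, l) \<in> I i" using deg_le[OF x(3)] that by (simp add: I_def)
        then show "x \<in> T ` {y \<in> ?\<kappa> ` I i. y < \<kappa> \<mu> j}"
          using x T by (intro image_eqI[of x T "\<kappa> \<nu> l"]) (auto intro: image_eqI[of _ ?\<kappa> "(\<nu>, l)"])
      qed
      note * = this
      show ?thesis
      proof (intro equalityI subsetI)
        fix x assume "x \<in> {x \<in> ?\<kappa> ` I i. T x \<notin> span (T ` {y \<in> ?\<kappa> ` I i. y < x})}"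
        then obtain \<mu> j where "x = \<kappa> \<mu> j" "(\<mu>, j) \<in> I i" "T x \<notin> span (T ` {y \<in> ?\<kappa> ` I i. y < x})"
          by auto
        then have "x = ?\<kappa> (\<mu>, j)" "j < r \<and> \<mu> \<in> D j \<and> sum \<mu> UNIV \<le> i"
          using *[of \<mu> j] by (auto simp: I_def T D_def)
        then show "x \<in> ?\<kappa> ` {(\<mu>, j). j < r \<and> \<mu> \<in> D j \<and> sum \<mu> UNIV \<le> i}" by blast
      next
        fix x assume "x \<in> ?\<kappa> ` {(\<mu>, j). j < r \<and> \<mu> \<in> D j \<and> sum \<mu> UNIV \<le> i}"
        then obtain \<mu> j where x: "x = \<kappa> \<mu> j" "j < r" "\<mu> \<in> D j" "sum \<mu> UNIV \<le> i" by auto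
        then have "x \<in> ?\<kappa> ` I i" by (auto simp: I_def)
        moreover have "T x \<notin> span (T ` {y \<in> ?\<kappa> ` I i. y < x})"
          unfolding x(1) *[OF x(4)] T using x(3) by (simp add: D_def)
        ultimately show "x \<in> {x \<in> ?\<kappa> ` I i. T x \<notin> span (T ` {y \<in> ?\<kappa> ` I i. y < x})}" by blast
      qed
    qed
    also have "card \<dots> = card {(\<mu>, j). j < r \<and> \<mu> \<in> D j \<and> sum \<mu> UNIV \<le> i}"
      by (rule card_image) (rule inj_on_subset[OF inj'], simp)
    also have "{(\<mu>, j). j < r \<and> \<mu> \<in> D j \<and> sum \<mu> UNIV \<le> i}
        = (\<Union>j\<in>{..<r}. (\<lambda>\<mu>. (\<mu>, j)) ` {\<mu> \<in> D j. sum \<mu> UNIV \<le> i})"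
      by auto
    also have "card \<dots> = (\<Sum>j<r. card ((\<lambda>\<mu>. (\<mu>, j)) ` {\<mu> \<in> D j. sum \<mu> UNIV \<le> i}))"
    proof (rule card_UN_disjoint)
      show "\<forall>j\<in>{..<r}. finite ((\<lambda>\<mu>. (\<mu>, j)) ` {\<mu> \<in> D j. sum \<mu> UNIV \<le> i})"
      proof
        fix j
        have "finite {\<mu> \<in> D j. sum \<mu> UNIV \<le> i}"
          by (rule finite_subset[OF _ finite_bounded_exponents[of "UNIV :: 'v set" i]])
             (auto simp: supported_def)
        then show "finite ((\<lambda>\<mu>. (\<mu>, j)) ` {\<mu> \<in> D j. sum \<mu> UNIV \<le> i})" by simp
      qed
    qed auto
    also have "\<dots> = (\<Sum>j<r. card {\<mu> \<in> D j. sum \<mu> UNIV \<le> i})"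
      by (intro sum.cong refl card_image) (auto simp: inj_on_def)
    finally show ?thesis .
  qed
  show ?thesis
    unfolding count
    by (intro eventually_poly_sum down_set_count_eventually_poly D_down) (auto simp: supported_def)
qed

end

section \<open>Monomials of the Weyl algebra\<close>

lemma UNIV_weyl_gen: "(UNIV :: 'n weyl_gen set) = range GenX \<union> range GenD"
proof (intro equalityI subsetI)
  fix x :: "'n weyl_gen"
  show "x \<in> range GenX \<union> range GenD" by (cases x) auto
qed simp

instance weyl_gen :: (finite) finite
  by standard (simp add: UNIV_weyl_gen)

lemma sum_weyl_gen:
  fixes \<mu> :: "'n::finite weyl_gen \<Rightarrow> nat"
  shows "sum \<mu> UNIV = (\<Sum>i\<in>UNIV. \<mu> (GenX i)) + (\<Sum>i\<in>UNIV. \<mu> (GenD i))"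
proof -
  have "sum \<mu> UNIV = sum \<mu> (range GenX) + sum \<mu> (range GenD)"
    unfolding UNIV_weyl_gen by (rule sum.union_disjoint) auto
  then show ?thesis by (simp add: sum.reindex inj_def)
qed

lemma card_weyl_gen: "card (UNIV :: 'n::finite weyl_gen set) = 2 * card (UNIV :: 'n set)"
proof -
  have "card (UNIV :: 'n weyl_gen set) = card (range (GenX :: 'n \<Rightarrow> _)) + card (range (GenD :: 'n \<Rightarrow> _))"
    unfolding UNIV_weyl_gen by (rule card_Un_disjoint) auto
  then show ?thesis by (simp add: card_image inj_def)
qed

text \<open>Either factor of \<open>weyl_monom\<close>, isolated so that the x-part and the
  derivative part are treated by the same lemmas.\<close>

definition fold_powers :: "('n \<Rightarrow> 'a::monoid_mult) \<Rightarrow> ('n \<Rightarrow> nat) \<Rightarrow> 'n set \<Rightarrow> 'a" where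
  "fold_powers g \<alpha> A = Finite_Set.fold (\<lambda>i a. g i ^ \<alpha> i * a) 1 A"

section \<open>Powers of pairwise commuting elements\<close>

context
  fixes g :: "'n::finite \<Rightarrow> 'a::ring_1"
  assumes g: "\<And>i j. g i * g j = g j * g i"
begin

interpretation comp_fun_commute "\<lambda>i a. g i ^ \<alpha> i * a" for \<alpha>
  by (rule comp_fun_commute_powers[OF g])

lemma fold_powers_insert:
  "i \<notin> A \<Longrightarrow> fold_powers g \<alpha> (insert i A) = g i ^ \<alpha> i * fold_powers g \<alpha> A"
  unfolding fold_powers_def by (rule fold_insert) auto

lemma fold_powers_remove: "fold_powers g \<alpha> UNIV = g v ^ \<alpha> v * fold_powers g \<alpha> (UNIV - {v})"
  using fold_powers_insert[of v "UNIV - {v}"] by (simp add: insert_UNIV)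

lemma fold_powers_upd: "fold_powers g (\<alpha>(v := m)) (UNIV - {v}) = fold_powers g \<alpha> (UNIV - {v})"
proof -
  have "fold_powers g (\<alpha>(v := m)) A = fold_powers g \<alpha> A" if "v \<notin> A" for A
    using finite[of A] that
    by (induction A rule: finite_induct) (auto simp: fold_powers_insert, simp add: fold_powers_def)
  then show ?thesis by simp
qed

lemma fold_powers_Suc: "fold_powers g (\<alpha>(v := Suc (\<alpha> v))) UNIV = g v * fold_powers g \<alpha> UNIV"
  unfolding fold_powers_remove[of _ v] fold_powers_upd by (simp add: mult.assoc)

lemma fold_powers_zero: "fold_powers g (\<lambda>_. 0) A = 1"
proof (induction A rule: infinite_finite_induct)
  case (insert x F)
  then show ?case by (simp add: fold_powers_insert)
qed (simp_all add: fold_powers_def)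

lemma fold_powers_commute:
  assumes "\<And>i. i \<in> A \<Longrightarrow> y * g i = g i * y"
  shows "y * fold_powers g \<alpha> A = fold_powers g \<alpha> A * y"
  using finite[of A] assms
proof (induction A rule: finite_induct)
  case empty
  show ?case by (simp add: fold_powers_def)
next
  case (insert i A)
  have "y * g i ^ \<alpha> i = g i ^ \<alpha> i * y"
    using insert.prems[of i] by (metis insertI1 power_commuting_commutes)
  moreover have "fold_powers g \<alpha> (insert i A) = g i ^ \<alpha> i * fold_powers g \<alpha> A"
    by (rule fold_powers_insert[OF insert.hyps(2)])
  moreover have "y * fold_powers g \<alpha> A = fold_powers g \<alpha> A * y"
    using insert.IH insert.prems by blast
  ultimately show ?case by (metis mult.assoc)
qed

text \<open>The commutator with \<open>y\<close> is a derivation, and \<epsilon> commutes with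
  \<open>z\<close>, so Leibniz gives the derivative of a power. At exponent 0 the factor
  \<open>of_nat m\<close> hides the truncated subtraction.\<close>

lemma commutator_power:
  assumes "y * z - z * y = (\<epsilon> :: 'a)" "\<epsilon> * z = z * \<epsilon>"
  shows "y * z ^ m - z ^ m * y = of_nat m * (\<epsilon> * z ^ (m - 1))"
proof (induction m)
  case (Suc m)
  have yz: "y * z = z * y + \<epsilon>" using assms(1) by (simp add: algebra_simps)
  have *: "\<epsilon> * z ^ m = z ^ m * \<epsilon>" using assms(2) by (metis power_commuting_commutes)
  have "y * z ^ Suc m - z ^ Suc m * y = (y * z) * z ^ m - z * z ^ m * y"
    by (simp add: mult.assoc)
  also have "\<dots> = \<epsilon> * z ^ m + z * (y * z ^ m - z ^ m * y)"
    unfolding yz by (simp add: algebra_simps)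
  also have "\<dots> = \<epsilon> * z ^ m + z * (of_nat m * (\<epsilon> * z ^ (m - 1)))" unfolding Suc.IH ..
  also have "z * (of_nat m * (\<epsilon> * z ^ (m - 1))) = (z * of_nat m) * \<epsilon> * z ^ (m - 1)"
    by (simp only: mult.assoc)
  also have "z * of_nat m = of_nat m * z" by (rule mult_of_nat_commute[symmetric])
  also have "of_nat m * z * \<epsilon> * z ^ (m - 1) = of_nat m * (z * \<epsilon>) * z ^ (m - 1)"
    by (simp only: mult.assoc)
  also have "\<dots> = of_nat m * (\<epsilon> * (z * z ^ (m - 1)))"
    unfolding assms(2)[symmetric] by (simp only: mult.assoc)
  also have "\<dots> = of_nat m * (\<epsilon> * z ^ m)"
    by (cases m) simp_all
  finally show ?case by (simp add: algebra_simps)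
qed simp

text \<open>\<open>y\<close> passes all factors except the power of \<open>g v\<close>, so the
  commutator is \<epsilon> times a formal partial derivative.\<close>

lemma fold_powers_commutator:
  assumes y: "\<And>i. y * g i - g i * y = (if i = v then \<epsilon> else 0)" and \<epsilon>: "\<And>z. \<epsilon> * z = z * \<epsilon>"
  shows "y * fold_powers g \<alpha> UNIV - fold_powers g \<alpha> UNIV * y
    = of_nat (\<alpha> v) * (\<epsilon> * fold_powers g (\<alpha>(v := \<alpha> v - 1)) UNIV)"
proof -
  let ?R = "fold_powers g \<alpha> (UNIV - {v})"
  have "y * ?R = ?R * y" by (rule fold_powers_commute) (use y in \<open>metis Diff_iff insertI1 right_minus_eq\<close>)
  then have "y * (g v ^ \<alpha> v * ?R) - g v ^ \<alpha> v * ?R * y = (y * g v ^ \<alpha> v - g v ^ \<alpha> v * y) * ?R"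
    by (simp add: algebra_simps)
  also have "\<dots> = of_nat (\<alpha> v) * (\<epsilon> * (g v ^ (\<alpha> v - 1) * ?R))"
    using commutator_power[of y "g v" \<epsilon> "\<alpha> v"] y[of v] \<epsilon> by (simp add: mult.assoc)
  finally show ?thesis
    unfolding fold_powers_remove[of _ v] fold_powers_upd by simp
qed

end

lemma weyl_monom_fold_powers:
  "weyl_monom \<alpha> \<beta> = fold_powers weyl_x \<alpha> UNIV * fold_powers weyl_d \<beta> UNIV"
  by (simp add: weyl_monom_def fold_powers_def)

lemma free_const_commute: "free_const c * a = a * free_const c"
  by (induction a rule: poly_mapping_single_induct)
     (simp_all add: free_const_def mult_single mult.commute distrib_left distrib_right)

lemma weyl_const_commute: "weyl_const c * a = a * weyl_const c"
  by transfer (simp add: free_const_commute weyl_ideal.zero)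

lemma weyl_const_add: "weyl_const (c + d) = weyl_const c + weyl_const d"
  by transfer (simp add: free_const_def single_add weyl_ideal.zero)

lemma weyl_const_mult: "weyl_const (c * d) = weyl_const c * weyl_const d"
  by transfer (simp add: free_const_def mult_single weyl_ideal.zero)

lemma weyl_const_0: "weyl_const 0 = 0"
  by transfer (simp add: free_const_def weyl_ideal.zero)

lemma weyl_const_1: "weyl_const 1 = 1"
  by transfer (simp add: free_const_def weyl_ideal.zero)

lemma weyl_const_of_nat: "weyl_const (of_nat n) = of_nat n"
  by (induction n) (simp_all add: weyl_const_0 weyl_const_1 weyl_const_add)

lemma weyl_const_uminus: "weyl_const (- c) = - weyl_const c"
  using weyl_const_add[of c "- c"] by (simp add: weyl_const_0 add_eq_0_iff)

primrec wgen :: "'n weyl_gen \<Rightarrow> ('n, 'k::field) weyl" where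
  "wgen (GenX i) = weyl_x i"
| "wgen (GenD i) = weyl_d i"

text \<open>Each generator fails to commute with exactly one other, and \<open>gen_sign\<close> is
  the sign of that commutator.\<close>

primrec conj_gen :: "'n weyl_gen \<Rightarrow> 'n weyl_gen" where
  "conj_gen (GenX i) = GenD i"
| "conj_gen (GenD i) = GenX i"

primrec gen_sign :: "'n weyl_gen \<Rightarrow> 'k::field" where
  "gen_sign (GenX i) = - 1"
| "gen_sign (GenD i) = 1"

lemma weyl_x_d: "weyl_x i * weyl_d j - weyl_d j * weyl_x i = (if j = i then - 1 else 0)"
proof -
  have "weyl_x i * weyl_d j - weyl_d j * weyl_x i = - (weyl_d j * weyl_x i - weyl_x i * weyl_d j :: ('a, 'b) weyl)"
    by simp
  then show ?thesis unfolding weyl_d_x by simp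
qed

text \<open>One exponent function on all generators replaces the pair of exponents. The variables of
  the counting lemmas are then the generators themselves.\<close>

definition wmon :: "('n::finite weyl_gen \<Rightarrow> nat) \<Rightarrow> ('n, 'k::field) weyl" where
  "wmon \<mu> = weyl_monom (\<lambda>i. \<mu> (GenX i)) (\<lambda>i. \<mu> (GenD i))"

lemma weyl_monom_wmon: "weyl_monom \<alpha> \<beta> = wmon (case_weyl_gen \<alpha> \<beta>)"
  by (simp add: wmon_def)

lemma upd_gen:
  "(\<lambda>i. (\<mu>(GenX v := m)) (GenX i)) = (\<lambda>i. \<mu> (GenX i))(v := m)"
  "(\<lambda>i. (\<mu>(GenX v := m)) (GenD i)) = (\<lambda>i. \<mu> (GenD i))"
  "(\<lambda>i. (\<mu>(GenD v := m)) (GenD i)) = (\<lambda>i. \<mu> (GenD i))(v := m)"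
  "(\<lambda>i. (\<mu>(GenD v := m)) (GenX i)) = (\<lambda>i. \<mu> (GenX i))"
  by (auto simp: fun_eq_iff)

lemma wmon_0: "wmon (\<lambda>_. 0) = 1"
  by (simp add: wmon_def weyl_monom_fold_powers fold_powers_zero weyl_x_commute weyl_d_commute)

lemma weyl_x_wmon: "weyl_x i * wmon \<mu> = wmon (\<mu>(GenX i := Suc (\<mu> (GenX i))))"
  unfolding wmon_def weyl_monom_fold_powers upd_gen
  by (subst fold_powers_Suc[OF weyl_x_commute]) (rule mult.assoc[symmetric])

text \<open>Up to sign, the commutator with a generator is the formal derivative in the conjugate
  one. Only one of the two blocks reacts, and the result is again in normal order.\<close>

lemma wmon_commutator:
  "wgen v * wmon \<mu> - wmon \<mu> * wgen v
    = weyl_const (gen_sign v * of_nat (\<mu> (conj_gen v))) *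
        wmon (\<mu>(conj_gen v := \<mu> (conj_gen v) - 1))"
proof (cases v)
  case (GenX i)
  let ?X = "fold_powers weyl_x (\<lambda>i. \<mu> (GenX i)) UNIV :: ('a, 'b) weyl"
  let ?D = "fold_powers weyl_d (\<lambda>i. \<mu> (GenD i)) UNIV :: ('a, 'b) weyl"
  have "weyl_x i * ?X = ?X * weyl_x i"
    by (rule fold_powers_commute[OF weyl_x_commute weyl_x_commute])
  then have "weyl_x i * (?X * ?D) - ?X * ?D * weyl_x i = ?X * (weyl_x i * ?D - ?D * weyl_x i)"
    by (simp add: algebra_simps flip: mult.assoc)
  also have "weyl_x i * ?D - ?D * weyl_x i = of_nat (\<mu> (GenD i)) *
      (- 1 * fold_powers weyl_d ((\<lambda>i. \<mu> (GenD i))(i := \<mu> (GenD i) - 1)) UNIV)"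
    by (rule fold_powers_commutator[OF weyl_d_commute])
       (simp_all only: weyl_x_d mult_minus_left mult_minus_right mult_1_left mult_1_right)
  also have "of_nat (\<mu> (GenD i)) *
      (- 1 * fold_powers weyl_d ((\<lambda>i. \<mu> (GenD i))(i := \<mu> (GenD i) - 1)) UNIV)
    = weyl_const (- 1 * of_nat (\<mu> (GenD i))) *
      fold_powers weyl_d ((\<lambda>i. \<mu> (GenD i))(i := \<mu> (GenD i) - 1)) UNIV"
    by (simp add: weyl_const_of_nat weyl_const_uminus)
  finally show ?thesis
    unfolding GenX wmon_def weyl_monom_fold_powers conj_gen.simps upd_gen wgen.simps gen_sign.simps
    by (simp only: mult.assoc weyl_const_commute)
next
  case (GenD i)
  let ?X = "fold_powers weyl_x (\<lambda>i. \<mu> (GenX i)) UNIV :: ('a, 'b) weyl"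
  let ?D = "fold_powers weyl_d (\<lambda>i. \<mu> (GenD i)) UNIV :: ('a, 'b) weyl"
  have "weyl_d i * ?D = ?D * weyl_d i"
    by (rule fold_powers_commute[OF weyl_d_commute weyl_d_commute])
  then have "weyl_d i * (?X * ?D) - ?X * ?D * weyl_d i = (weyl_d i * ?X - ?X * weyl_d i) * ?D"
    by (simp add: algebra_simps)
  also have "weyl_d i * ?X - ?X * weyl_d i = of_nat (\<mu> (GenX i)) *
      (1 * fold_powers weyl_x ((\<lambda>i. \<mu> (GenX i))(i := \<mu> (GenX i) - 1)) UNIV)"
    by (rule fold_powers_commutator[OF weyl_x_commute])
       (auto simp: weyl_d_x)
  finally show ?thesis
    unfolding GenD wmon_def weyl_monom_fold_powers conj_gen.simps upd_gen
    by (simp add: weyl_const_of_nat mult.assoc)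
qed

text \<open>Multiplied from the right, a derivative is already in normal order; moving it to the
  left costs the commutator.\<close>

lemma weyl_d_wmon:
  "weyl_d i * wmon \<mu> = wmon (\<mu>(GenD i := Suc (\<mu> (GenD i))))
    + weyl_const (of_nat (\<mu> (GenX i))) * wmon (\<mu>(GenX i := \<mu> (GenX i) - 1))"
proof -
  have "wmon \<mu> * weyl_d i = (wmon (\<mu>(GenD i := Suc (\<mu> (GenD i)))) :: ('a, 'b) weyl)"
    unfolding wmon_def weyl_monom_fold_powers upd_gen
    by (subst fold_powers_Suc[OF weyl_d_commute], subst fold_powers_commute[OF weyl_d_commute weyl_d_commute])
       (rule mult.assoc)
  moreover have "wgen (GenD i) * wmon \<mu> - wmon \<mu> * wgen (GenD i)
    = (weyl_const (gen_sign (GenD i) * of_nat (\<mu> (conj_gen (GenD i)))) *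
        wmon (\<mu>(conj_gen (GenD i) := \<mu> (conj_gen (GenD i)) - 1)) :: ('a, 'b) weyl)"
    by (rule wmon_commutator)
  ultimately show ?thesis by (simp add: algebra_simps)
qed

section \<open>The Bernstein filtration in terms of monomials\<close>

lemma bernstein_wmon: "bernstein m = weyl.span {wmon \<mu> | \<mu>. sum \<mu> UNIV \<le> m}"
proof -
  have "{weyl_monom \<alpha> \<beta> | \<alpha> \<beta>. sum \<alpha> UNIV + sum \<beta> UNIV \<le> m}
    = ({wmon \<mu> | \<mu>. sum \<mu> UNIV \<le> m} :: ('a, 'b) weyl set)"
  proof (intro equalityI subsetI)
    fix a :: "('a, 'b) weyl" assume "a \<in> {weyl_monom \<alpha> \<beta> | \<alpha> \<beta>. sum \<alpha> UNIV + sum \<beta> UNIV \<le> m}"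
    then obtain \<alpha> \<beta> where "a = weyl_monom \<alpha> \<beta>" "sum \<alpha> UNIV + sum \<beta> UNIV \<le> m" by blast
    then have "a = wmon (case_weyl_gen \<alpha> \<beta>)" "sum (case_weyl_gen \<alpha> \<beta>) UNIV \<le> m"
      by (simp_all add: weyl_monom_wmon sum_weyl_gen)
    then show "a \<in> {wmon \<mu> | \<mu>. sum \<mu> UNIV \<le> m}" by blast
  next
    fix a :: "('a, 'b) weyl" assume "a \<in> {wmon \<mu> | \<mu>. sum \<mu> UNIV \<le> m}"
    then obtain \<mu> where "a = wmon \<mu>" "sum \<mu> UNIV \<le> m" by blast
    then show "a \<in> {weyl_monom \<alpha> \<beta> | \<alpha> \<beta>. sum \<alpha> UNIV + sum \<beta> UNIV \<le> m}"
      unfolding wmon_def sum_weyl_gen by blast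
  qed
  then show ?thesis by (simp add: bernstein_def)
qed

lemma wmon_in_bernstein: "sum \<mu> UNIV \<le> m \<Longrightarrow> wmon \<mu> \<in> bernstein m"
  unfolding bernstein_wmon by (rule weyl.span_base) blast

lemma bernstein_subspace: "weyl.subspace (bernstein m)"
  by (simp add: bernstein_wmon)

lemma bernstein_mono: "m \<le> m' \<Longrightarrow> bernstein m \<subseteq> bernstein m'"
  unfolding bernstein_wmon by (rule weyl.span_mono) auto

lemma sum_upd_Suc: "sum (\<mu>(v := Suc (\<mu> v))) UNIV = Suc (sum \<mu> UNIV)"
  for \<mu> :: "'v::finite \<Rightarrow> nat"
  by (simp add: sum.remove[of UNIV v])

lemma sum_upd_le: "m \<le> \<mu> v \<Longrightarrow> sum (\<mu>(v := m)) UNIV \<le> sum \<mu> UNIV"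
  for \<mu> :: "'v::finite \<Rightarrow> nat"
  by (rule sum_mono) simp

text \<open>The error vanishes for x, and for a derivative it is the term produced by passing x.
  This is the shift property that \<open>hilbert_function_eventually_poly\<close> asks for.\<close>

lemma wgen_mult_wmon:
  "wgen v * wmon \<mu> - wmon (\<mu>(v := Suc (\<mu> v))) \<in> bernstein (sum \<mu> UNIV)"
proof (cases v)
  case (GenX i)
  then show ?thesis using weyl.subspace_0[OF bernstein_subspace] by (simp add: weyl_x_wmon)
next
  case (GenD i)
  have "wmon (\<mu>(GenX i := \<mu> (GenX i) - 1)) \<in> bernstein (sum \<mu> UNIV)"
    by (intro wmon_in_bernstein sum_upd_le) simp
  then show ?thesis
    using weyl.subspace_scale[OF bernstein_subspace] GenD by (simp add: weyl_d_wmon)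
qed

lemma bernstein_wgen:
  assumes "a \<in> bernstein m"
  shows "wgen v * a \<in> bernstein (Suc m)"
  using assms unfolding bernstein_wmon[of m]
proof (induction rule: weyl.span_induct_alt)
  case base
  show ?case using weyl.subspace_0[OF bernstein_subspace] by simp
next
  case (step c x y)
  then obtain \<mu> where \<mu>: "x = wmon \<mu>" "sum \<mu> UNIV \<le> m" by blast
  have "wgen v * x - wmon (\<mu>(v := Suc (\<mu> v))) \<in> bernstein (Suc m)"
    using wgen_mult_wmon[of v \<mu>] bernstein_mono[of "sum \<mu> UNIV" "Suc m"] \<mu> by auto
  moreover have "wmon (\<mu>(v := Suc (\<mu> v))) \<in> bernstein (Suc m)"
    using \<mu> by (intro wmon_in_bernstein) (simp only: sum_upd_Suc)
  ultimately have "wgen v * x \<in> bernstein (Suc m)"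
    using weyl.subspace_add[OF bernstein_subspace] by fastforce
  then have "weyl_const c * (wgen v * x) + wgen v * y \<in> bernstein (Suc m)"
    using step.IH by (intro weyl.subspace_add[OF bernstein_subspace] weyl.subspace_scale[OF bernstein_subspace])
  moreover have "weyl_const c * (wgen v * x) = wgen v * (weyl_const c * x)"
    by (simp only: mult.assoc weyl_const_commute)
  ultimately show ?case by (simp only: distrib_left)
qed

lemma one_in_bernstein: "1 \<in> bernstein m"
  using wmon_in_bernstein[of "\<lambda>_. 0" m] by (simp add: wmon_0)

text \<open>An induction principle: statements on how far an operator of degree m moves a filtration
  need checking only for left multiplication by generators.\<close>

lemma bernstein_least:
  fixes R :: "nat \<Rightarrow> ('n::finite, 'k::field) weyl set"
  assumes sub: "\<And>m. weyl.subspace (R m)" and mono: "\<And>m. R m \<subseteq> R (Suc m)"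
    and one: "1 \<in> R 0" and gen: "\<And>m v a. a \<in> R m \<Longrightarrow> wgen v * a \<in> R (Suc m)"
  shows "bernstein m \<subseteq> R m"
proof -
  have "wmon \<mu> \<in> R (sum \<mu> UNIV)" for \<mu>
  proof (induction "sum \<mu> UNIV" arbitrary: \<mu>)
    case 0
    then have "\<mu> = (\<lambda>_. 0)" by (auto simp: fun_eq_iff)
    then show ?case using one by (simp add: wmon_0)
  next
    case (Suc n)
    show ?case
    proof (cases "\<exists>i. \<mu> (GenX i) > 0")
      case True
      then obtain i where i: "\<mu> (GenX i) > 0" by blast
      let ?\<nu> = "\<mu>(GenX i := \<mu> (GenX i) - 1)"
      have \<mu>: "\<mu> = ?\<nu>(GenX i := Suc (?\<nu> (GenX i)))" using i by (simp add: fun_eq_iff)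
      then have "n = sum ?\<nu> UNIV" using Suc(2) sum_upd_Suc[of ?\<nu> "GenX i"] by simp
      then have "wgen (GenX i) * wmon ?\<nu> \<in> R (Suc n)" using Suc(1)[of ?\<nu>] gen by metis
      then show ?thesis using Suc(2) \<mu> by (simp add: weyl_x_wmon)
    next
      case False
      \<comment> \<open>Derivatives are split off on the left only when no x remains, because then
        the correction term vanishes.\<close>
      then have X: "\<mu> (GenX i) = 0" for i by simp
      have "\<exists>i. \<mu> (GenD i) > 0"
      proof (rule ccontr)
        assume "\<not> ?thesis"
        then have "sum \<mu> UNIV = 0" using X by (simp add: sum_weyl_gen)
        with Suc(2) show False by simp
      qed
      then obtain i where i: "\<mu> (GenD i) > 0" by blast
      let ?\<nu> = "\<mu>(GenD i := \<mu> (GenD i) - 1)"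
      have \<mu>: "\<mu> = ?\<nu>(GenD i := Suc (?\<nu> (GenD i)))" using i by (simp add: fun_eq_iff)
      then have "n = sum ?\<nu> UNIV" using Suc(2) sum_upd_Suc[of ?\<nu> "GenD i"] by simp
      then have "wgen (GenD i) * wmon ?\<nu> \<in> R (Suc n)" using Suc(1)[of ?\<nu>] gen by metis
      then show ?thesis using Suc(2) \<mu> X by (simp add: weyl_d_wmon weyl_const_0)
    qed
  qed
  moreover have "R k \<subseteq> R m" if "k \<le> m" for k
    using that by (induction m rule: dec_induct) (use mono in blast)+
  ultimately show ?thesis
    unfolding bernstein_wmon by (intro weyl.span_minimal sub) blast
qed

text \<open>Comes from the free algebra, whose elements are sums of scaled words, each word being
  built letter by letter from the left.\<close>

lemma weyl_induct [case_names one gen add scale]: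
  fixes a :: "('n, 'k::field) weyl"
  assumes "P 1" "\<And>v a. P a \<Longrightarrow> P (wgen v * a)" "\<And>a b. P a \<Longrightarrow> P b \<Longrightarrow> P (a + b)"
    "\<And>c a. P a \<Longrightarrow> P (weyl_const c * a)"
  shows "P a"
proof -
  have word: "P (abs_weyl (Poly_Mapping.single (Word w) 1))" for w
  proof (induction w)
    case Nil
    have "abs_weyl (Poly_Mapping.single (Word []) 1) = (1 :: ('n, 'k) weyl)"
      unfolding one_weyl_def by (simp flip: zero_word_def)
    then show ?case using assms(1) by simp
  next
    case (Cons g w)
    have "wgen g = (abs_weyl (free_gen g) :: ('n, 'k) weyl)"
      by (cases g) (simp_all add: weyl_x.abs_eq weyl_d.abs_eq weyl_x_def weyl_d_def)
    then have "abs_weyl (Poly_Mapping.single (Word (g # w)) 1)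
        = wgen g * (abs_weyl (Poly_Mapping.single (Word w) 1) :: ('n, 'k) weyl)"
      by (simp add: times_weyl.abs_eq free_gen_def mult_single)
    then show ?case using assms(2) Cons by simp
  qed
  have "P (abs_weyl p)" for p
  proof (induction p rule: poly_mapping_single_induct)
    case (single w c)
    have "abs_weyl (Poly_Mapping.single w c)
        = weyl_const c * (abs_weyl (Poly_Mapping.single w 1) :: ('n, 'k) weyl)"
      by (simp add: times_weyl.abs_eq free_const_def weyl_const_def mult_single)
    then show ?case using assms(4) word by (cases w) simp
  next
    case (sum p q)
    then show ?case using assms(3) by (simp flip: plus_weyl.abs_eq)
  qed
  then show ?thesis by (rule weyl.abs_induct)
qed

lemma bernstein_exhaust: "\<exists>m. (a :: ('n::finite, 'k::field) weyl) \<in> bernstein m"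
proof (induction a rule: weyl_induct)
  case one
  show ?case using one_in_bernstein by blast
next
  case (gen v a)
  then show ?case using bernstein_wgen by blast
next
  case (add a b)
  then obtain m m' where "a \<in> bernstein m" "b \<in> bernstein m'" by blast
  then have "a \<in> bernstein (max m m')" "b \<in> bernstein (max m m')"
    using bernstein_mono max.cobounded1 max.cobounded2 by blast+
  then show ?case using weyl.subspace_add[OF bernstein_subspace] by blast
next
  case (scale c a)
  then show ?case using weyl.subspace_scale[OF bernstein_subspace] by blast
qed

section \<open>Filtered modules over the Weyl algebra\<close>

lemma card_bounded_functions:
  "card {\<mu> :: 'v::finite \<Rightarrow> nat. \<forall>v. \<mu> v \<le> q} = (q + 1) ^ card (UNIV :: 'v set)"
proof -
  have "{\<mu> :: 'v \<Rightarrow> nat. \<forall>v. \<mu> v \<le> q} = (\<Pi>\<^sub>E v\<in>UNIV. {..q})"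
    by (auto simp: PiE_def Pi_def)
  then show ?thesis by (simp add: card_PiE)
qed

lemma sum_fun_apply: "(\<Sum>x\<in>A. f x) y = (\<Sum>x\<in>A. f x y)"
  by (induction A rule: infinite_finite_induct) simp_all

context vector_space
begin

text \<open>Coefficients are indexed by \<open>A\<close> and not by the image of \<open>f\<close>,
  so injectivity of \<open>f\<close> is a consequence of independence.\<close>

lemma card_le_of_independent_family:
  assumes "finite A" "finite B" "f ` A \<subseteq> span B"
    and ind: "\<And>c. (\<Sum>x\<in>A. scale (c x) (f x)) = 0 \<Longrightarrow> \<forall>x\<in>A. c x = 0"
  shows "card A \<le> card B"
proof -
  have inj: "inj_on f A"
  proof (rule inj_onI, rule ccontr)
    fix x y assume xy: "x \<in> A" "y \<in> A" "f x = f y" "x \<noteq> y"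
    \<comment> \<open>Two equal values would satisfy the nontrivial relation with coefficients 1 and
      -1.\<close>
    let ?c = "\<lambda>z. if z = x then 1 else if z = y then - 1 else 0 :: 'a"
    have "(\<Sum>z\<in>A. scale (?c z) (f z)) = (\<Sum>z\<in>{x, y}. scale (?c z) (f z))"
      using xy assms(1) by (intro sum.mono_neutral_right) auto
    also have "\<dots> = 0" using xy by simp
    finally have "\<forall>z\<in>A. ?c z = 0" by (rule ind)
    then have "?c x = 0" using xy(1) by blast
    then show False by simp
  qed
  have "independent (f ` A)"
  proof (rule independent_if_scalars_zero)
    fix g x assume "(\<Sum>x\<in>f ` A. scale (g x) x) = 0" "x \<in> f ` A"
    then show "g x = 0" using ind[of "g \<circ> f"] inj by (auto simp: sum.reindex)
  qed (use assms(1) in simp)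
  then show ?thesis using independent_span_bound[OF assms(2) _ assms(3)] card_image[OF inj] by simp
qed

text \<open>Functions into the module later stand for linear maps, which are compared by
  dimension.\<close>

lemma vector_space_fun: "vector_space (\<lambda>c f x. scale c (f x))"
  by unfold_locales (auto simp: fun_eq_iff scale_left_distrib scale_right_distrib)

end

text \<open>The module is the subspace \<open>W\<close> of an ambient type; the operators \<open>act a\<close> are linear everywhere
  but satisfy the module laws only on \<open>W\<close>.\<close>

locale wmod = vector_space scale
  for scale :: "'k::field_char_0 \<Rightarrow> 'v::ab_group_add \<Rightarrow> 'v" +
  fixes W :: "'v set" and act :: "('n::finite, 'k) weyl \<Rightarrow> 'v \<Rightarrow> 'v"
  assumes W: "subspace W"
    and act_linear: "Vector_Spaces.linear scale scale (act a)"
    and act_closed: "w \<in> W \<Longrightarrow> act a w \<in> W"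
    and act_mult: "w \<in> W \<Longrightarrow> act (a * b) w = act a (act b w)"
    and act_add: "w \<in> W \<Longrightarrow> act (a + b) w = act a w + act b w"
    and act_one: "w \<in> W \<Longrightarrow> act 1 w = w"
    and act_const: "w \<in> W \<Longrightarrow> act (weyl_const c) w = scale c w"
begin

interpretation act: Vector_Spaces.linear scale scale "act a" for a
  by (rule act_linear)

lemma act_zero_right: "act a 0 = 0"
  by (rule act.zero)

lemma act_plus: "act a (v + w) = act a v + act a w"
  by (rule act.add)

lemma act_scale: "act a (scale c w) = scale c (act a w)"
  by (rule act.scale)

lemma act_diff: "act a (v - w) = act a v - act a w"
  by (rule act.diff)

lemma act_const_mult: "w \<in> W \<Longrightarrow> act (weyl_const c * a) w = scale c (act a w)"
  by (simp add: act_mult act_const act_closed)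

lemma act_zero: "w \<in> W \<Longrightarrow> act 0 w = 0"
  using act_const[of w 0] by (simp add: weyl_const_0)

lemma act_sum: "w \<in> W \<Longrightarrow> act (\<Sum>x\<in>A. f x) w = (\<Sum>x\<in>A. act (f x) w)"
  by (induction A rule: infinite_finite_induct) (simp_all add: act_zero act_add)

lemma act_minus: "w \<in> W \<Longrightarrow> act (a - b) w = act a w - act b w"
  using act_add[of w "a - b" b] by simp

text \<open>Stability is asked of the generators only; \<open>submod_act\<close> extends it to all
  operators.\<close>

definition submod :: "'v set \<Rightarrow> bool" where
  "submod L \<longleftrightarrow> subspace L \<and> L \<subseteq> W \<and> (\<forall>v. \<forall>w\<in>L. act (wgen v) w \<in> L)"

lemma submod_act:
  assumes "submod L" "w \<in> L"
  shows "act a w \<in> L"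
proof -
  have L: "subspace L" "w \<in> W" "\<And>w. w \<in> L \<Longrightarrow> w \<in> W" "\<And>v w. w \<in> L \<Longrightarrow> act (wgen v) w \<in> L"
    using assms by (auto simp: submod_def)
  show ?thesis
    by (induction a rule: weyl_induct)
       (use L assms(2) in \<open>auto simp: act_one act_mult act_add act_const subspace_add subspace_scale\<close>)
qed

text \<open>Finite dimension of the steps, exhaustion and generation by a step are all left open and
  appear as separate assumptions where they matter. The filtration of the tensor product fits this
  form.\<close>

definition filtr :: "(nat \<Rightarrow> 'v set) \<Rightarrow> bool" where
  "filtr F \<longleftrightarrow> (\<forall>i. subspace (F i) \<and> F i \<subseteq> W \<and> F i \<subseteq> F (Suc i) \<and>
     (\<forall>v. \<forall>w\<in>F i. act (wgen v) w \<in> F (Suc i)))"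

lemma filtrD:
  assumes "filtr F"
  shows "subspace (F i)" "F i \<subseteq> W" "i \<le> j \<Longrightarrow> F i \<subseteq> F j" "w \<in> F i \<Longrightarrow> act (wgen v) w \<in> F (Suc i)"
proof -
  show "F i \<subseteq> F j" if "i \<le> j"
    using that by (induction j rule: dec_induct) (use assms in \<open>auto simp: filtr_def\<close>)
qed (use assms in \<open>auto simp: filtr_def\<close>)

lemma filtr_bernstein:
  assumes F: "filtr F" and "a \<in> bernstein m" "w \<in> F k"
  shows "act a w \<in> F (m + k)"
proof -
  let ?R = "\<lambda>m. {a. \<forall>w\<in>F k. act a w \<in> F (m + k)}"
  have W': "w \<in> W" if "w \<in> F k" for w using filtrD(2)[OF F] that by blast
  have "bernstein m \<subseteq> ?R m"
  proof (rule bernstein_least)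
    fix m
    show "weyl.subspace (?R m)"
      by (rule weyl.subspaceI)
         (use filtrD(1)[OF F] W' in \<open>auto simp: act_zero act_add act_const_mult
            subspace_0 subspace_add subspace_scale\<close>)
    show "?R m \<subseteq> ?R (Suc m)" using filtrD(3)[OF F, of "m + k" "Suc m + k"] by auto
    show "wgen v * a \<in> ?R (Suc m)" if "a \<in> ?R m" for v a
      using that W' filtrD(4)[OF F] by (simp add: act_mult)
  qed (use W' in \<open>auto simp: act_one\<close>)
  then show ?thesis using assms by blast
qed

section \<open>Filtrations generated by a set\<close>

definition gens :: "'v set \<Rightarrow> nat \<Rightarrow> 'v set" where
  "gens S i = {act (wmon \<mu>) s | \<mu> s. s \<in> S \<and> sum \<mu> UNIV \<le> i}"

text \<open>The counterpart of \<open>good_filtration\<close> as a span of monomial images;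
  \<open>f_good_filtration\<close> identifies the two.\<close>

definition Gam :: "'v set \<Rightarrow> nat \<Rightarrow> 'v set" where
  "Gam S i = span (gens S i)"

definition GenM :: "'v set \<Rightarrow> 'v set" where
  "GenM S = (\<Union>i. Gam S i)"

lemma finite_exponents: "finite {\<mu> :: 'v1::finite \<Rightarrow> nat. sum \<mu> UNIV \<le> i}"
  using finite_bounded_exponents[of "UNIV :: 'v1 set" i] by (simp add: supported_def)

lemma finite_gens: "finite S \<Longrightarrow> finite (gens S i)"
proof -
  assume "finite S"
  moreover have "gens S i = (\<lambda>(\<mu>, s). act (wmon \<mu>) s) ` ({\<mu>. sum \<mu> UNIV \<le> i} \<times> S)"
    by (auto simp: gens_def)
  ultimately show ?thesis
    by (simp only:) (intro finite_imageI finite_cartesian_product finite_exponents)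
qed

lemma Gam_mono: "S \<subseteq> T \<Longrightarrow> i \<le> j \<Longrightarrow> Gam S i \<subseteq> Gam T j"
  unfolding Gam_def gens_def by (rule span_mono) (blast intro: order.trans)

lemma Gam_sub_W: "S \<subseteq> W \<Longrightarrow> Gam S i \<subseteq> W"
  unfolding Gam_def gens_def by (rule span_minimal[OF _ W]) (auto intro: act_closed)

lemma bernstein_Gam:
  assumes "a \<in> bernstein i" "s \<in> S" "S \<subseteq> W"
  shows "act a s \<in> Gam S i"
  using assms(1) unfolding bernstein_wmon
proof (induction rule: weyl.span_induct_alt)
  case base
  then show ?case using assms by (auto simp: act_zero Gam_def span_zero)
next
  case (step c x y)
  then have "act x s \<in> Gam S i"
    unfolding Gam_def gens_def using assms(2) by (intro span_base) blast
  with step assms show ?case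
    by (auto simp: act_add act_const_mult Gam_def span_add span_scale)
qed

lemma filtr_Gam:
  assumes "S \<subseteq> W"
  shows "filtr (Gam S)"
  unfolding filtr_def
proof (intro allI conjI ballI)
  fix i v w
  show "subspace (Gam S i)" by (simp add: Gam_def)
  show "Gam S i \<subseteq> W" by (rule Gam_sub_W[OF assms])
  show "Gam S i \<subseteq> Gam S (Suc i)" by (rule Gam_mono) auto
  assume "w \<in> Gam S i"
  then show "act (wgen v) w \<in> Gam S (Suc i)"
    unfolding Gam_def[of S i]
  proof (induction rule: span_induct_alt)
    case (step c x y)
    then obtain \<mu> s where x: "x = act (wmon \<mu>) s" "s \<in> S" "sum \<mu> UNIV \<le> i" by (auto simp: gens_def)
    have "act (wgen v) x = act (wgen v * wmon \<mu>) s" using x assms by (auto simp: act_mult)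
    also have "\<dots> \<in> Gam S (Suc i)"
      using x assms bernstein_wgen[OF wmon_in_bernstein[OF x(3)]] by (intro bernstein_Gam)
    finally show ?case using step by (simp add: act_plus act_scale Gam_def span_add span_scale)
  qed (simp add: Gam_def span_zero)
qed

lemma in_Gam: "s \<in> S \<Longrightarrow> S \<subseteq> W \<Longrightarrow> s \<in> Gam S i"
  using bernstein_Gam[of 1 i s S] one_in_bernstein by (auto simp: act_one subset_eq)

text \<open>Up to a shift of the index, the filtration of a generating set lies below every
  compatible filtration that catches the generators. All comparisons of growth rest on this.\<close>

lemma Gam_least:
  assumes F: "filtr F" and S: "S \<subseteq> F k"
  shows "Gam S i \<subseteq> F (i + k)"
  unfolding Gam_def
proof (rule span_minimal)
  show "gens S i \<subseteq> F (i + k)"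
    using filtr_bernstein[OF F wmon_in_bernstein] S unfolding gens_def by blast
qed (rule filtrD(1)[OF F])

lemma submod_GenM:
  assumes "S \<subseteq> W"
  shows "submod (GenM S)"
  unfolding submod_def
proof (intro conjI allI ballI)
  note F = filtrD[OF filtr_Gam[OF assms]]
  show "subspace (GenM S)"
  proof (rule subspaceI)
    show "0 \<in> GenM S" using subspace_0[OF F(1)] by (auto simp: GenM_def)
    show "scale c x \<in> GenM S" if "x \<in> GenM S" for c x
      using that subspace_scale[OF F(1)] by (auto simp: GenM_def)
    fix x y assume "x \<in> GenM S" "y \<in> GenM S"
    then obtain i j where "x \<in> Gam S i" "y \<in> Gam S j" by (auto simp: GenM_def)
    then have "x \<in> Gam S (max i j)" "y \<in> Gam S (max i j)"
      using F(3)[of i "max i j"] F(3)[of j "max i j"] by auto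
    then show "x + y \<in> GenM S" using subspace_add[OF F(1)] unfolding GenM_def by blast
  qed
  show "GenM S \<subseteq> W" using F(2) by (auto simp: GenM_def)
  show "act (wgen v) w \<in> GenM S" if "w \<in> GenM S" for v w
    using that F(4) unfolding GenM_def by blast
qed

lemma GenM_act: "s \<in> S \<Longrightarrow> S \<subseteq> W \<Longrightarrow> act a s \<in> GenM S"
  using bernstein_exhaust[of a] bernstein_Gam unfolding GenM_def by blast

lemma finite_subset_filtr:
  assumes "filtr F" "finite S" "S \<subseteq> (\<Union>i. F i)"
  shows "\<exists>k. S \<subseteq> F k"
  using assms(2,3)
proof (induction S)
  case (insert x S)
  then obtain k i where "S \<subseteq> F k" "x \<in> F i" by auto
  then have "insert x S \<subseteq> F (max k i)"
    using filtrD(3)[OF assms(1), of k "max k i"] filtrD(3)[OF assms(1), of i "max k i"] by auto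
  then show ?case ..
qed simp

lemma hilbert_polynomial:
  assumes "finite S" "S \<subseteq> W"
  shows "eventually_poly (\<lambda>i. dim (Gam S i))"
proof -
  \<comment> \<open>The generators are numbered so that the term order can break ties between
    them.\<close>
  obtain s r where s: "S = s ` {..<r::nat}"
    using assms(1) by (metis finite_imp_nat_seg_image_inj_on lessThan_def)
  let ?t = "\<lambda>\<mu> j. act (wmon \<mu>) (s j)"
  have gens: "gens S i = {?t \<mu> j | \<mu> j. j < r \<and> sum \<mu> UNIV \<le> i}" for i
    unfolding gens_def s by blast
  have "eventually_poly (\<lambda>i. dim {?t \<mu> j | \<mu> j. j < r \<and> sum \<mu> UNIV \<le> i})"
  proof (rule hilbert_function_eventually_poly)
    fix v show "Vector_Spaces.linear scale scale (act (wgen v))" by (rule act_linear)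
    fix \<mu> j assume j: "j < r"
    then have sj: "s j \<in> S" "s j \<in> W" using s assms(2) by auto
    have "act (wgen v) (?t \<mu> j) - ?t (\<mu>(v := Suc (\<mu> v))) j
        = act (wgen v * wmon \<mu> - wmon (\<mu>(v := Suc (\<mu> v)))) (s j)"
      using sj by (simp add: act_mult act_minus)
    also have "\<dots> \<in> Gam S (sum \<mu> UNIV)"
      by (rule bernstein_Gam[OF wgen_mult_wmon sj(1) assms(2)])
    finally show "act (wgen v) (?t \<mu> j) - ?t (\<mu>(v := Suc (\<mu> v))) j
        \<in> span {?t \<nu> l | \<nu> l. l < r \<and> sum \<nu> UNIV \<le> sum \<mu> UNIV}"
      unfolding Gam_def gens .
  qed
  then show ?thesis unfolding Gam_def gens by simp
qed

subsection \<open>Bernstein's inequality\<close>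

text \<open>Operators are given by their coefficients, without appeal to independence of the
  monomials; that the coefficients vanish is the conclusion of
  \<open>lin_op_faithful\<close>.\<close>

definition lin_op :: "nat \<Rightarrow> (('n weyl_gen \<Rightarrow> nat) \<Rightarrow> 'k) \<Rightarrow> ('n, 'k) weyl" where
  "lin_op i c = (\<Sum>\<mu> | sum \<mu> UNIV \<le> i. weyl_const (c \<mu>) * wmon \<mu>)"

lemma act_lin_op: "w \<in> W \<Longrightarrow> act (lin_op i c) w = (\<Sum>\<mu> | sum \<mu> UNIV \<le> i. scale (c \<mu>) (act (wmon \<mu>) w))"
  unfolding lin_op_def by (simp add: act_sum act_const_mult)

text \<open>The commutator differentiates the normal form in the conjugate variable, so the
  coefficient at \<nu> comes from the exponent one higher there, multiplied by that
  exponent.\<close>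

lemma lin_op_commutator:
  "wgen v * lin_op (Suc i) c - lin_op (Suc i) c * wgen v = lin_op i
     (\<lambda>\<nu>. c (\<nu>(conj_gen v := Suc (\<nu> (conj_gen v)))) * gen_sign v * of_nat (Suc (\<nu> (conj_gen v))))"
proof -
  let ?u = "conj_gen v"
  let ?A = "{\<mu> :: 'n weyl_gen \<Rightarrow> nat. sum \<mu> UNIV \<le> Suc i}"
  let ?f = "\<lambda>\<mu>. weyl_const (c \<mu> * (gen_sign v * of_nat (\<mu> ?u))) * wmon (\<mu>(?u := \<mu> ?u - 1))"
  have commutator_term: "wgen v * (weyl_const k * wmon \<mu>) - weyl_const k * wmon \<mu> * wgen v
      = weyl_const (k * (gen_sign v * of_nat (\<mu> ?u))) * wmon (\<mu>(?u := \<mu> ?u - 1))" for k \<mu>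
  proof -
    have "wgen v * (weyl_const k * wmon \<mu>) = weyl_const k * (wgen v * wmon \<mu>)"
      by (simp only: mult.assoc weyl_const_commute)
    then have "wgen v * (weyl_const k * wmon \<mu>) - weyl_const k * wmon \<mu> * wgen v
        = weyl_const k * (wgen v * wmon \<mu> - wmon \<mu> * wgen v)"
      by (simp only: mult.assoc right_diff_distrib)
    then show ?thesis unfolding wmon_commutator by (simp only: weyl_const_mult mult.assoc)
  qed
  have "wgen v * lin_op (Suc i) c - lin_op (Suc i) c * wgen v = (\<Sum>\<mu>\<in>?A. ?f \<mu>)"
    unfolding lin_op_def sum_distrib_left sum_distrib_right sum_subtractf[symmetric] commutator_term ..
  \<comment> \<open>Terms of exponent 0 in the conjugate variable vanish; on the others lowering the
    exponent is a bijection.\<close>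
  also have "\<dots> = (\<Sum>\<mu> | sum \<mu> UNIV \<le> Suc i \<and> \<mu> ?u > 0. ?f \<mu>)"
    by (rule sum.mono_neutral_right) (auto simp: finite_exponents weyl_const_0)
  also have "\<dots> = (\<Sum>\<nu> | sum \<nu> UNIV \<le> i. ?f (\<nu>(?u := Suc (\<nu> ?u))))"
  proof (rule sum.reindex_bij_witness[of _ "\<lambda>\<nu>. \<nu>(?u := Suc (\<nu> ?u))" "\<lambda>\<mu>. \<mu>(?u := \<mu> ?u - 1)"])
    fix \<mu> :: "'n weyl_gen \<Rightarrow> nat" assume "\<mu> \<in> {\<mu>. sum \<mu> UNIV \<le> Suc i \<and> 0 < \<mu> ?u}"
    then have \<mu>: "sum \<mu> UNIV \<le> Suc i" "0 < \<mu> ?u" by auto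
    let ?\<nu> = "\<mu>(?u := \<mu> ?u - 1)"
    have eq: "\<mu> = ?\<nu>(?u := Suc (?\<nu> ?u))" using \<mu>(2) by (simp add: fun_eq_iff)
    then show "?\<nu>(?u := Suc (?\<nu> ?u)) = \<mu>" by simp
    have "Suc (sum ?\<nu> UNIV) = sum \<mu> UNIV"
      using arg_cong[OF eq, of "\<lambda>f. sum f UNIV"] sum_upd_Suc[of ?\<nu> ?u] by (simp only:)
    then show "?\<nu> \<in> {\<nu>. sum \<nu> UNIV \<le> i}" using \<mu>(1) unfolding mem_Collect_eq by linarith
    show "?f (?\<nu>(?u := Suc (?\<nu> ?u))) = ?f \<mu>" using eq by simp
  next
    fix \<nu> :: "'n weyl_gen \<Rightarrow> nat" assume "\<nu> \<in> {\<nu>. sum \<nu> UNIV \<le> i}"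
    then show "(\<nu>(?u := Suc (\<nu> ?u)))(?u := (\<nu>(?u := Suc (\<nu> ?u))) ?u - 1) = \<nu>"
      "\<nu>(?u := Suc (\<nu> ?u)) \<in> {\<mu>. sum \<mu> UNIV \<le> Suc i \<and> 0 < \<mu> ?u}"
      using sum_upd_Suc[of \<nu> ?u] by auto
  qed
  also have "\<dots> = lin_op i
     (\<lambda>\<nu>. c (\<nu>(conj_gen v := Suc (\<nu> (conj_gen v)))) * gen_sign v * of_nat (Suc (\<nu> (conj_gen v))))"
    unfolding lin_op_def by (intro sum.cong refl) (simp add: mult.assoc del: of_nat_Suc)
  finally show ?thesis .
qed

text \<open>Commutators with the generators lower the degree, so an operator annihilating enough of a
  nonzero cyclic module is forced to be constant and hence zero; this is where characteristic zero
  enters.\<close>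

lemma lin_op_faithful:
  assumes L: "submod L" and u: "u \<in> W" "u \<notin> L"
    and "\<And>w. w \<in> Gam {u} i \<Longrightarrow> act (lin_op i c) w \<in> L" and "sum \<mu> UNIV \<le> i"
  shows "c \<mu> = 0"
  using assms(4,5)
proof (induction i arbitrary: c \<mu>)
  \<comment> \<open>A constant operator multiplies \<open>u\<close> by its constant; a nonzero
    constant could be divided out and would put \<open>u\<close> into \<open>L\<close>.\<close>
  have zero: "c (\<lambda>_. 0) = 0" if c: "act (lin_op i c) u \<in> L" "\<And>\<mu>. sum \<mu> UNIV \<le> i \<Longrightarrow> \<mu> \<noteq> (\<lambda>_. 0) \<Longrightarrow> c \<mu> = 0" for i c
  proof (rule ccontr)
    assume "c (\<lambda>_. 0) \<noteq> 0"
    have "act (lin_op i c) u = (\<Sum>\<mu>\<in>{\<lambda>_. 0}. scale (c \<mu>) (act (wmon \<mu>) u))"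
      unfolding act_lin_op[OF u(1)]
      by (rule sum.mono_neutral_right) (use c(2) finite_exponents in auto)
    then have "scale (c (\<lambda>_. 0)) u \<in> L" using c(1) u(1) by (simp add: wmon_0 act_one)
    then have "scale (inverse (c (\<lambda>_. 0))) (scale (c (\<lambda>_. 0)) u) \<in> L"
      using L by (simp only: submod_def subspace_scale)
    then show False using \<open>c (\<lambda>_. 0) \<noteq> 0\<close> u(2) by simp
  qed
  have u_Gam: "u \<in> Gam {u} i" for i using in_Gam[of u "{u}"] u(1) by simp
  {
    case 0
    then have "\<mu> = (\<lambda>_. 0)" by (auto simp: fun_eq_iff)
    moreover have "c (\<lambda>_. 0) = 0" by (rule zero[of 0 c]) (use 0 u_Gam in \<open>auto simp: fun_eq_iff\<close>)
    ultimately show ?case by simp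
  next
    case (Suc i)
    note F = filtrD[OF filtr_Gam, of "{u}"]
    have nz: "c (\<nu>(conj_gen v := Suc (\<nu> (conj_gen v)))) = 0" if \<nu>: "sum \<nu> UNIV \<le> i" for \<nu> v
    proof -
      let ?c = "\<lambda>\<nu>. c (\<nu>(conj_gen v := Suc (\<nu> (conj_gen v)))) * gen_sign v * of_nat (Suc (\<nu> (conj_gen v)))"
      have "?c \<nu> = 0"
      proof (rule Suc.IH[OF _ \<nu>])
        fix w assume w: "w \<in> Gam {u} i"
        have wW: "w \<in> W" using w F(2) u(1) by blast
        \<comment> \<open>Both orders of composition end in \<open>L\<close>: one because
          \<open>L\<close> is a submodule, the other because a generator moves step i into step
          \<open>Suc i\<close>, where the hypothesis still applies.\<close>
        have "act (lin_op i ?c) w = act (wgen v) (act (lin_op (Suc i) c) w) - act (lin_op (Suc i) c) (act (wgen v) w)"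
          unfolding lin_op_commutator[symmetric] using wW by (simp add: act_minus act_mult)
        also have "\<dots> \<in> L"
        proof -
          have "act (lin_op (Suc i) c) w \<in> L" "act (lin_op (Suc i) c) (act (wgen v) w) \<in> L"
            using Suc.prems(1) w F(3)[of i "Suc i"] F(4)[OF _ w] u(1) by auto
          then show ?thesis using submod_act[OF L] L by (simp add: submod_def subspace_diff)
        qed
        finally show "act (lin_op i ?c) w \<in> L" .
      qed
      moreover have "gen_sign v \<noteq> (0 :: 'k)" by (cases v) simp_all
      ultimately show ?thesis by (simp del: of_nat_Suc)
    qed
    have c0: "c \<mu> = 0" if \<mu>: "sum \<mu> UNIV \<le> Suc i" "\<mu> \<noteq> (\<lambda>_. 0)" for \<mu>
    proof -
      \<comment> \<open>A nonzero exponent is positive in some variable, and the commutator with the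
        conjugate of that variable detects its coefficient.\<close>
      obtain t where t: "\<mu> t > 0" using \<mu>(2) by (auto simp: fun_eq_iff)
      define v where "v = conj_gen t"
      have v: "conj_gen v = t" unfolding v_def by (cases t) simp_all
      let ?\<nu> = "\<mu>(t := \<mu> t - 1)"
      have eq: "\<mu> = ?\<nu>(t := Suc (?\<nu> t))" using t by (simp add: fun_eq_iff)
      then have "sum ?\<nu> UNIV \<le> i" using sum_upd_Suc[of ?\<nu> t] \<mu>(1) by simp
      from nz[OF this, of v] show ?thesis unfolding v using eq by simp
    qed
    moreover have "c (\<lambda>_. 0) = 0" by (rule zero[of "Suc i" c]) (use Suc.prems(1) u_Gam c0 in auto)
    ultimately show ?case using Suc.prems(2) by (cases "\<mu> = (\<lambda>_. 0)") auto
  }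
qed

context
  fixes L P
  assumes L: "submod L"
    and P: "Vector_Spaces.linear scale scale P" "\<And>v. P v = 0 \<longleftrightarrow> v \<in> L"
begin

text \<open>The range of \<open>P\<close> plays the quotient by \<open>L\<close>. By
  \<open>lin_op_faithful\<close> the monomial operators are independent as maps between two steps of
  it, and such a map is stored by its values on lifts of a basis of the first step.\<close>

lemma quotient_dim_product:
  assumes u: "u \<in> W" "u \<notin> L"
  shows "card {\<mu> :: 'n weyl_gen \<Rightarrow> nat. sum \<mu> UNIV \<le> i}
    \<le> dim (P ` Gam {u} i) * dim (P ` Gam {u} (i + i))"
proof -
  interpret P: Vector_Spaces.linear scale scale P by (rule P(1))
  interpret pr: vector_space_pair scale scale ..
  interpret V2: vector_space "\<lambda>c f x. scale c (f x) :: 'v" by (rule vector_space_fun)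
  interpret pr2: vector_space_pair scale "\<lambda>c f x. scale c (f x) :: 'v" ..
  have uW: "{u} \<subseteq> W" using u by simp
  note F = filtrD[OF filtr_Gam[OF uW]]
  have fd: "finite E" if "E \<subseteq> P ` Gam {u} j" "independent E" for E j
  proof -
    have "P ` Gam {u} j = span (P ` gens {u} j)"
      unfolding Gam_def by (rule pr.linear_span_image[OF P(1), symmetric])
    then show ?thesis using independent_span_bound[of "P ` gens {u} j" E] finite_gens[of "{u}" j] that by simp
  qed
  obtain E where E: "E \<subseteq> P ` Gam {u} i" "independent E" "P ` Gam {u} i \<subseteq> span E" "card E = dim (P ` Gam {u} i)"
    by (rule basis_exists)
  obtain E' where E': "E' \<subseteq> P ` Gam {u} (i + i)" "independent E'" "P ` Gam {u} (i + i) \<subseteq> span E'"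
      "card E' = dim (P ` Gam {u} (i + i))"
    by (rule basis_exists)
  obtain Q where Q: "Q \<subseteq> Gam {u} i" "inj_on P Q" "E = P ` Q"
    using subset_image_inj[of E P "Gam {u} i"] E(1) by blast
  have fin: "finite Q" "finite E'" using fd[OF E(1,2)] fd[OF E'(1,2)] Q by (simp_all add: finite_image_iff)
  \<comment> \<open>Elementary matrices: the lift \<open>q\<close> goes to \<open>e\<close>, the
    other lifts to 0.\<close>
  define \<delta> where "\<delta> q e = (\<lambda>x. if x = q then e else 0)" for q e :: 'v
  define f where "f \<mu> = (\<lambda>x. if x \<in> Q then P (act (wmon \<mu>) x) else 0)" for \<mu>
  have "card {\<mu> :: 'n weyl_gen \<Rightarrow> nat. sum \<mu> UNIV \<le> i} \<le> card ((\<lambda>(q, e). \<delta> q e) ` (Q \<times> E'))"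
  proof (rule V2.card_le_of_independent_family[where f = f])
    show "f ` {\<mu>. sum \<mu> UNIV \<le> i} \<subseteq> V2.span ((\<lambda>(q, e). \<delta> q e) ` (Q \<times> E'))"
    proof safe
      fix \<mu> :: "'n weyl_gen \<Rightarrow> nat" assume \<mu>: "sum \<mu> UNIV \<le> i"
      have "f \<mu> = (\<Sum>q\<in>Q. \<delta> q (P (act (wmon \<mu>) q)))"
      proof
        fix x
        have "(\<Sum>q\<in>Q. \<delta> q (P (act (wmon \<mu>) q))) x = (\<Sum>q\<in>Q. \<delta> q (P (act (wmon \<mu>) q)) x)"
          by (rule sum_fun_apply)
        then show "f \<mu> x = (\<Sum>q\<in>Q. \<delta> q (P (act (wmon \<mu>) q))) x"
          using fin(1) by (simp add: f_def \<delta>_def)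
      qed
      also have "\<dots> \<in> V2.span ((\<lambda>(q, e). \<delta> q e) ` (Q \<times> E'))"
      proof (rule V2.span_sum)
        fix q assume q: "q \<in> Q"
        have lin: "Vector_Spaces.linear scale (\<lambda>c f x. scale c (f x)) (\<delta> q)"
          unfolding Vector_Spaces.linear_iff
          using vector_space_axioms vector_space_fun by (auto simp: \<delta>_def fun_eq_iff)
        have "act (wmon \<mu>) q \<in> Gam {u} (i + i)"
          using filtr_bernstein[OF filtr_Gam[OF uW] wmon_in_bernstein[OF \<mu>]] q Q(1) by blast
        then have "P (act (wmon \<mu>) q) \<in> span E'" using E'(3) by blast
        then have "\<delta> q (P (act (wmon \<mu>) q)) \<in> V2.span (\<delta> q ` E')"
          using pr2.linear_span_image[OF lin] by blast
        moreover have "\<delta> q ` E' \<subseteq> (\<lambda>(q, e). \<delta> q e) ` (Q \<times> E')" using q by auto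
        ultimately show "\<delta> q (P (act (wmon \<mu>) q)) \<in> V2.span ((\<lambda>(q, e). \<delta> q e) ` (Q \<times> E'))"
          using V2.span_mono by blast
      qed
      finally show "f \<mu> \<in> V2.span ((\<lambda>(q, e). \<delta> q e) ` (Q \<times> E'))" .
    qed
    fix c :: "('n weyl_gen \<Rightarrow> nat) \<Rightarrow> 'k"
    assume c: "(\<Sum>\<mu> | sum \<mu> UNIV \<le> i. (\<lambda>x. scale (c \<mu>) (f \<mu> x))) = 0"
    \<comment> \<open>A linear relation among the matrices says that the combined operator sends
      every lift into \<open>L\<close>.\<close>
    have Q_L: "act (lin_op i c) q \<in> L" if q: "q \<in> Q" for q
    proof -
      have qW: "q \<in> W" using q Q(1) F(2) by blast
      have "(\<Sum>\<mu> | sum \<mu> UNIV \<le> i. (\<lambda>x. scale (c \<mu>) (f \<mu> x))) q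
          = (\<Sum>\<mu> | sum \<mu> UNIV \<le> i. scale (c \<mu>) (f \<mu> q))"
        by (rule sum_fun_apply)
      then have "(\<Sum>\<mu> | sum \<mu> UNIV \<le> i. scale (c \<mu>) (f \<mu> q)) = 0" using c by simp
      then have "P (act (lin_op i c) q) = 0"
        using q unfolding act_lin_op[OF qW] by (simp add: f_def P.sum P.scale)
      then show ?thesis using P(2) by simp
    qed
    \<comment> \<open>Each element of the step differs from a combination of lifts by an element of
      \<open>L\<close>, which the operator keeps in \<open>L\<close>.\<close>
    have "act (lin_op i c) w \<in> L" if w: "w \<in> Gam {u} i" for w
    proof -
      have "P w \<in> span E" using w E(3) by blast
      then have "P w \<in> P ` span Q" unfolding Q(3) using pr.linear_span_image[OF P(1), of Q] by simp
      then obtain s where s: "s \<in> span Q" "P w = P s" by blast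
      have "w - s \<in> L" using s(2) P(2)[of "w - s"] by (simp add: P.diff)
      then have "act (lin_op i c) (w - s) \<in> L" by (rule submod_act[OF L])
      moreover have "act (lin_op i c) s \<in> L"
      proof -
        have "act (lin_op i c) s \<in> act (lin_op i c) ` span Q" using s(1) by blast
        also have "\<dots> = span (act (lin_op i c) ` Q)" using pr.linear_span_image[OF act_linear] by simp
        also have "\<dots> \<subseteq> L" using L Q_L by (intro span_minimal) (auto simp: submod_def)
        finally show ?thesis .
      qed
      ultimately have "act (lin_op i c) (w - s) + act (lin_op i c) s \<in> L"
        using L by (simp add: submod_def subspace_add)
      then show ?thesis by (simp add: act_diff)
    qed
    then show "\<forall>\<mu>\<in>{\<mu>. sum \<mu> UNIV \<le> i}. c \<mu> = 0" using lin_op_faithful[OF L u] by blast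
  qed (use fin finite_exponents in auto)
  also have "\<dots> \<le> card (Q \<times> E')" using fin by (intro card_image_le) simp
  also have "\<dots> = card Q * card E'" by (rule card_cartesian_product)
  also have "\<dots> = dim (P ` Gam {u} i) * dim (P ` Gam {u} (i + i))"
    using E(4) E'(4) Q card_image[OF Q(2)] by simp
  finally show ?thesis .
qed

text \<open>With N variables, the exponents bounded by \<open>q\<close> in each of the 2N generators
  have degree at most 2Nq and number at least the 2N-th power of \<open>q\<close>. The product
  inequality at 2Nq, with both factors raised to index 4Nq, turns this into a bound on a
  square.\<close>

lemma quotient_dim_lower:
  assumes u: "u \<in> W" "u \<notin> L"
  shows "q ^ card (UNIV :: 'n set) \<le> dim (P ` Gam {u} (4 * card (UNIV :: 'n set) * q))"
proof -
  interpret pr: vector_space_pair scale scale ..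
  let ?N = "card (UNIV :: 'n set)"
  let ?i = "2 * ?N * q"
  let ?h = "dim (P ` Gam {u} (?i + ?i))"
  have "(q ^ ?N) ^ 2 \<le> ((q + 1) ^ ?N) ^ 2" by (intro power_mono) auto
  also have "\<dots> = card {\<mu> :: 'n weyl_gen \<Rightarrow> nat. \<forall>v. \<mu> v \<le> q}"
    by (simp only: card_bounded_functions card_weyl_gen power_mult[symmetric] mult.commute)
  also have "\<dots> \<le> card {\<mu> :: 'n weyl_gen \<Rightarrow> nat. sum \<mu> UNIV \<le> ?i}"
  proof (rule card_mono[OF finite_exponents], safe)
    fix \<mu> :: "'n weyl_gen \<Rightarrow> nat" assume "\<forall>v. \<mu> v \<le> q"
    then have "sum \<mu> UNIV \<le> of_nat (card (UNIV :: 'n weyl_gen set)) * q"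
      by (intro sum_bounded_above) simp
    then show "sum \<mu> UNIV \<le> ?i" by (simp add: card_weyl_gen)
  qed
  also have "\<dots> \<le> dim (P ` Gam {u} ?i) * ?h" by (rule quotient_dim_product[OF u])
  also have "\<dots> \<le> ?h * ?h"
  proof (rule mult_right_mono)
    have "P ` Gam {u} (?i + ?i) \<subseteq> span (P ` gens {u} (?i + ?i))"
      unfolding Gam_def pr.linear_span_image[OF P(1)] by blast
    moreover have "P ` Gam {u} ?i \<subseteq> span (P ` Gam {u} (?i + ?i))"
      using Gam_mono[of "{u}" "{u}" ?i "?i + ?i"] span_superset by (meson image_mono le_add1 order.refl order.trans)
    ultimately show "dim (P ` Gam {u} ?i) \<le> ?h"
      using finite_gens[of "{u}"] by (intro dim_mono_finite_span[where W = "P ` gens {u} (?i + ?i)"]) auto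
  qed simp
  finally have "q ^ ?N \<le> ?h" by (simp only: power2_eq_square[symmetric] power2_nat_le_eq_le)
  moreover have "?i + ?i = 4 * ?N * q" by simp
  ultimately show ?thesis by metis
qed

end

text \<open>Rank-nullity modulo the submodule generated so far: the kernel contains the step of the
  old generators, and the image contains that of the new one, which
  \<open>quotient_dim_lower\<close> bounds from below. The step index is the same throughout, so the
  contributions add up.\<close>

lemma chain_dim_lower:
  assumes "\<And>j. j < length us \<Longrightarrow> us ! j \<in> W \<and> us ! j \<notin> GenM (set (take j us))"
  shows "length us * q ^ card (UNIV :: 'n set) \<le> dim (Gam (set us) (4 * card (UNIV :: 'n set) * q))"
  using assms
proof (induction us rule: rev_induct)
  case (snoc u us)
  let ?i = "4 * card (UNIV :: 'n set) * q"
  have us: "us ! j \<in> W \<and> us ! j \<notin> GenM (set (take j us))" if "j < length us" for j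
    using snoc.prems[of j] that by (simp add: nth_append)
  have u: "u \<in> W" "u \<notin> GenM (set us)" using snoc.prems[of "length us"] by auto
  have usW: "set us \<subseteq> W" using us by (auto simp: in_set_conv_nth)
  have sub: "subspace (GenM (set us))" using submod_GenM[OF usW] by (simp add: submod_def)
  obtain P where P: "Vector_Spaces.linear scale scale P" "\<And>v. P v = 0 \<longleftrightarrow> v \<in> GenM (set us)"
    "\<And>v. v - P v \<in> GenM (set us)"
    using projection_along_exists[OF sub] by blast
  have "length (us @ [u]) * q ^ card (UNIV :: 'n set) = q ^ card (UNIV :: 'n set) + length us * q ^ card (UNIV :: 'n set)"
    by simp
  also have "\<dots> \<le> dim (P ` Gam {u} ?i) + dim (Gam (set us) ?i)"
    using quotient_dim_lower[OF submod_GenM[OF usW] P(1,2) u] snoc.IH[OF us] by (intro add_mono) auto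
  also have "\<dots> \<le> dim (Gam (set (us @ [u])) ?i)"
  proof (rule dim_image_add_kernel_le[OF P(1)])
    show "Gam (set (us @ [u])) ?i \<subseteq> span (gens (set (us @ [u])) ?i)" by (simp add: Gam_def)
    show "finite (gens (set (us @ [u])) ?i)" by (rule finite_gens) simp
    show "Gam (set us) ?i \<subseteq> span (Gam (set (us @ [u])) ?i)"
      using Gam_mono[of "set us" "set (us @ [u])" ?i ?i] span_superset by fastforce
    show "P b = 0" if "b \<in> Gam (set us) ?i" for b using that P(2) by (auto simp: GenM_def)
    show "P ` Gam {u} ?i \<subseteq> P ` Gam (set (us @ [u])) ?i"
      by (intro image_mono Gam_mono) auto
  qed
  finally show ?case .
qed simp

subsection \<open>Finite generation and dimension\<close>

lemma dim_Gam_le_filtr: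
  assumes F: "filtr F" "finite G" "F (i + k) \<subseteq> span G" and S: "S \<subseteq> F k"
  shows "dim (Gam S i) \<le> dim (F (i + k))"
  using Gam_least[OF F(1) S, of i] F(2,3) span_superset[of "F (i + k)"]
  by (intro dim_mono_finite_span[where W = G]) auto

text \<open>Without finite generation there are chains of every length. Their dimension grows with
  the length as a factor, which the fixed constant \<open>C\<close> cannot match.\<close>

lemma finitely_generated_of_filtr:
  assumes F: "filtr F" "\<And>i. \<exists>G. finite G \<and> F i \<subseteq> span G" "W \<subseteq> (\<Union>i. F i)"
    and bound: "\<And>i. dim (F i) \<le> C * (i + 1) ^ card (UNIV :: 'n set)"
  shows "\<exists>S. finite S \<and> S \<subseteq> W \<and> W \<subseteq> GenM S"
proof (rule ccontr)
  assume no: "\<not> ?thesis"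
  let ?N = "card (UNIV :: 'n set)"
  have "\<exists>us. length us = s \<and> (\<forall>j<length us. us ! j \<in> W \<and> us ! j \<notin> GenM (set (take j us)))" for s
  proof (induction s)
    case (Suc s)
    then obtain us where us: "length us = s" "\<And>j. j < length us \<Longrightarrow> us ! j \<in> W \<and> us ! j \<notin> GenM (set (take j us))"
      by blast
    have "set us \<subseteq> W" using us by (auto simp: in_set_conv_nth)
    then obtain u where u: "u \<in> W" "u \<notin> GenM (set us)" using no by blast
    show ?case
      by (rule exI[of _ "us @ [u]"]) (use us u in \<open>auto simp: nth_append less_Suc_eq\<close>)
  qed simp
  \<comment> \<open>The length must be fixed before the step \<open>k\<close> that contains the
    chain is known, so it depends only on \<open>C\<close> and \<open>?N\<close>.\<close>
  then obtain us where us: "length us = C * (4 * ?N + 1) ^ ?N + 1"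
    "\<And>j. j < length us \<Longrightarrow> us ! j \<in> W \<and> us ! j \<notin> GenM (set (take j us))"
    by blast
  have "set us \<subseteq> W" using us(2) by (auto simp: in_set_conv_nth)
  then obtain k where k: "set us \<subseteq> F k" using finite_subset_filtr[OF F(1), of "set us"] F(3) by auto
  \<comment> \<open>With this choice \<open>4 * ?N * ?q + k + 1\<close> is exactly a multiple of
    \<open>?q\<close>, and the shift by \<open>k\<close> disappears into the factor
    \<open>4 * ?N + 1\<close>.\<close>
  let ?q = "k + 1"
  obtain G where G: "finite G" "F (4 * ?N * ?q + k) \<subseteq> span G" using F(2) by blast
  have "length us * ?q ^ ?N \<le> dim (Gam (set us) (4 * ?N * ?q))"
    by (rule chain_dim_lower[OF us(2)])
  also have "\<dots> \<le> dim (F (4 * ?N * ?q + k))"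
    by (rule dim_Gam_le_filtr[OF F(1) G k])
  also have "\<dots> \<le> C * (4 * ?N * ?q + k + 1) ^ ?N" by (rule bound)
  also have "\<dots> = C * ((4 * ?N + 1) * ?q) ^ ?N" by (simp add: algebra_simps)
  also have "\<dots> = C * (4 * ?N + 1) ^ ?N * ?q ^ ?N" by (simp only: power_mult_distrib mult.assoc)
  finally have "length us \<le> C * (4 * ?N + 1) ^ ?N" by (rule mult_right_le_imp_le) simp
  then show False using us(1) by simp
qed

lemma hilbert_degree_le:
  fixes p :: "rat poly"
  assumes F: "filtr F" "\<And>i. \<exists>G. finite G \<and> F i \<subseteq> span G" "W \<subseteq> (\<Union>i. F i)"
    and bound: "\<And>i. dim (F i) \<le> C * (i + 1) ^ d"
    and S: "finite S" "S \<subseteq> W"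
    and p: "\<forall>\<^sub>F i in sequentially. of_nat (dim (Gam S i)) = poly p (of_nat i)"
  shows "degree p \<le> d"
proof -
  obtain k where k: "S \<subseteq> F k" using finite_subset_filtr[OF F(1) S(1)] S(2) F(3) by auto
  have le: "dim (Gam S i) \<le> (C * (k + 1) ^ d) * (i + 1) ^ d" for i
  proof -
    obtain G where G: "finite G" "F (i + k) \<subseteq> span G" using F(2) by blast
    have "dim (Gam S i) \<le> C * (i + k + 1) ^ d"
      using dim_Gam_le_filtr[OF F(1) G k] bound[of "i + k"] by simp
    \<comment> \<open>The shift by \<open>k\<close> becomes a factor and so part of the
      constant.\<close>
    also have "\<dots> \<le> C * ((k + 1) * (i + 1)) ^ d"
      by (intro mult_left_mono power_mono) auto
    also have "\<dots> = (C * (k + 1) ^ d) * (i + 1) ^ d" by (simp only: power_mult_distrib mult.assoc)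
    finally show ?thesis .
  qed
  show ?thesis
  proof (rule degree_le_of_bound)
    show "\<forall>\<^sub>F i in sequentially. poly p (of_nat i) \<le> of_nat (C * (k + 1) ^ d * (i + 1) ^ d)"
      using p
    proof eventually_elim
      case (elim i)
      have "(of_nat (dim (Gam S i)) :: rat) \<le> of_nat (C * (k + 1) ^ d * (i + 1) ^ d)"
        by (rule of_nat_mono[OF le])
      then show ?case using elim by simp
    qed
    show "\<forall>\<^sub>F i in sequentially. 0 \<le> poly p (of_nat i)"
      using p by eventually_elim (metis of_nat_0_le_iff)
  qed
qed

lemma filtr_Gam_finite: "finite S \<Longrightarrow> \<exists>G. finite G \<and> Gam S i \<subseteq> span G"
  using finite_gens unfolding Gam_def by blast

text \<open>The filtration of \<open>S'\<close> exhausts the module and grows with exponent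
  \<open>degree p'\<close>, so it can serve as the dominating filtration. Exchanging two generating
  sets shows that the dimension does not depend on them.\<close>

lemma hilbert_degree_unique:
  fixes p p' :: "rat poly"
  assumes S: "finite S" "S \<subseteq> W" and S': "finite S'" "S' \<subseteq> W" "W \<subseteq> GenM S'"
    and p: "\<forall>\<^sub>F i in sequentially. of_nat (dim (Gam S i)) = poly p (of_nat i)"
    and p': "\<forall>\<^sub>F i in sequentially. of_nat (dim (Gam S' i)) = poly p' (of_nat i)"
  shows "degree p \<le> degree p'"
proof -
  obtain C where C: "\<And>i. dim (Gam S' i) \<le> C * (i + 1) ^ degree p'"
    using eventually_poly_growth[OF p'] by blast
  show ?thesis
    by (rule hilbert_degree_le[OF filtr_Gam[OF S'(2)] filtr_Gam_finite[OF S'(1)] _ C S p])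
       (use S'(3) in \<open>simp add: GenM_def\<close>)
qed

text \<open>Bernstein's inequality. A nonzero module contains a nonzero cyclic one, whose filtration
  is dominated after a shift.\<close>

lemma hilbert_degree_ge:
  fixes p :: "rat poly"
  assumes S: "finite S" "S \<subseteq> W" "W \<subseteq> GenM S" and nz: "W \<noteq> {0}"
    and p: "\<forall>\<^sub>F i in sequentially. of_nat (dim (Gam S i)) = poly p (of_nat i)"
  shows "card (UNIV :: 'n set) \<le> degree p"
proof -
  let ?N = "card (UNIV :: 'n set)"
  obtain u where u: "u \<in> W" "u \<noteq> 0" using nz subspace_0[OF W] by blast
  \<comment> \<open>The identity is a projection along the zero submodule, which turns the bound for
    quotients into one for the module itself.\<close>
  have L: "submod {0}" using subspace_0[OF W] by (simp add: submod_def)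
  have id: "Vector_Spaces.linear scale scale (\<lambda>v. v)" by (rule linear_ident)
  have low: "q ^ ?N \<le> dim (Gam {u} (4 * ?N * q))" for q
    using quotient_dim_lower[OF L id, of u q] u by simp
  obtain k where k: "{u} \<subseteq> Gam S k"
    using finite_subset_filtr[OF filtr_Gam[OF S(2)], of "{u}"] u(1) S(3) by (auto simp: GenM_def)
  obtain K where K: "\<And>i. i \<ge> K \<Longrightarrow> of_nat (dim (Gam S i)) = poly p (of_nat i)"
    using p by (auto simp: eventually_sequentially)
  \<comment> \<open>The extra 1 in the factor absorbs the shift \<open>k\<close> as soon as
    \<open>q\<close> is at least \<open>k\<close>.\<close>
  have "of_nat (q ^ ?N) \<le> poly p (of_nat ((4 * ?N + 1) * q))" if q: "q \<ge> k + K" for q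
  proof -
    have "q ^ ?N \<le> dim (Gam {u} (4 * ?N * q))" by (rule low)
    also have "\<dots> \<le> dim (Gam S (4 * ?N * q + k))"
      using filtr_Gam_finite[OF S(1)] dim_Gam_le_filtr[OF filtr_Gam[OF S(2)] _ _ k] by blast
    also have "\<dots> \<le> dim (Gam S ((4 * ?N + 1) * q))"
      using finite_gens[OF S(1)] Gam_mono[of S S "4 * ?N * q + k" "(4 * ?N + 1) * q"] q
      unfolding Gam_def by (intro dim_mono_finite_span[where W = "gens S ((4 * ?N + 1) * q)"]) (auto simp: span_span)
    finally have "(of_nat (q ^ ?N) :: rat) \<le> of_nat (dim (Gam S ((4 * ?N + 1) * q)))"
      by (rule of_nat_mono)
    moreover have "(4 * ?N + 1) * q \<ge> K" using q by simp
    ultimately show ?thesis by (simp only: K)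
  qed
  moreover have "0 < 4 * ?N + 1" by (simp only: zero_less_Suc Suc_eq_plus1[symmetric])
  ultimately show ?thesis by (intro degree_ge_of_bound[of "4 * ?N + 1" "k + K"])
qed

end

section \<open>Embedding modules into a type with a vector space structure\<close>

text \<open>The free vector space on the type of module elements. It supplies the type-class
  addition that \<open>vector_space\<close> requires and that a module given by a carrier
  lacks.\<close>

definition pscale :: "'k::field \<Rightarrow> ('m \<Rightarrow>\<^sub>0 'k) \<Rightarrow> 'm \<Rightarrow>\<^sub>0 'k" where
  "pscale c p = Poly_Mapping.map (\<lambda>x. c * x) p"

lemma lookup_pscale: "Poly_Mapping.lookup (pscale c p) m = c * Poly_Mapping.lookup p m"
  by (simp add: pscale_def Poly_Mapping.map.rep_eq when_def)

interpretation pv: vector_space pscale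
  by unfold_locales (auto intro!: poly_mapping_eqI simp: lookup_pscale lookup_add algebra_simps)

text \<open>Infinite index sets form no exception, since both sums are then zero by
  convention.\<close>

lemma finsum_hom:
  assumes "abelian_monoid U" and h: "\<And>x. x \<in> A \<Longrightarrow> h x \<in> carrier U"
    and f0: "f \<zero>\<^bsub>U\<^esub> = 0"
    and f: "\<And>x y. x \<in> carrier U \<Longrightarrow> y \<in> carrier U \<Longrightarrow> f (x \<oplus>\<^bsub>U\<^esub> y) = f x + f y"
  shows "f (\<Oplus>\<^bsub>U\<^esub>x\<in>A. h x) = (\<Sum>x\<in>A. (f (h x) :: 'v::ab_group_add))"
proof -
  interpret U: abelian_monoid U by (rule assms(1))
  show ?thesis
    using h
  proof (induction A rule: infinite_finite_induct)
    case (insert x A)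
    then have "h \<in> A \<rightarrow> carrier U" "h x \<in> carrier U" by auto
    then show ?case using insert by (simp add: U.finsum_insert f)
  qed (simp_all add: f0 U.finsum_infinite)
qed

text \<open>\<open>e\<close> evaluates a formal linear combination of elements of \<open>M\<close>; \<open>f\<close> is a linear section of it,
  obtained by projecting the free vector space along the kernel of \<open>e\<close>.\<close>

lemma vectorspace_embedding:
  fixes M :: "('k::field, 'm, 'z) module_scheme" (structure)
  assumes "vectorspace class_ring M"
  obtains f :: "'m \<Rightarrow> ('m \<Rightarrow>\<^sub>0 'k)" and e where
    "\<And>v. e v \<in> carrier M" "\<And>v w. e (v + w) = e v \<oplus> e w" "\<And>c v. e (pscale c v) = c \<odot> e v"
    "\<And>x. x \<in> carrier M \<Longrightarrow> e (f x) = x"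
    "\<And>x y. x \<in> carrier M \<Longrightarrow> y \<in> carrier M \<Longrightarrow> f (x \<oplus> y) = f x + f y"
    "\<And>c x. x \<in> carrier M \<Longrightarrow> f (c \<odot> x) = pscale c (f x)"
proof -
  interpret M: vectorspace class_ring M by (rule assms)
  \<comment> \<open>Symbols outside the carrier are ignored, which makes \<open>e\<close> linear on
    the whole type.\<close>
  define e :: "('m \<Rightarrow>\<^sub>0 'k) \<Rightarrow> 'm" where
    "e p = (\<Oplus>m\<in>Poly_Mapping.keys p \<inter> carrier M. Poly_Mapping.lookup p m \<odot> m)" for p
  have sm: "c \<odot> m \<in> carrier M" if "m \<in> carrier M" for c m using that M.smult_closed[of c m] by simp
  have e_sup: "e p = (\<Oplus>m\<in>A. Poly_Mapping.lookup p m \<odot> m)"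
    if A: "finite A" "A \<subseteq> carrier M" "Poly_Mapping.keys p \<inter> carrier M \<subseteq> A" for p A
    unfolding e_def
  proof (rule M.add.finprod_mono_neutral_cong_left[OF A(1,3)])
    fix m assume "m \<in> A - Poly_Mapping.keys p \<inter> carrier M"
    then have "Poly_Mapping.lookup p m = 0" "m \<in> carrier M" using A(2) by (auto simp: in_keys_iff)
    then show "Poly_Mapping.lookup p m \<odot> m = \<zero>" using M.lmult_0[of m] by simp
  qed (use A sm in auto)
  have e_closed: "e p \<in> carrier M" for p unfolding e_def by (rule M.finsum_closed) (use sm in auto)
  have e_add: "e (p + q) = e p \<oplus> e q" for p q
  proof -
    let ?A = "(Poly_Mapping.keys p \<union> Poly_Mapping.keys q) \<inter> carrier M"
    have "e (p + q) = (\<Oplus>m\<in>?A. Poly_Mapping.lookup (p + q) m \<odot> m)"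
      by (rule e_sup) (use Poly_Mapping.keys_add[of p q] in auto)
    also have "\<dots> = (\<Oplus>m\<in>?A. Poly_Mapping.lookup p m \<odot> m \<oplus> Poly_Mapping.lookup q m \<odot> m)"
      by (rule M.finsum_cong') (use sm M.smult_l_distr in \<open>auto simp: lookup_add\<close>)
    also have "\<dots> = (\<Oplus>m\<in>?A. Poly_Mapping.lookup p m \<odot> m) \<oplus> (\<Oplus>m\<in>?A. Poly_Mapping.lookup q m \<odot> m)"
      by (rule M.finsum_addf) (use sm in auto)
    also have "(\<Oplus>m\<in>?A. Poly_Mapping.lookup p m \<odot> m) = e p"
      by (rule e_sup[symmetric]) auto
    also have "(\<Oplus>m\<in>?A. Poly_Mapping.lookup q m \<odot> m) = e q"
      by (rule e_sup[symmetric]) auto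
    finally show ?thesis .
  qed
  have e_scale: "e (pscale c p) = c \<odot> e p" for c p
  proof -
    let ?A = "Poly_Mapping.keys p \<inter> carrier M"
    have "e (pscale c p) = (\<Oplus>m\<in>?A. Poly_Mapping.lookup (pscale c p) m \<odot> m)"
      by (rule e_sup) (auto simp: in_keys_iff lookup_pscale)
    also have "\<dots> = (\<Oplus>m\<in>?A. c \<odot> (Poly_Mapping.lookup p m \<odot> m))"
      by (rule M.finsum_cong') (use sm M.smult_assoc1 in \<open>auto simp: lookup_pscale\<close>)
    also have "\<dots> = c \<odot> (\<Oplus>m\<in>?A. Poly_Mapping.lookup p m \<odot> m)"
      by (rule M.finsum_smult[symmetric]) (use sm in auto)
    finally show ?thesis by (simp add: e_def)
  qed
  have e_single: "e (Poly_Mapping.single m 1) = m" if "m \<in> carrier M" for m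
  proof -
    have "e (Poly_Mapping.single m 1) = (\<Oplus>x\<in>{m}. Poly_Mapping.lookup (Poly_Mapping.single m 1) x \<odot> x)"
      by (rule e_sup) (use that in auto)
    also have "\<dots> = m"
      using that sm M.smult_one[of m] M.finsum_insert[of "{}" m "\<lambda>x. Poly_Mapping.lookup (Poly_Mapping.single m 1) x \<odot> x"]
      by (simp add: M.finsum_empty)
    finally show ?thesis .
  qed
  define K where "K = {p. e p = \<zero>}"
  have e0: "e 0 = \<zero>" by (simp add: e_def)
  have e_diff: "e (p - q) = \<zero> \<longleftrightarrow> e p = e q" for p q
  proof -
    have "e p = e (p - q) \<oplus> e q" using e_add[of "p - q" q] by simp
    then show ?thesis using e_closed M.l_zero M.add.r_cancel_one'[of "e q" "e (p - q)"] by (metis M.add.l_cancel_one')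
  qed
  have "pv.subspace K"
    by (rule pv.subspaceI) (use M.rmult_0 in \<open>auto simp: K_def e0 e_add e_scale\<close>)
  then obtain P where P: "Vector_Spaces.linear pscale pscale P" "\<And>v. P v = 0 \<longleftrightarrow> v \<in> K" "\<And>v. v - P v \<in> K"
    using pv.projection_along_exists by metis
  interpret P: Vector_Spaces.linear pscale pscale P by (rule P(1))
  have P_eq: "P v = P w \<longleftrightarrow> e v = e w" for v w
    using P(2)[of "v - w"] e_diff[of v w] by (simp add: P.diff K_def)
  define f where "f x = P (Poly_Mapping.single x 1)" for x
  show thesis
  proof
    fix x y c assume x: "x \<in> carrier M"
    have "e (P (Poly_Mapping.single x 1)) = e (Poly_Mapping.single x 1)"
      using P(3)[of "Poly_Mapping.single x 1"] e_diff by (simp add: K_def)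
    then show "e (f x) = x" using e_single[OF x] by (simp add: f_def)
    show "f (c \<odot> x) = pscale c (f x)"
      unfolding f_def P.scale[symmetric] P_eq using x e_single sm by (simp add: e_scale)
    assume y: "y \<in> carrier M"
    show "f (x \<oplus> y) = f x + f y"
      unfolding f_def P.add[symmetric] P_eq using x y e_single by (simp add: e_add)
  qed (use e_closed e_add e_scale in auto)
qed

lemma subspace_image_carrier:
  fixes U :: "('k::field, 'm, 'z) module_scheme" (structure) and f :: "'m \<Rightarrow> ('a \<Rightarrow>\<^sub>0 'k)"
  assumes "vectorspace class_ring U"
    and add: "\<And>x y. x \<in> carrier U \<Longrightarrow> y \<in> carrier U \<Longrightarrow> f (x \<oplus> y) = f x + f y"
    and scale: "\<And>c x. x \<in> carrier U \<Longrightarrow> f (c \<odot> x) = pscale c (f x)"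
  shows "pv.subspace (f ` carrier U)"
proof -
  interpret U: vectorspace class_ring U by (rule assms(1))
  show ?thesis
  proof (rule pv.subspaceI)
    show "0 \<in> f ` carrier U" using add[of \<zero> \<zero>] by (auto intro!: image_eqI[of _ f \<zero>])
    fix x c assume "x \<in> f ` carrier U"
    then obtain u where u: "u \<in> carrier U" "x = f u" by blast
    then show "pscale c x \<in> f ` carrier U"
      using scale[of u c] U.smult_closed[of c u] by (auto intro!: image_eqI[of _ f "c \<odot> u"])
    fix y assume "y \<in> f ` carrier U"
    then obtain v where "v \<in> carrier U" "y = f v" by blast
    then show "x + y \<in> f ` carrier U" using u add by (auto intro!: image_eqI[of _ f "u \<oplus> v"])
  qed
qed

text \<open>One dimension is the least size of a finite spanning set, the other the size of a basis.
  \<open>f\<close> carries spans to spans, and \<open>G\<close> ensures that bases are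
  finite.\<close>

lemma vectorspace_dim_eq:
  fixes U :: "('k::field, 'm, 'z) module_scheme" (structure) and f :: "'m \<Rightarrow> ('m \<Rightarrow>\<^sub>0 'k)"
  assumes "vectorspace class_ring U"
    and add: "\<And>x y. x \<in> carrier U \<Longrightarrow> y \<in> carrier U \<Longrightarrow> f (x \<oplus> y) = f x + f y"
    and scale: "\<And>c x. x \<in> carrier U \<Longrightarrow> f (c \<odot> x) = pscale c (f x)"
    and inj: "inj_on f (carrier U)"
    and fin: "finite G" "f ` carrier U \<subseteq> pv.span G"
  shows "vectorspace.dim class_ring U = pv.dim (f ` carrier U)"
proof -
  interpret U: vectorspace class_ring U by (rule assms(1))
  have f0: "f \<zero> = 0" using add[of \<zero> \<zero>] by simp
  have sm: "c \<odot> m \<in> carrier U" if "m \<in> carrier U" for c m using that U.smult_closed[of c m] by simp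
  have lincomb: "f (U.lincomb a A) = (\<Sum>x\<in>A. pscale (a x) (f x))" if "A \<subseteq> carrier U" for a A
  proof -
    have "f (U.lincomb a A) = (\<Sum>x\<in>A. f (a x \<odot> x))"
      unfolding U.lincomb_def
      by (rule finsum_hom) (use that sm f0 add in \<open>auto intro: U.abelian_monoid_axioms\<close>)
    also have "\<dots> = (\<Sum>x\<in>A. pscale (a x) (f x))"
      using that scale by (intro sum.cong) auto
    finally show ?thesis .
  qed
  have lin_closed: "U.lincomb a A \<in> carrier U" if "A \<subseteq> carrier U" for a A
    using that by (intro U.lincomb_closed) auto
  have span: "f ` U.span A = pv.span (f ` A)" if A: "A \<subseteq> carrier U" "finite A" for A
  proof (intro equalityI subsetI)
    fix v assume "v \<in> f ` U.span A"
    then obtain a B where B: "finite B" "B \<subseteq> A" "v = f (U.lincomb a B)" by (auto simp: U.span_def)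
    then have "v = (\<Sum>x\<in>B. pscale (a x) (f x))" using A(1) lincomb[of B a] by auto
    also have "\<dots> \<in> pv.span (f ` A)"
      by (intro pv.span_sum pv.span_scale, rule pv.span_base) (use B(2) in auto)
    finally show "v \<in> pv.span (f ` A)" .
  next
    fix v assume "v \<in> pv.span (f ` A)"
    then obtain u where u: "v = (\<Sum>w\<in>f ` A. pscale (u w) w)"
      using pv.span_finite[of "f ` A"] A(2) by auto
    have "v = (\<Sum>x\<in>A. pscale (u (f x)) (f x))"
      unfolding u using inj_on_subset[OF inj A(1)] by (simp add: sum.reindex)
    also have "\<dots> = f (U.lincomb (u \<circ> f) A)" using lincomb[OF A(1)] by simp
    finally show "v \<in> f ` U.span A" unfolding U.span_def using A by auto
  qed
  have span_sub: "U.span A \<subseteq> carrier U" if "A \<subseteq> carrier U" for A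
    using that lin_closed by (auto simp: U.span_def)
  have sub: "pv.subspace (f ` carrier U)" by (rule subspace_image_carrier[OF assms(1) add scale])
  show ?thesis
    unfolding U.dim_def
  proof (rule Least_equality)
    obtain B where B: "B \<subseteq> f ` carrier U" "pv.independent B" "f ` carrier U \<subseteq> pv.span B"
        "card B = pv.dim (f ` carrier U)"
      by (rule pv.basis_exists)
    have finB: "finite B" using pv.independent_span_bound[OF fin(1) B(2)] B(1) fin(2) by blast
    obtain A where A: "A \<subseteq> carrier U" "inj_on f A" "B = f ` A"
      using subset_image_inj[of B f "carrier U"] B(1) by blast
    have finA: "finite A" using finB A by (simp add: finite_image_iff)
    have "f ` U.span A = f ` carrier U"
      using span[OF A(1) finA] A(3) B(3) pv.span_minimal[OF B(1) sub] by auto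
    then have "U.span A = carrier U"
      using inj_on_image_eq_iff[OF inj, of "U.span A" "carrier U"] span_sub[OF A(1)] by blast
    then show "\<exists>A. finite A \<and> card A = pv.dim (f ` carrier U) \<and> A \<subseteq> carrier U \<and> U.span A = carrier U"
      using finA A B(4) by (intro exI[of _ A]) (simp add: card_image)
  next
    fix n assume "\<exists>A. finite A \<and> card A = n \<and> A \<subseteq> carrier U \<and> U.span A = carrier U"
    then obtain A where A: "finite A" "card A = n" "A \<subseteq> carrier U" "U.span A = carrier U" by blast
    have "pv.dim (f ` carrier U) \<le> card (f ` A)"
      using span[OF A(3,1)] A(1,4) by (intro pv.dim_le_card) auto
    also have "\<dots> \<le> n" using card_image_le[OF A(1)] A(2) by simp
    finally show "pv.dim (f ` carrier U) \<le> n" .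
  qed
qed

text \<open>Scalars act through constants, and constants are central.\<close>

lemma (in weyl_left_module) act_smult: "x \<in> carrier M \<Longrightarrow> act a (c \<odot> x) = c \<odot> act a x"
  using act_mult[of x a "weyl_const c"] act_mult[of x "weyl_const c" a]
  by (simp add: act_const act_closed weyl_const_commute)

text \<open>Since \<open>e\<close> is defined and linear everywhere, an operator conjugated by
  \<open>f\<close> and \<open>e\<close> is linear on the whole ambient type, as \<open>wmod\<close>
  demands.\<close>

locale weyl_embed = weyl_left_module M act
  for M :: "('k::field_char_0, 'm, 'z) module_scheme" (structure)
    and act :: "('n::finite, 'k) weyl \<Rightarrow> 'm \<Rightarrow> 'm" +
  fixes f :: "'m \<Rightarrow> ('m \<Rightarrow>\<^sub>0 'k)" and e :: "('m \<Rightarrow>\<^sub>0 'k) \<Rightarrow> 'm"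
  assumes e_closed: "e v \<in> carrier M"
    and e_add: "e (v + w) = e v \<oplus> e w"
    and e_scale: "e (pscale c v) = c \<odot> e v"
    and e_f: "x \<in> carrier M \<Longrightarrow> e (f x) = x"
    and f_add: "x \<in> carrier M \<Longrightarrow> y \<in> carrier M \<Longrightarrow> f (x \<oplus> y) = f x + f y"
    and f_scale: "x \<in> carrier M \<Longrightarrow> f (c \<odot> x) = pscale c (f x)"
begin

lemma smult_closed': "x \<in> carrier M \<Longrightarrow> c \<odot> x \<in> carrier M"
  using smult_closed[of c x] by simp

lemma f_zero: "f \<zero> = 0"
  using f_add[of \<zero> \<zero>] by simp

lemma f_inj: "inj_on f (carrier M)"
  by (rule inj_on_inverseI[of _ e]) (rule e_f)

lemma W_subspace: "pv.subspace (f ` carrier M)"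
  by (rule subspace_image_carrier[OF vectorspace_axioms f_add f_scale])

lemma f_finsum: "(\<And>x. x \<in> A \<Longrightarrow> h x \<in> carrier M) \<Longrightarrow> f (\<Oplus>x\<in>A. h x) = (\<Sum>x\<in>A. f (h x))"
  by (rule finsum_hom[OF abelian_monoid_axioms]) (auto simp: f_zero f_add)

sublocale wm: wmod pscale "f ` carrier M" "\<lambda>a v. f (act a (e v))"
proof (rule wmod.intro[OF pv.vector_space_axioms], rule wmod_axioms.intro)
  show "Vector_Spaces.linear pscale pscale (\<lambda>v. f (act a (e v)))" for a
    unfolding Vector_Spaces.linear_iff
    using pv.vector_space_axioms
    by (simp add: e_add e_scale e_closed act_add_right act_closed f_add f_scale act_smult)
qed (auto simp: W_subspace e_f act_closed act_mult act_add_left act_one act_const f_add f_scale)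

lemma f_good_filtration:
  assumes S: "finite S" "S \<subseteq> carrier M"
  shows "f ` good_filtration M act S i = wm.Gam (f ` S) i"
proof -
  have fS: "f ` S \<subseteq> f ` carrier M" using S(2) by blast
  have im: "f (\<Oplus>s\<in>S. act (b s) s) = (\<Sum>s\<in>S. f (act (b s) s))" for b
    by (rule f_finsum) (use S(2) act_closed in auto)
  show ?thesis
  proof (intro equalityI subsetI)
    fix v assume "v \<in> f ` good_filtration M act S i"
    then obtain b where b: "v = f (\<Oplus>s\<in>S. act (b s) s)" "\<And>s. s \<in> S \<Longrightarrow> b s \<in> bernstein i"
      by (auto simp: good_filtration_def)
    have "f (act (b s) s) \<in> wm.Gam (f ` S) i" if s: "s \<in> S" for s
      using wm.bernstein_Gam[OF b(2)[OF s] imageI[OF s, of f] fS] s S(2) by (simp add: e_f subset_eq)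
    then show "v \<in> wm.Gam (f ` S) i"
      unfolding b(1) im wm.Gam_def by (intro pv.span_sum) auto
  next
    fix v assume "v \<in> wm.Gam (f ` S) i"
    then have "\<exists>b. (\<forall>s. b s \<in> bernstein i) \<and> v = (\<Sum>s\<in>S. f (act (b s) s))"
      unfolding wm.Gam_def
    proof (induction rule: pv.span_induct_alt)
      case base
      have "f (act 0 s) = 0" if "s \<in> S" for s
        using wm.act_zero[of "f s"] that S(2) by (auto simp: e_f)
      then show ?case using weyl.subspace_0[OF bernstein_subspace] by (intro exI[of _ "\<lambda>_. 0"]) auto
    next
      case (step c x y)
      then obtain b where b: "\<And>s. b s \<in> bernstein i" "y = (\<Sum>s\<in>S. f (act (b s) s))" by blast
      obtain \<mu> s0 where x: "x = f (act (wmon \<mu>) (e (f s0)))" "s0 \<in> S" "sum \<mu> UNIV \<le> i"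
        using step.hyps by (auto simp: wm.gens_def)
      have s0: "s0 \<in> carrier M" using x(2) S(2) by blast
      \<comment> \<open>A further monomial image changes only the coefficient of its own generator.
        This regroups a span of monomials into one coefficient per generator.\<close>
      let ?b = "\<lambda>s. (if s = s0 then weyl_const c * wmon \<mu> else 0) + b s"
      have "?b s \<in> bernstein i" for s
        using b(1) wmon_in_bernstein[OF x(3)] bernstein_subspace
        by (auto intro!: weyl.subspace_add weyl.subspace_scale simp: weyl.subspace_0)
      moreover have "pscale c x + y = (\<Sum>s\<in>S. f (act (?b s) s))"
      proof -
        have "f (act (?b s) s) = (if s = s0 then pscale c x else 0) + f (act (b s) s)" if "s \<in> S" for s
        proof -
          have s: "s \<in> carrier M" using that S(2) by blast
          then have "act 0 s = \<zero>" using act_const[of s 0] lmult_0[of s] by (simp add: weyl_const_0)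
          then show ?thesis
            using s s0 by (simp add: act_add_left act_closed f_add f_zero x(1) e_f act_mult act_const f_scale smult_closed')
        qed
        then have "(\<Sum>s\<in>S. f (act (?b s) s)) = (\<Sum>s\<in>S. if s = s0 then pscale c x else 0) + y"
          unfolding b(2) sum.distrib[symmetric] by (intro sum.cong) auto
        then show ?thesis using S(1) x(2) by simp
      qed
      ultimately show ?case by (intro exI[of _ ?b] conjI allI)
    qed
    then obtain b where b: "\<And>s. b s \<in> bernstein i" "v = (\<Sum>s\<in>S. f (act (b s) s))" by blast
    have "v = f (\<Oplus>s\<in>S. act (b s) s)" unfolding im b(2) ..
    then show "v \<in> f ` good_filtration M act S i"
      unfolding good_filtration_def using b(1) by blast
  qed
qed

lemma good_filtration_closed: "S \<subseteq> carrier M \<Longrightarrow> good_filtration M act S i \<subseteq> carrier M"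
  unfolding good_filtration_def by (auto intro!: finsum_closed act_closed)

lemma mem_good_filtration:
  assumes S: "finite S" "S \<subseteq> carrier M" and x: "x \<in> carrier M"
  shows "x \<in> good_filtration M act S i \<longleftrightarrow> f x \<in> wm.Gam (f ` S) i"
  using inj_on_image_mem_iff[OF f_inj x good_filtration_closed[OF S(2)]]
  by (simp add: f_good_filtration[OF S])

lemma dim_good_filtration:
  assumes S: "finite S" "S \<subseteq> carrier M"
  shows "vectorspace.dim class_ring (M\<lparr>carrier := good_filtration M act S i\<rparr>) = pv.dim (wm.Gam (f ` S) i)"
proof -
  let ?G = "good_filtration M act S i"
  have G: "?G \<subseteq> carrier M" by (rule good_filtration_closed[OF S(2)])
  have sub: "pv.subspace (wm.Gam (f ` S) i)" by (simp add: wm.Gam_def)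
  have "submodule class_ring ?G M"
  proof
    show "x \<oplus> y \<in> ?G" if "x \<in> ?G" "y \<in> ?G" for x y
    proof -
      have c: "x \<in> carrier M" "y \<in> carrier M" using that G by auto
      then have "f x \<in> wm.Gam (f ` S) i" "f y \<in> wm.Gam (f ` S) i"
        using that mem_good_filtration[OF S] by auto
      then show ?thesis using c mem_good_filtration[OF S, of "x \<oplus> y"] f_add pv.subspace_add[OF sub] by simp
    qed
    show "\<zero> \<in> ?G" using mem_good_filtration[OF S, of \<zero>] pv.subspace_0[OF sub] by (simp add: f_zero)
    show "c \<odot> x \<in> ?G" if "x \<in> ?G" for c x
    proof -
      have c: "x \<in> carrier M" using that G by auto
      then have "f x \<in> wm.Gam (f ` S) i" using that mem_good_filtration[OF S] by auto
      then show ?thesis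
        using c mem_good_filtration[OF S, of "c \<odot> x"] f_scale smult_closed' pv.subspace_scale[OF sub] by simp
    qed
  qed (rule G)
  then have "VectorSpace.subspace class_ring ?G M"
    using vectorspace_axioms by (simp add: VectorSpace.subspace_def)
  then have "vectorspace class_ring (M\<lparr>carrier := ?G\<rparr>)" by (rule subspace_is_vs)
  then have "vectorspace.dim class_ring (M\<lparr>carrier := ?G\<rparr>) = pv.dim (f ` carrier (M\<lparr>carrier := ?G\<rparr>))"
  proof (rule vectorspace_dim_eq)
    show "finite (wm.gens (f ` S) i)" using S(1) by (intro wm.finite_gens) simp
    show "f ` carrier (M\<lparr>carrier := ?G\<rparr>) \<subseteq> pv.span (wm.gens (f ` S) i)"
      using f_good_filtration[OF S, of i] by (simp add: wm.Gam_def)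
  qed (use subsetD[OF G] f_add f_scale inj_on_subset[OF f_inj G] in auto)
  then show ?thesis using f_good_filtration[OF S, of i] by simp
qed

lemma left_gen_iff:
  "left_gen M act S \<longleftrightarrow> finite S \<and> S \<subseteq> carrier M \<and> f ` carrier M \<subseteq> wm.GenM (f ` S)"
proof (cases "finite S \<and> S \<subseteq> carrier M")
  case True
  then have S: "finite S" "S \<subseteq> carrier M" and fS: "f ` S \<subseteq> f ` carrier M" by auto
  show ?thesis
  proof
    assume gen: "left_gen M act S"
    have "f m \<in> wm.GenM (f ` S)" if m: "m \<in> carrier M" for m
    proof -
      obtain b where b: "m = (\<Oplus>s\<in>S. act (b s) s)" using gen m by (auto simp: left_gen_def)
      have sub: "pv.subspace (wm.GenM (f ` S))" using wm.submod_GenM[OF fS] by (simp add: wm.submod_def)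
      have fm: "f m = (\<Sum>s\<in>S. f (act (b s) s))"
        unfolding b by (rule f_finsum) (use S act_closed in auto)
      have mem: "f (act (b s) s) \<in> wm.GenM (f ` S)" if "s \<in> S" for s
        using wm.GenM_act[of "f s" "f ` S" "b s"] that fS S(2) by (simp add: e_f subset_eq)
      show ?thesis unfolding fm by (rule pv.subspace_sum[OF sub]) (rule mem)
    qed
    with S show "finite S \<and> S \<subseteq> carrier M \<and> f ` carrier M \<subseteq> wm.GenM (f ` S)" by blast
  next
    assume gen: "finite S \<and> S \<subseteq> carrier M \<and> f ` carrier M \<subseteq> wm.GenM (f ` S)"
    have "\<exists>b. m = (\<Oplus>s\<in>S. act (b s) s)" if m: "m \<in> carrier M" for m
    proof -
      obtain i where "f m \<in> wm.Gam (f ` S) i" using gen m by (auto simp: wm.GenM_def)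
      then have "m \<in> good_filtration M act S i" using mem_good_filtration[OF S m] by simp
      then show ?thesis by (auto simp: good_filtration_def)
    qed
    with S show "left_gen M act S" by (simp add: left_gen_def)
  qed
qed (auto simp: left_gen_def)

text \<open>Resolves the definite description in \<open>weyl_dim\<close>: \<open>p\<close> is a
  witness, and \<open>hilbert_degree_unique\<close> in both directions gives uniqueness over all
  generating sets.\<close>

lemma weyl_dim_eq:
  fixes p :: "rat poly"
  assumes S: "left_gen M act S"
    and p: "\<forall>\<^sub>F i in sequentially. of_nat (pv.dim (wm.Gam (f ` S) i)) = poly p (of_nat i)"
  shows "weyl_dim M act = degree p"
proof -
  have S': "finite S" "S \<subseteq> carrier M" "finite (f ` S)" "f ` S \<subseteq> f ` carrier M"
    "f ` carrier M \<subseteq> wm.GenM (f ` S)" using S by (auto simp: left_gen_iff)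
  show ?thesis
    unfolding weyl_dim_def
  proof (rule the_equality)
    show "\<exists>S (p' :: rat poly). left_gen M act S \<and> degree p' = degree p \<and>
        (\<forall>\<^sub>F i in sequentially. of_nat (vectorspace.dim class_ring (M\<lparr>carrier := good_filtration M act S i\<rparr>)) = poly p' (of_nat i))"
      using S p by (intro exI[of _ S] exI[of _ p]) (simp add: dim_good_filtration[OF S'(1,2)])
    fix d assume "\<exists>S (p' :: rat poly). left_gen M act S \<and> degree p' = d \<and>
        (\<forall>\<^sub>F i in sequentially. of_nat (vectorspace.dim class_ring (M\<lparr>carrier := good_filtration M act S i\<rparr>)) = poly p' (of_nat i))"
    then obtain T and p' :: "rat poly" where T: "left_gen M act T" "degree p' = d"
      "\<forall>\<^sub>F i in sequentially. of_nat (vectorspace.dim class_ring (M\<lparr>carrier := good_filtration M act T i\<rparr>)) = poly p' (of_nat i)"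
      by blast
    have T': "finite T" "T \<subseteq> carrier M" "finite (f ` T)" "f ` T \<subseteq> f ` carrier M"
      "f ` carrier M \<subseteq> wm.GenM (f ` T)" using T(1) by (auto simp: left_gen_iff)
    have p': "\<forall>\<^sub>F i in sequentially. of_nat (pv.dim (wm.Gam (f ` T) i)) = poly p' (of_nat i)"
      using T(3) by (simp add: dim_good_filtration[OF T'(1,2)])
    have "degree p \<le> degree p'"
      by (rule wm.hilbert_degree_unique[OF S'(3,4) T'(3-5) p p'])
    moreover have "degree p' \<le> degree p"
      by (rule wm.hilbert_degree_unique[OF T'(3,4) S'(3-5) p' p])
    ultimately show "d = degree p" using T(2) by simp
  qed
qed

lemma hilbert_polynomial_exists:
  assumes "left_gen M act S"
  obtains p :: "rat poly" where "\<forall>\<^sub>F i in sequentially. of_nat (pv.dim (wm.Gam (f ` S) i)) = poly p (of_nat i)"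
proof -
  have "finite (f ` S)" "f ` S \<subseteq> f ` carrier M" using assms by (auto simp: left_gen_def)
  from wm.hilbert_polynomial[OF this] that show thesis unfolding eventually_poly_def by blast
qed

lemma holonomic_growth:
  assumes "holonomic M act"
  obtains S C where "left_gen M act S"
    "\<And>i. pv.dim (wm.Gam (f ` S) i) \<le> C * (i + 1) ^ card (UNIV :: 'n set)"
proof -
  let ?N = "card (UNIV :: 'n set)"
  obtain S where S: "left_gen M act S" using assms by (auto simp: holonomic_def)
  obtain p :: "rat poly" where p: "\<forall>\<^sub>F i in sequentially. of_nat (pv.dim (wm.Gam (f ` S) i)) = poly p (of_nat i)"
    by (rule hilbert_polynomial_exists[OF S])
  obtain C where C: "\<And>i. pv.dim (wm.Gam (f ` S) i) \<le> C * (i + 1) ^ degree p"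
    using eventually_poly_growth[OF p] by blast
  show thesis
  proof (cases "carrier M = {\<zero>}")
    \<comment> \<open>The zero module counts as holonomic whatever its \<open>weyl_dim\<close> is,
      so the bound is obtained directly with constant 0.\<close>
    case True
    have "pv.dim (wm.Gam (f ` S) i) = 0" for i
    proof -
      have "f ` S \<subseteq> f ` carrier M" using S by (auto simp: left_gen_def)
      then have "wm.Gam (f ` S) i \<subseteq> pv.span {}" using wm.Gam_sub_W[of "f ` S" i] True f_zero by auto
      then show ?thesis using pv.dim_le_card[of "wm.Gam (f ` S) i" "{}"] by simp
    qed
    then show thesis using that[OF S, of 0] by simp
  next
    case False
    then have "degree p = ?N" using assms weyl_dim_eq[OF S p] by (simp add: holonomic_def)
    then show thesis using that[OF S, of C] C by simp
  qed
qed

text \<open>Bernstein's criterion. The upper bound from growth and the lower bound from Bernstein's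
  inequality meet at the number of variables.\<close>

lemma holonomicI:
  assumes F: "wm.filtr F" "\<And>i. \<exists>G. finite G \<and> F i \<subseteq> pv.span G" "f ` carrier M \<subseteq> (\<Union>i. F i)"
    and bound: "\<And>i. pv.dim (F i) \<le> C * (i + 1) ^ card (UNIV :: 'n set)"
  shows "holonomic M act"
proof -
  let ?N = "card (UNIV :: 'n set)"
  obtain T where T: "finite T" "T \<subseteq> f ` carrier M" "f ` carrier M \<subseteq> wm.GenM T"
    using wm.finitely_generated_of_filtr[OF F bound] by blast
  obtain S where S0: "S \<subseteq> carrier M" "finite S" "T = f ` S"
    using finite_subset_image[OF T(1,2)] by blast
  have S: "left_gen M act S" using S0 T by (simp add: left_gen_iff)
  obtain p :: "rat poly" where p: "\<forall>\<^sub>F i in sequentially. of_nat (pv.dim (wm.Gam (f ` S) i)) = poly p (of_nat i)"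
    by (rule hilbert_polynomial_exists[OF S])
  have fS: "finite (f ` S)" "f ` S \<subseteq> f ` carrier M" "f ` carrier M \<subseteq> wm.GenM (f ` S)"
    using T S0 by auto
  have "weyl_dim M act = ?N" if "carrier M \<noteq> {\<zero>}"
  proof -
    have "f ` carrier M \<noteq> {0}"
    proof
      assume "f ` carrier M = {0}"
      then have "x = \<zero>" if "x \<in> carrier M" for x
        using that inj_onD[OF f_inj, of x \<zero>] f_zero by auto
      then show False using \<open>carrier M \<noteq> {\<zero>}\<close> by auto
    qed
    then have "?N \<le> degree p" by (rule wm.hilbert_degree_ge[OF fS _ p])
    moreover have "degree p \<le> ?N" by (rule wm.hilbert_degree_le[OF F bound fS(1,2) p])
    ultimately show ?thesis using weyl_dim_eq[OF S p] by simp
  qed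
  then show ?thesis using S weyl_left_module_axioms by (auto simp: holonomic_def)
qed

end

lemma weyl_embed_exists:
  fixes M :: "('k::field_char_0, 'm, 'z) module_scheme" and act :: "('n::finite, 'k) weyl \<Rightarrow> 'm \<Rightarrow> 'm"
  assumes "weyl_left_module M act"
  obtains f e where "weyl_embed M act f e"
proof -
  interpret weyl_left_module M act by (rule assms)
  show thesis
  proof (rule vectorspace_embedding[OF vectorspace_axioms])
    fix f :: "'m \<Rightarrow> ('m \<Rightarrow>\<^sub>0 'k)" and e
    assume "\<And>v. e v \<in> carrier M" "\<And>v w. e (v + w) = e v \<oplus>\<^bsub>M\<^esub> e w"
      "\<And>c v. e (pscale c v) = c \<odot>\<^bsub>M\<^esub> e v" "\<And>x. x \<in> carrier M \<Longrightarrow> e (f x) = x"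
      "\<And>x y. x \<in> carrier M \<Longrightarrow> y \<in> carrier M \<Longrightarrow> f (x \<oplus>\<^bsub>M\<^esub> y) = f x + f y"
      "\<And>c x. x \<in> carrier M \<Longrightarrow> f (c \<odot>\<^bsub>M\<^esub> x) = pscale c (f x)"
    then have "weyl_embed M act f e" by unfold_locales
    then show thesis by (rule that)
  qed
qed

section \<open>Actions determined by the generators\<close>

text \<open>For the universal property of the Weyl algebra: operators that obey the defining
  relations extend to an action. As in \<open>wmod\<close>, linearity holds everywhere and the
  relations hold on \<open>W\<close>.\<close>

locale weyl_operators = vector_space scale
  for scale :: "'k::field \<Rightarrow> 'v::ab_group_add \<Rightarrow> 'v" +
  fixes W :: "'v set" and opr :: "'n weyl_gen \<Rightarrow> 'v \<Rightarrow> 'v"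
  assumes W: "subspace W"
    and opr_linear: "Vector_Spaces.linear scale scale (opr g)"
    and opr_closed: "w \<in> W \<Longrightarrow> opr g w \<in> W"
    and opr_xx: "w \<in> W \<Longrightarrow> opr (GenX i) (opr (GenX j) w) = opr (GenX j) (opr (GenX i) w)"
    and opr_dd: "w \<in> W \<Longrightarrow> opr (GenD i) (opr (GenD j) w) = opr (GenD j) (opr (GenD i) w)"
    and opr_dx: "w \<in> W \<Longrightarrow> opr (GenD i) (opr (GenX j) w)
      = opr (GenX j) (opr (GenD i) w) + (if i = j then w else 0)"
begin

fun word_opr :: "'n weyl_gen word \<Rightarrow> 'v \<Rightarrow> 'v" where
  "word_opr (Word w) v = foldr opr w v"

lemma opr_add: "opr g (v + w) = opr g v + opr g w"
  using opr_linear[of g] by (simp add: Vector_Spaces.linear_iff)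

lemma opr_scale: "opr g (scale c w) = scale c (opr g w)"
  using opr_linear[of g] by (simp add: Vector_Spaces.linear_iff)

lemma word_opr_plus: "word_opr (u + w) v = word_opr u (word_opr w v)"
  by (cases u; cases w) simp

lemma word_opr_add: "word_opr w (x + y) = word_opr w x + word_opr w y"
proof (cases w)
  case (Word u)
  show ?thesis unfolding Word by (induction u) (simp_all add: opr_add)
qed

lemma word_opr_scale: "word_opr w (scale c x) = scale c (word_opr w x)"
proof (cases w)
  case (Word u)
  show ?thesis unfolding Word by (induction u) (simp_all add: opr_scale)
qed

lemma word_opr_closed: "v \<in> W \<Longrightarrow> word_opr w v \<in> W"
proof (cases w)
  case (Word u)
  assume "v \<in> W"
  then show ?thesis unfolding Word by (induction u) (simp_all add: opr_closed)
qed

definition free_opr :: "('n weyl_gen word \<Rightarrow>\<^sub>0 'k) \<Rightarrow> 'v \<Rightarrow> 'v" where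
  "free_opr p v = (\<Sum>w\<in>Poly_Mapping.keys p. scale (Poly_Mapping.lookup p w) (word_opr w v))"

lemma free_opr_superset:
  assumes "finite A" "Poly_Mapping.keys p \<subseteq> A"
  shows "free_opr p v = (\<Sum>w\<in>A. scale (Poly_Mapping.lookup p w) (word_opr w v))"
  unfolding free_opr_def
  by (rule sum.mono_neutral_left) (use assms in \<open>auto simp: in_keys_iff\<close>)

lemma free_opr_plus: "free_opr (p + q) v = free_opr p v + free_opr q v"
proof -
  let ?A = "Poly_Mapping.keys p \<union> Poly_Mapping.keys q"
  have "free_opr (p + q) v = (\<Sum>w\<in>?A. scale (Poly_Mapping.lookup (p + q) w) (word_opr w v))"
    by (rule free_opr_superset) (use Poly_Mapping.keys_add[of p q] in auto)
  also have "\<dots> = free_opr p v + free_opr q v"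
    by (simp add: free_opr_superset[of ?A] lookup_add scale_left_distrib sum.distrib)
  finally show ?thesis .
qed

lemma free_opr_zero: "free_opr 0 v = 0"
  by (simp add: free_opr_def)

lemma free_opr_diff: "free_opr (p - q) v = free_opr p v - free_opr q v"
  using free_opr_plus[of "p - q" q v] by simp

lemma free_opr_single: "free_opr (Poly_Mapping.single w c) v = scale c (word_opr w v)"
  by (cases "c = 0") (simp_all add: free_opr_def)

lemma free_opr_one: "free_opr 1 v = v"
proof -
  have "free_opr (Poly_Mapping.single 0 1) v = v"
    by (simp only: free_opr_single) (simp add: zero_word_def)
  then show ?thesis by simp
qed

lemma free_opr_gen: "free_opr (free_gen g) v = opr g v"
  by (simp add: free_gen_def free_opr_single)

lemma free_opr_add: "free_opr p (x + y) = free_opr p x + free_opr p y"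
  by (simp add: free_opr_def word_opr_add scale_right_distrib sum.distrib)

lemma free_opr_zero_right: "free_opr p 0 = 0"
  using free_opr_add[of p 0 0] by simp

lemma free_opr_closed: "v \<in> W \<Longrightarrow> free_opr p v \<in> W"
  unfolding free_opr_def by (intro subspace_sum[OF W] subspace_scale[OF W] word_opr_closed)

lemma free_opr_mult: "free_opr (p * q) v = free_opr p (free_opr q v)"
proof (induction p rule: poly_mapping_single_induct)
  case (single u c)
  show ?case
  proof (induction q rule: poly_mapping_single_induct)
    case (single w d)
    show ?case by (simp add: mult_single free_opr_single word_opr_plus word_opr_scale)
  next
    case (sum q r)
    then show ?case by (simp add: distrib_left free_opr_plus free_opr_add)
  qed
next
  case (sum p r)
  then show ?case by (simp add: distrib_right free_opr_plus)
qed

lemma free_opr_weyl_relators: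
  assumes "r \<in> weyl_relators" "w \<in> W"
  shows "free_opr r w = 0"
  using assms
  by (auto simp: weyl_relators_def free_opr_diff free_opr_mult free_opr_gen free_opr_zero free_opr_one
      opr_xx opr_dd opr_dx)

lemma free_opr_weyl_ideal:
  assumes "r \<in> weyl_ideal" "w \<in> W"
  shows "free_opr r w = 0"
  using assms
  by (induction arbitrary: w)
     (auto simp: free_opr_weyl_relators free_opr_zero free_opr_plus free_opr_mult free_opr_closed free_opr_zero_right)

text \<open>On \<open>W\<close> the choice of representative is immaterial, because the ideal acts
  by zero there; elsewhere the value may depend on it.\<close>

definition weyl_opr :: "('n, 'k) weyl \<Rightarrow> 'v \<Rightarrow> 'v" where
  "weyl_opr a = free_opr (rep_weyl a)"

lemma weyl_opr_abs: "w \<in> W \<Longrightarrow> weyl_opr (abs_weyl p) w = free_opr p w"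
proof -
  assume w: "w \<in> W"
  have "rep_weyl (abs_weyl p) - p \<in> weyl_ideal"
    by (simp only: weyl.abs_eq_iff[symmetric] Quotient3_abs_rep[OF Quotient3_weyl])
  from free_opr_weyl_ideal[OF this w] show ?thesis by (simp add: weyl_opr_def free_opr_diff)
qed

end

lemma weyl_left_module_of_generators:
  fixes M :: "('k::field, 'm, 'z) module_scheme" (structure) and opr :: "'n weyl_gen \<Rightarrow> 'm \<Rightarrow> 'm"
  assumes vs: "vectorspace class_ring M"
    and closed: "\<And>g m. m \<in> carrier M \<Longrightarrow> opr g m \<in> carrier M"
    and add: "\<And>g m m'. m \<in> carrier M \<Longrightarrow> m' \<in> carrier M \<Longrightarrow> opr g (m \<oplus> m') = opr g m \<oplus> opr g m'"
    and smult: "\<And>g c m. m \<in> carrier M \<Longrightarrow> opr g (c \<odot> m) = c \<odot> opr g m"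
    and xx: "\<And>i j m. m \<in> carrier M \<Longrightarrow> opr (GenX i) (opr (GenX j) m) = opr (GenX j) (opr (GenX i) m)"
    and dd: "\<And>i j m. m \<in> carrier M \<Longrightarrow> opr (GenD i) (opr (GenD j) m) = opr (GenD j) (opr (GenD i) m)"
    and dx: "\<And>i j m. m \<in> carrier M \<Longrightarrow> opr (GenD i) (opr (GenX j) m)
        = opr (GenX j) (opr (GenD i) m) \<oplus> (if i = j then m else \<zero>)"
  obtains act where "weyl_left_module M act" "\<And>g m. m \<in> carrier M \<Longrightarrow> act (wgen g) m = opr g m"
proof -
  interpret M: vectorspace class_ring M by (rule vs)
  obtain f :: "'m \<Rightarrow> ('m \<Rightarrow>\<^sub>0 'k)" and e where
    e: "\<And>v. e v \<in> carrier M" "\<And>v w. e (v + w) = e v \<oplus> e w" "\<And>c v. e (pscale c v) = c \<odot> e v"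
    and ef: "\<And>x. x \<in> carrier M \<Longrightarrow> e (f x) = x"
    and f: "\<And>x y. x \<in> carrier M \<Longrightarrow> y \<in> carrier M \<Longrightarrow> f (x \<oplus> y) = f x + f y"
    "\<And>c x. x \<in> carrier M \<Longrightarrow> f (c \<odot> x) = pscale c (f x)"
    by (rule vectorspace_embedding[OF vs], rule that)
  have f0: "f \<zero> = 0" using f(1)[of \<zero> \<zero>] by simp
  have sub: "pv.subspace (f ` carrier M)" by (rule subspace_image_carrier[OF vs f])
  interpret R: weyl_operators pscale "f ` carrier M" "\<lambda>g v. f (opr g (e v))"
  proof (rule weyl_operators.intro[OF pv.vector_space_axioms], rule weyl_operators_axioms.intro)
    fix g
    show "Vector_Spaces.linear pscale pscale (\<lambda>v. f (opr g (e v)))"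
      unfolding Vector_Spaces.linear_iff
      using pv.vector_space_axioms by (simp add: e add closed f smult)
  next
    fix w i j assume "w \<in> f ` carrier M"
    then obtain m where m: "m \<in> carrier M" "w = f m" by blast
    show "f (opr (GenX i) (e (f (opr (GenX j) (e w))))) = f (opr (GenX j) (e (f (opr (GenX i) (e w)))))"
      using m xx by (simp add: ef closed)
    show "f (opr (GenD i) (e (f (opr (GenD j) (e w))))) = f (opr (GenD j) (e (f (opr (GenD i) (e w)))))"
      using m dd by (simp add: ef closed)
    show "f (opr (GenD i) (e (f (opr (GenX j) (e w))))) = f (opr (GenX j) (e (f (opr (GenD i) (e w))))) + (if i = j then w else 0)"
      using m dx[of m i j] by (simp add: ef closed f f0)
  qed (use sub closed e in auto)
  define act where "act a m = e (R.weyl_opr a (f m))" for a m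
  have act_abs: "act (abs_weyl p) m = e (R.free_opr p (f m))" if "m \<in> carrier M" for p m
    using R.weyl_opr_abs[of "f m" p] that by (simp add: act_def)
  have f_act: "f (e (R.free_opr p (f m))) = R.free_opr p (f m)" if "m \<in> carrier M" for p m
    using R.free_opr_closed[of "f m" p] that ef by auto
  have abs: "\<exists>p. a = abs_weyl p" for a :: "('n, 'k) weyl"
    by (rule exI[of _ "rep_weyl a"]) (simp only: Quotient3_abs_rep[OF Quotient3_weyl])
  have "weyl_left_module M act"
  proof (rule weyl_left_module.intro[OF vs], rule weyl_left_module_axioms.intro)
    fix m m' c and a b :: "('n, 'k) weyl" assume m: "m \<in> carrier M"
    obtain p q where p: "a = abs_weyl p" and q: "b = abs_weyl q" using abs by metis
    show "act a m \<in> carrier M" by (simp add: act_def e)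
    show "act (a + b) m = act a m \<oplus> act b m"
      unfolding p q plus_weyl.abs_eq act_abs[OF m] by (simp add: R.free_opr_plus e)
    show "act (a * b) m = act a (act b m)"
      unfolding p q times_weyl.abs_eq act_abs[OF m] act_abs[OF e(1)] f_act[OF m] by (simp add: R.free_opr_mult)
    show "act 1 m = m"
      unfolding one_weyl_def act_abs[OF m] by (simp add: R.free_opr_one ef m)
    show "act (weyl_const c) m = c \<odot> m"
    proof -
      have "R.free_opr (free_const c) (f m) = pscale c (f m)"
        unfolding free_const_def R.free_opr_single by (simp add: zero_word_def)
      then show ?thesis unfolding weyl_const.abs_eq act_abs[OF m] by (simp add: e ef m)
    qed
    assume m': "m' \<in> carrier M"
    show "act a (m \<oplus> m') = act a m \<oplus> act a m'"
      using m m' unfolding p by (simp add: act_abs f R.free_opr_add e)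
  qed
  moreover have "act (wgen g) m = opr g m" if m: "m \<in> carrier M" for g m
  proof -
    have "wgen g = (abs_weyl (free_gen g) :: ('n, 'k) weyl)"
      by (cases g) (simp_all add: weyl_x.abs_eq weyl_d.abs_eq weyl_x_def weyl_d_def)
    then show ?thesis using m by (simp add: act_abs R.free_opr_gen ef closed)
  qed
  ultimately show thesis by (rule that)
qed

text \<open>Right multiplication reverses products and with them the sign of the commutator of
  derivative and variable; the minus sign on the right derivatives restores it. Left and right
  generators commute by the bimodule law.\<close>

lemma associated_action_exists:
  fixes T :: "('n, 'k::field, 'm) bimodule"
  assumes "weyl_bimodule T"
  obtains act where "associated_action T act"
proof -
  interpret L: weyl_left_module T "lact T" using assms by (simp add: weyl_bimodule_def)
  interpret R: weyl_right_module T "ract T" using assms by (simp add: weyl_bimodule_def)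
  have comm: "ract T (lact T a m) b = lact T a (ract T m b)" if "m \<in> carrier T" for a b m
    using assms that by (simp add: weyl_bimodule_def)
  have sm: "c \<odot>\<^bsub>T\<^esub> m \<in> carrier T" if "m \<in> carrier T" for c m using that L.smult_closed[of c m] by simp
  \<comment> \<open>Negation is expressed as a scalar multiple, so that it passes through both
    actions.\<close>
  have neg: "\<ominus>\<^bsub>T\<^esub> m = (- 1) \<odot>\<^bsub>T\<^esub> m" if m: "m \<in> carrier T" for m
  proof -
    have "(- 1) \<odot>\<^bsub>T\<^esub> m \<oplus>\<^bsub>T\<^esub> m = (- 1 + 1) \<odot>\<^bsub>T\<^esub> m"
      using L.smult_l_distr[of "- 1" 1 m] L.smult_one[OF m] m by simp
    also have "\<dots> = \<zero>\<^bsub>T\<^esub>" using L.lmult_0[OF m] by simp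
    finally show ?thesis using L.minus_equality[of "(- 1) \<odot>\<^bsub>T\<^esub> m" m] m sm by simp
  qed
  have r_smult: "ract T (c \<odot>\<^bsub>T\<^esub> m) a = c \<odot>\<^bsub>T\<^esub> ract T m a" if "m \<in> carrier T" for a c m
    using that R.act_mult[of m a "weyl_const c"] R.act_mult[of m "weyl_const c" a]
    by (simp add: R.act_const R.act_closed weyl_const_commute)
  have l_neg: "lact T a (\<ominus>\<^bsub>T\<^esub> m) = \<ominus>\<^bsub>T\<^esub> lact T a m" if "m \<in> carrier T" for a m
    using that by (simp add: neg L.act_smult L.act_closed)
  have r_neg: "ract T (\<ominus>\<^bsub>T\<^esub> m) a = \<ominus>\<^bsub>T\<^esub> ract T m a" if "m \<in> carrier T" for a m
    using that by (simp add: neg r_smult R.act_closed)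
  have l_gen: "lact T a (lact T b m) = lact T b (lact T a m)" if "a * b = b * a" "m \<in> carrier T" for a b m
    using that L.act_mult[of m a b] L.act_mult[of m b a] by simp
  have r_gen: "ract T (ract T m a) b = ract T (ract T m b) a" if "a * b = b * a" "m \<in> carrier T" for a b m
    using that R.act_mult[of m a b] R.act_mult[of m b a] by simp
  have dx_eq: "weyl_d i * weyl_x j = weyl_x j * weyl_d i + (if i = j then 1 else 0 :: ('n, 'k) weyl)" for i j
  proof -
    have "weyl_d i * weyl_x j = weyl_x j * weyl_d i
        + (weyl_d i * weyl_x j - weyl_x j * weyl_d i :: ('n, 'k) weyl)" by simp
    then show ?thesis unfolding weyl_d_x .
  qed
  have l_zero: "lact T 0 m = \<zero>\<^bsub>T\<^esub>" if "m \<in> carrier T" for m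
    using L.act_const[OF that, of 0] L.lmult_0[OF that] by (simp add: weyl_const_0)
  have r_zero: "ract T m 0 = \<zero>\<^bsub>T\<^esub>" if "m \<in> carrier T" for m
    using R.act_const[OF that, of 0] L.lmult_0[OF that] by (simp add: weyl_const_0)
  have l_dx: "lact T (weyl_d i) (lact T (weyl_x j) m) = lact T (weyl_x j) (lact T (weyl_d i) m)
      \<oplus>\<^bsub>T\<^esub> (if i = j then m else \<zero>\<^bsub>T\<^esub>)" if m: "m \<in> carrier T" for i j m
    using L.act_mult[OF m, of "weyl_d i" "weyl_x j", unfolded dx_eq] m
    by (simp add: L.act_add_left L.act_mult L.act_one l_zero split: if_splits)
  have r_dx: "ract T (ract T m (weyl_d i)) (weyl_x j) = ract T (ract T m (weyl_x j)) (weyl_d i)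
      \<oplus>\<^bsub>T\<^esub> (if i = j then m else \<zero>\<^bsub>T\<^esub>)" if m: "m \<in> carrier T" for i j m
    using R.act_mult[OF m, of "weyl_d i" "weyl_x j", unfolded dx_eq] m
    by (simp add: R.act_add_right R.act_mult R.act_one r_zero split: if_splits)
  define opr where "opr g m = (case g of
      GenX (Inl i) \<Rightarrow> lact T (weyl_x i) m | GenD (Inl i) \<Rightarrow> lact T (weyl_d i) m
    | GenX (Inr i) \<Rightarrow> ract T m (weyl_x i) | GenD (Inr i) \<Rightarrow> \<ominus>\<^bsub>T\<^esub> ract T m (weyl_d i))" for g m
  have "\<exists>act. weyl_left_module T act \<and> (\<forall>g. \<forall>m\<in>carrier T. act (wgen g) m = opr g m)"
  proof (rule weyl_left_module_of_generators[of T opr])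
    show "vectorspace class_ring T" by (rule L.vectorspace_axioms)
    fix g and i j :: "'n + 'n" and c m assume m: "m \<in> carrier T"
    show "opr g m \<in> carrier T"
      using m by (auto simp: opr_def L.act_closed R.act_closed split: weyl_gen.split sum.split)
    show "opr g (c \<odot>\<^bsub>T\<^esub> m) = c \<odot>\<^bsub>T\<^esub> opr g m"
      using m L.smult_assoc1[of c "- 1"] L.smult_assoc1[of "- 1" c]
      by (auto simp: opr_def L.act_smult r_smult neg L.act_closed R.act_closed sm split: weyl_gen.split sum.split)
    show "opr (GenX i) (opr (GenX j) m) = opr (GenX j) (opr (GenX i) m)"
      using m by (auto simp: opr_def comm intro!: l_gen r_gen weyl_x_commute split: sum.split)
    show "opr (GenD i) (opr (GenD j) m) = opr (GenD j) (opr (GenD i) m)"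
      using m by (auto simp: opr_def comm l_neg r_neg L.act_closed R.act_closed
          intro!: l_gen r_gen weyl_d_commute split: sum.split)
    show "opr (GenD i) (opr (GenX j) m) = opr (GenX j) (opr (GenD i) m) \<oplus>\<^bsub>T\<^esub> (if i = j then m else \<zero>\<^bsub>T\<^esub>)"
    proof (cases i; cases j)
      fix a b assume "i = Inl a" "j = Inl b"
      then show ?thesis using l_dx[OF m, of a b] by (simp add: opr_def)
    next
      fix a b assume "i = Inl a" "j = Inr b"
      then show ?thesis using m by (simp add: opr_def comm L.act_closed R.act_closed)
    next
      fix a b assume "i = Inr a" "j = Inl b"
      then show ?thesis using m by (simp add: opr_def comm l_neg L.act_closed R.act_closed)
    next
      fix a b assume ij: "i = Inr a" "j = Inr b"
      have c: "ract T (ract T m (weyl_d a)) (weyl_x b) \<in> carrier T"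
        "ract T (ract T m (weyl_x b)) (weyl_d a) \<in> carrier T" using m by (simp_all add: R.act_closed)
      show ?thesis
      proof (cases "a = b")
        case True
        have "ract T (ract T m (weyl_d a)) (weyl_x b) = ract T (ract T m (weyl_x b)) (weyl_d a) \<oplus>\<^bsub>T\<^esub> m"
          using r_dx[OF m, of a b] True by simp
        then have "\<ominus>\<^bsub>T\<^esub> ract T (ract T m (weyl_x b)) (weyl_d a)
            = \<ominus>\<^bsub>T\<^esub> ract T (ract T m (weyl_d a)) (weyl_x b) \<oplus>\<^bsub>T\<^esub> m"
          using c m by (simp add: L.minus_add L.a_assoc L.l_neg)
        then show ?thesis using ij m True by (simp add: opr_def r_neg R.act_closed)
      next
        case False
        then show ?thesis using r_dx[OF m, of a b] ij m c by (simp add: opr_def r_neg R.act_closed)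
      qed
    qed
    fix m' assume m': "m' \<in> carrier T"
    show "opr g (m \<oplus>\<^bsub>T\<^esub> m') = opr g m \<oplus>\<^bsub>T\<^esub> opr g m'"
      using m m' by (auto simp: opr_def L.act_add_right R.act_add_left L.act_closed R.act_closed L.minus_add
          split: weyl_gen.split sum.split)
  next
    fix act assume "weyl_left_module T act" "\<And>g m. m \<in> carrier T \<Longrightarrow> act (wgen g) m = opr g m"
    then show "\<exists>act. weyl_left_module T act \<and> (\<forall>g. \<forall>m\<in>carrier T. act (wgen g) m = opr g m)" by blast
  qed
  then obtain act where act: "weyl_left_module T act" "\<And>g m. m \<in> carrier T \<Longrightarrow> act (wgen g) m = opr g m"
    by blast
  have "associated_action T act"
    unfolding associated_action_def
  proof (intro conjI ballI allI)
    fix m and i :: 'n assume m: "m \<in> carrier T"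
    show "act (weyl_x (Inl i)) m = lact T (weyl_x i) m" using act(2)[OF m, of "GenX (Inl i)"] by (simp add: opr_def)
    show "act (weyl_d (Inl i)) m = lact T (weyl_d i) m" using act(2)[OF m, of "GenD (Inl i)"] by (simp add: opr_def)
    show "act (weyl_x (Inr i)) m = ract T m (weyl_x i)" using act(2)[OF m, of "GenX (Inr i)"] by (simp add: opr_def)
    show "act (weyl_d (Inr i)) m = \<ominus>\<^bsub>T\<^esub> ract T m (weyl_d i)" using act(2)[OF m, of "GenD (Inr i)"] by (simp add: opr_def)
  qed (rule act(1))
  then show thesis by (rule that)
qed

section \<open>Tensor products of bimodules\<close>

locale weyl_tensor =
  fixes M :: "('n, 'k::field, 'm) bimodule" and N :: "('n, 'k, 'p) bimodule"
  assumes bimodule_M: "weyl_bimodule M" and bimodule_N: "weyl_bimodule N"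
begin

sublocale LM: weyl_left_module M "lact M"
  using bimodule_M by (simp add: weyl_bimodule_def)

sublocale RM: weyl_right_module M "ract M"
  using bimodule_M by (simp add: weyl_bimodule_def)

sublocale LN: weyl_left_module N "lact N"
  using bimodule_N by (simp add: weyl_bimodule_def)

sublocale RN: weyl_right_module N "ract N"
  using bimodule_N by (simp add: weyl_bimodule_def)

lemma M_commute: "x \<in> carrier M \<Longrightarrow> ract M (lact M a x) b = lact M a (ract M x b)"
  using bimodule_M by (simp add: weyl_bimodule_def)

lemma N_commute: "y \<in> carrier N \<Longrightarrow> ract N (lact N a y) b = lact N a (ract N y b)"
  using bimodule_N by (simp add: weyl_bimodule_def)

abbreviation "F \<equiv> tensor_free M N"
abbreviation "K \<equiv> tensor_subgroup M N"
abbreviation "T \<equiv> tensor_product M N"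
abbreviation "supp \<equiv> carrier M \<times> carrier N"

definition coset :: "('m \<times> 'p \<Rightarrow>\<^sub>0 int) \<Rightarrow> ('m \<times> 'p \<Rightarrow>\<^sub>0 int) set" where
  "coset u = K #>\<^bsub>F\<^esub> u"

definition tens :: "'m \<Rightarrow> 'p \<Rightarrow> ('m \<times> 'p \<Rightarrow>\<^sub>0 int) set" where
  "tens x y = coset (frag_of (x, y))"

lemma F_closed:
  "0 \<in> carrier F" "u \<in> carrier F \<Longrightarrow> v \<in> carrier F \<Longrightarrow> u + v \<in> carrier F"
  "u \<in> carrier F \<Longrightarrow> v \<in> carrier F \<Longrightarrow> u - v \<in> carrier F" "u \<in> carrier F \<Longrightarrow> - u \<in> carrier F"
  using Poly_Mapping.keys_add[of u v] Poly_Mapping.keys_diff[of u v] by auto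

lemma relators_sub: "tensor_relators M N \<subseteq> carrier F"
proof -
  have fr: "frag_of (x, y) \<in> carrier F" if "x \<in> carrier M" "y \<in> carrier N" for x y
    using that by simp
  show ?thesis
    unfolding tensor_relators_def
    by (intro Un_least subsetI; elim CollectE exE conjE; simp only:;
        intro F_closed(3) fr LM.a_closed LN.a_closed RM.act_closed LN.act_closed; assumption)
qed

lemma K_subgroup: "subgroup K F"
  unfolding tensor_subgroup_def
  by (rule group.generate_is_subgroup[OF group_free_Abelian_group relators_sub])

lemma K_sub: "K \<subseteq> carrier F"
  using K_subgroup by (rule subgroup.subset)

lemma K_zero: "0 \<in> K"
  using subgroup.one_closed[OF K_subgroup] by simp

lemma K_add: "u \<in> K \<Longrightarrow> v \<in> K \<Longrightarrow> u + v \<in> K"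
  using subgroup.m_closed[OF K_subgroup] by simp

lemma K_uminus: "u \<in> K \<Longrightarrow> - u \<in> K"
  using subgroup.m_inv_closed[OF K_subgroup, of u] K_sub by auto

lemma K_diff: "u \<in> K \<Longrightarrow> v \<in> K \<Longrightarrow> u - v \<in> K"
  using K_add[of u "- v"] K_uminus[of v] by simp

lemma K_relator: "r \<in> tensor_relators M N \<Longrightarrow> r \<in> K"
  unfolding tensor_subgroup_def by (rule generate.incl)

lemma coset_def': "coset u = {k + u | k. k \<in> K}"
  unfolding coset_def r_coset_def by auto

lemma coset_eq_iff: "coset u = coset v \<longleftrightarrow> u - v \<in> K"
proof
  assume "coset u = coset v"
  moreover have "u \<in> coset u" unfolding coset_def' using K_zero by force
  ultimately show "u - v \<in> K" unfolding coset_def' by auto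
next
  assume uv: "u - v \<in> K"
  have "k + u = (k + (u - v)) + v" "k + v = (k - (u - v)) + u" for k by simp_all
  then show "coset u = coset v"
    unfolding coset_def' using K_add[OF _ uv] K_diff[OF _ uv] by blast
qed

lemma coset_self: "u \<in> coset u"
  unfolding coset_def' using K_zero by force

lemma T_simps:
  "carrier T = coset ` carrier F"
  "zero T = coset 0"
  "add T = set_mult F"
  "smult T = (\<lambda>c. tensor_map M N (\<lambda>(x, y). (c \<odot>\<^bsub>M\<^esub> x, y)))"
  "lact T = (\<lambda>a. tensor_map M N (\<lambda>(x, y). (lact M a x, y)))"
  "ract T = (\<lambda>C a. tensor_map M N (\<lambda>(x, y). (x, ract N y a)) C)"
proof -
  show "carrier T = coset ` carrier F"
    by (auto simp: tensor_product_def Let_def FactGroup_def RCOSETS_def coset_def)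
  have "coset 0 = K" by (simp add: coset_def')
  then show "zero T = coset 0" by (simp add: tensor_product_def Let_def FactGroup_def)
qed (simp_all add: tensor_product_def Let_def FactGroup_def)

lemma T_add: "coset u \<oplus>\<^bsub>T\<^esub> coset v = coset (u + v)"
proof -
  have "coset u \<oplus>\<^bsub>T\<^esub> coset v = {(k + u) + (l + v) | k l. k \<in> K \<and> l \<in> K}"
    unfolding T_simps set_mult_def coset_def' by auto
  also have "\<dots> = coset (u + v)"
  proof (intro equalityI subsetI)
    fix z assume "z \<in> {(k + u) + (l + v) | k l. k \<in> K \<and> l \<in> K}"
    then obtain k l where "z = (k + l) + (u + v)" "k \<in> K" "l \<in> K" by (auto simp: algebra_simps)
    then show "z \<in> coset (u + v)" unfolding coset_def' using K_add by blast
  next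
    fix z assume "z \<in> coset (u + v)"
    then obtain k where "z = (k + u) + (0 + v)" "k \<in> K" unfolding coset_def' by (auto simp: algebra_simps)
    then show "z \<in> {(k + u) + (l + v) | k l. k \<in> K \<and> l \<in> K}" using K_zero by blast
  qed
  finally show ?thesis .
qed

lemma T_carrierE:
  assumes "s \<in> carrier T"
  obtains u where "u \<in> carrier F" "s = coset u"
  using assms unfolding T_simps by blast

lemma coset_closed: "u \<in> carrier F \<Longrightarrow> coset u \<in> carrier T"
  unfolding T_simps by blast

lemma abelian_group_T: "abelian_group T"
proof (rule abelian_groupI)
  fix s t r assume s: "s \<in> carrier T" and t: "t \<in> carrier T"
  obtain u where u: "u \<in> carrier F" "s = coset u" by (rule T_carrierE[OF s])
  obtain v where v: "v \<in> carrier F" "t = coset v" by (rule T_carrierE[OF t])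
  show "s \<oplus>\<^bsub>T\<^esub> t \<in> carrier T" unfolding u v T_add by (rule coset_closed[OF F_closed(2)[OF u(1) v(1)]])
  show "s \<oplus>\<^bsub>T\<^esub> t = t \<oplus>\<^bsub>T\<^esub> s" unfolding u v T_add by (simp add: add.commute)
  show "\<zero>\<^bsub>T\<^esub> \<oplus>\<^bsub>T\<^esub> s = s" unfolding u T_simps(2) T_add by simp
  show "\<exists>y\<in>carrier T. y \<oplus>\<^bsub>T\<^esub> s = \<zero>\<^bsub>T\<^esub>"
    unfolding u T_simps(2)
    by (rule bexI[of _ "coset (- u)"]) (simp add: T_add, rule coset_closed[OF F_closed(4)[OF u(1)]])
  assume r: "r \<in> carrier T"
  obtain w where w: "w \<in> carrier F" "r = coset w" by (rule T_carrierE[OF r])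
  show "(s \<oplus>\<^bsub>T\<^esub> t) \<oplus>\<^bsub>T\<^esub> r = s \<oplus>\<^bsub>T\<^esub> (t \<oplus>\<^bsub>T\<^esub> r)" unfolding u v w T_add by (simp add: add.assoc)
qed (use coset_closed[OF F_closed(1)] in \<open>simp add: T_simps(2)\<close>)

section \<open>Maps on cosets induced by maps of pairs\<close>

definition lin :: "('m \<times> 'p \<Rightarrow> 'm \<times> 'p) \<Rightarrow> ('m \<times> 'p \<Rightarrow>\<^sub>0 int) \<Rightarrow> ('m \<times> 'p \<Rightarrow>\<^sub>0 int)" where
  "lin g = frag_extend (\<lambda>z. frag_of (g z))"

lemma lin_simps: "lin g 0 = 0" "lin g (u + v) = lin g u + lin g v" "lin g (u - v) = lin g u - lin g v"
  "lin g (- u) = - lin g u" "lin g (frag_of z) = frag_of (g z)"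
  by (simp_all add: lin_def frag_extend_add frag_extend_diff frag_extend_minus)

text \<open>Congruences between additive expressions need checking on generators of the free group
  only. The laws of the tensor product that hold only modulo relations are verified in this
  way.\<close>

lemma additive_in_K:
  assumes "u \<in> carrier F" "\<psi> 0 = 0" "\<And>u v. \<psi> (u - v) = \<psi> u - \<psi> v" "\<And>z. z \<in> supp \<Longrightarrow> \<psi> (frag_of z) \<in> K"
  shows "\<psi> u \<in> K"
proof -
  have "Poly_Mapping.keys u \<subseteq> supp" using assms(1) by simp
  then show ?thesis
    by (induction rule: frag_induction) (use assms K_zero K_diff in auto)
qed

lemma tens_add_left: "x \<in> carrier M \<Longrightarrow> x' \<in> carrier M \<Longrightarrow> y \<in> carrier N \<Longrightarrow>
    frag_of (x \<oplus>\<^bsub>M\<^esub> x', y) - frag_of (x, y) - frag_of (x', y) \<in> K"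
  by (rule K_relator) (unfold tensor_relators_def, blast)

lemma tens_add_right: "x \<in> carrier M \<Longrightarrow> y \<in> carrier N \<Longrightarrow> y' \<in> carrier N \<Longrightarrow>
    frag_of (x, y \<oplus>\<^bsub>N\<^esub> y') - frag_of (x, y) - frag_of (x, y') \<in> K"
  by (rule K_relator) (unfold tensor_relators_def, blast)

lemma tens_balanced: "x \<in> carrier M \<Longrightarrow> y \<in> carrier N \<Longrightarrow>
    frag_of (ract M x a, y) - frag_of (x, lact N a y) \<in> K"
  by (rule K_relator) (unfold tensor_relators_def, blast)

text \<open>The condition under which all cosets in the union that defines \<open>tensor_map\<close>
  agree.\<close>

definition balanced :: "('m \<times> 'p \<Rightarrow> 'm \<times> 'p) \<Rightarrow> bool" where
  "balanced g \<longleftrightarrow> g ` supp \<subseteq> supp \<and> (\<forall>r\<in>tensor_relators M N. lin g r \<in> K)"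

lemma lin_closed:
  assumes "balanced g" "u \<in> carrier F"
  shows "lin g u \<in> carrier F"
proof -
  have "Poly_Mapping.keys u \<subseteq> supp" using assms(2) by simp
  then show ?thesis
  proof (induction rule: frag_induction)
    case (one z)
    then have "g z \<in> supp" using assms(1) unfolding balanced_def by blast
    then show ?case by (simp only: lin_simps frag_of_in_free_Abelian_group)
  next
    case (diff a b)
    then show ?case unfolding lin_simps by (rule F_closed(3))
  qed (simp add: lin_simps)
qed

lemma lin_K:
  assumes "balanced g" "u \<in> K"
  shows "lin g u \<in> K"
  using assms(2) unfolding tensor_subgroup_def
proof (induction rule: generate.induct)
  case one
  then show ?case using K_zero by (simp add: lin_simps tensor_subgroup_def)
next
  case (incl h)
  then show ?case using assms(1) by (simp add: balanced_def tensor_subgroup_def)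
next
  case (inv h)
  then have "h \<in> carrier F" using relators_sub by blast
  then have "inv\<^bsub>F\<^esub> h = - h" by simp
  moreover have "lin g h \<in> K" using assms(1) inv by (simp add: balanced_def)
  ultimately show ?case using K_uminus by (simp add: lin_simps tensor_subgroup_def)
next
  case (eng h1 h2)
  then show ?case using K_add by (simp add: lin_simps tensor_subgroup_def)
qed

lemma tensor_map_coset:
  assumes "balanced g"
  shows "tensor_map M N g (coset u) = coset (lin g u)"
proof -
  have "coset (lin g v) = coset (lin g u)" if "v \<in> coset u" for v
  proof -
    have "v - u \<in> K" using that unfolding coset_def' by auto
    then have "lin g (v - u) \<in> K" by (rule lin_K[OF assms])
    then show ?thesis by (simp add: coset_eq_iff lin_simps)
  qed
  then have "(\<Union>v\<in>coset u. coset (lin g v)) = coset (lin g u)" using coset_self[of u] by blast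
  then show ?thesis unfolding tensor_map_def coset_def lin_def .
qed

lemma balanced_left:
  assumes "\<And>x. x \<in> carrier M \<Longrightarrow> p x \<in> carrier M"
    and "\<And>x x'. x \<in> carrier M \<Longrightarrow> x' \<in> carrier M \<Longrightarrow> p (x \<oplus>\<^bsub>M\<^esub> x') = p x \<oplus>\<^bsub>M\<^esub> p x'"
    and "\<And>x a. x \<in> carrier M \<Longrightarrow> p (ract M x a) = ract M (p x) a"
  shows "balanced (\<lambda>(x, y). (p x, y))"
  unfolding balanced_def
proof (intro conjI ballI)
  fix r assume "r \<in> tensor_relators M N"
  then show "lin (\<lambda>(x, y). (p x, y)) r \<in> K"
    unfolding tensor_relators_def
    by (auto simp: lin_simps assms intro!: tens_add_left tens_add_right tens_balanced)
qed (use assms(1) in auto)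

lemma balanced_right:
  assumes "\<And>y. y \<in> carrier N \<Longrightarrow> q y \<in> carrier N"
    and "\<And>y y'. y \<in> carrier N \<Longrightarrow> y' \<in> carrier N \<Longrightarrow> q (y \<oplus>\<^bsub>N\<^esub> y') = q y \<oplus>\<^bsub>N\<^esub> q y'"
    and "\<And>y a. y \<in> carrier N \<Longrightarrow> q (lact N a y) = lact N a (q y)"
  shows "balanced (\<lambda>(x, y). (x, q y))"
  unfolding balanced_def
proof (intro conjI ballI)
  fix r assume "r \<in> tensor_relators M N"
  then show "lin (\<lambda>(x, y). (x, q y)) r \<in> K"
    unfolding tensor_relators_def
    by (auto simp: lin_simps assms intro!: tens_add_left tens_add_right tens_balanced)
qed (use assms(1) in auto)

abbreviation "gl a \<equiv> \<lambda>(x, y). (lact M a x, y)"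
abbreviation "gr a \<equiv> \<lambda>(x, y). (x, ract N y a)"
abbreviation "gs c \<equiv> \<lambda>(x, y). (c \<odot>\<^bsub>M\<^esub> x, y)"

lemma smult_closed_M: "x \<in> carrier M \<Longrightarrow> c \<odot>\<^bsub>M\<^esub> x \<in> carrier M"
  using LM.smult_closed[of c x] by simp

lemma balanced_gl: "balanced (gl a)"
  by (rule balanced_left) (auto simp: LM.act_closed LM.act_add_right M_commute)

lemma balanced_gr: "balanced (gr a)"
  by (rule balanced_right) (auto simp: RN.act_closed RN.act_add_left N_commute)

lemma balanced_gs: "balanced (gs c)"
proof (rule balanced_left)
  fix x a assume x: "x \<in> carrier M"
  \<comment> \<open>A scalar is read as a left constant, so the bimodule law lets it pass the right
    action.\<close>
  have "lact M (weyl_const c) (ract M x a) = ract M (lact M (weyl_const c) x) a"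
    using M_commute[OF x] by simp
  then show "c \<odot>\<^bsub>M\<^esub> ract M x a = ract M (c \<odot>\<^bsub>M\<^esub> x) a"
    using x by (simp add: LM.act_const RM.act_closed)
qed (use LM.smult_r_distr smult_closed_M in auto)

lemma T_act:
  "lact T a (coset u) = coset (lin (gl a) u)"
  "ract T (coset u) a = coset (lin (gr a) u)"
  "c \<odot>\<^bsub>T\<^esub> coset u = coset (lin (gs c) u)"
  unfolding T_simps by (simp_all add: tensor_map_coset balanced_gl balanced_gr balanced_gs)

lemma lin_in_K:
  assumes "u \<in> carrier F" "\<And>x y. x \<in> carrier M \<Longrightarrow> y \<in> carrier N \<Longrightarrow>
      lin g (frag_of (x, y)) - lin h (lin k (frag_of (x, y))) \<in> K"
  shows "coset (lin g u) = coset (lin h (lin k u))"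
  unfolding coset_eq_iff
  by (rule additive_in_K[OF assms(1), where \<psi> = "\<lambda>u. lin g u - lin h (lin k u)"])
     (use assms(2) in \<open>auto simp: lin_simps\<close>)

lemma lin_in_K_add:
  assumes "u \<in> carrier F" "\<And>x y. x \<in> carrier M \<Longrightarrow> y \<in> carrier N \<Longrightarrow>
      lin g (frag_of (x, y)) - lin h (frag_of (x, y)) - lin k (frag_of (x, y)) \<in> K"
  shows "coset (lin g u) = coset (lin h u) \<oplus>\<^bsub>T\<^esub> coset (lin k u)"
proof -
  have "lin g u - lin h u - lin k u \<in> K"
    by (rule additive_in_K[OF assms(1), where \<psi> = "\<lambda>u. lin g u - lin h u - lin k u"])
       (use assms(2) in \<open>auto simp: lin_simps\<close>)
  then show ?thesis by (simp add: T_add coset_eq_iff diff_diff_eq)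
qed

lemma lin_in_K_eq:
  assumes "u \<in> carrier F" "\<And>x y. x \<in> carrier M \<Longrightarrow> y \<in> carrier N \<Longrightarrow>
      lin g (frag_of (x, y)) - lin h (frag_of (x, y)) \<in> K"
  shows "coset (lin g u) = coset (lin h u)"
  unfolding coset_eq_iff
  by (rule additive_in_K[OF assms(1), where \<psi> = "\<lambda>u. lin g u - lin h u"])
     (use assms(2) in \<open>auto simp: lin_simps\<close>)

lemma lin_id: "u \<in> carrier F \<Longrightarrow> coset (lin (\<lambda>z. z) u) = coset u"
  using frag_expansion[of u] by (simp add: lin_def)

section \<open>Module and bimodule structure of the tensor product\<close>

lemma vectorspace_T: "vectorspace class_ring T"
proof -
  have "module class_ring T"
  proof (rule moduleI)
    show "cring (class_ring :: 'k ring)" by (rule module.axioms(1)[OF vectorspace.axioms(1)[OF LM.vectorspace_axioms]])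
    show "abelian_group T" by (rule abelian_group_T)
    fix c d :: 'k and s t assume s: "s \<in> carrier T"
    obtain u where u: "u \<in> carrier F" "s = coset u" by (rule T_carrierE[OF s])
    show "c \<odot>\<^bsub>T\<^esub> s \<in> carrier T"
      unfolding u T_act by (rule coset_closed[OF lin_closed[OF balanced_gs u(1)]])
    show "(c \<oplus>\<^bsub>class_ring\<^esub> d) \<odot>\<^bsub>T\<^esub> s = c \<odot>\<^bsub>T\<^esub> s \<oplus>\<^bsub>T\<^esub> d \<odot>\<^bsub>T\<^esub> s"
      unfolding u T_act
    proof (rule lin_in_K_add[OF u(1)])
      fix x y assume xy: "x \<in> carrier M" "y \<in> carrier N"
      show "lin (gs (c \<oplus>\<^bsub>class_ring\<^esub> d)) (frag_of (x, y)) - lin (gs c) (frag_of (x, y)) - lin (gs d) (frag_of (x, y)) \<in> K"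
        using tens_add_left[of "c \<odot>\<^bsub>M\<^esub> x" "d \<odot>\<^bsub>M\<^esub> x" y] LM.smult_l_distr[of c d x] xy
        by (simp add: lin_simps smult_closed_M)
    qed
    show "(c \<otimes>\<^bsub>class_ring\<^esub> d) \<odot>\<^bsub>T\<^esub> s = c \<odot>\<^bsub>T\<^esub> (d \<odot>\<^bsub>T\<^esub> s)"
      unfolding u T_act
    proof (rule lin_in_K[OF u(1)])
      fix x y assume xy: "x \<in> carrier M" "y \<in> carrier N"
      show "lin (gs (c \<otimes>\<^bsub>class_ring\<^esub> d)) (frag_of (x, y)) - lin (gs c) (lin (gs d) (frag_of (x, y))) \<in> K"
        using LM.smult_assoc1[of c d x] xy K_zero by (simp add: lin_simps)
    qed
    show "\<one>\<^bsub>class_ring\<^esub> \<odot>\<^bsub>T\<^esub> s = s"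
    proof -
      have "coset (lin (gs 1) u) = coset (lin (\<lambda>z. z) u)"
        by (rule lin_in_K_eq[OF u(1)]) (use LM.smult_one K_zero in \<open>simp add: lin_simps\<close>)
      then show ?thesis unfolding u T_act using lin_id[OF u(1)] by simp
    qed
    assume t: "t \<in> carrier T"
    obtain v where v: "v \<in> carrier F" "t = coset v" by (rule T_carrierE[OF t])
    show "c \<odot>\<^bsub>T\<^esub> (s \<oplus>\<^bsub>T\<^esub> t) = c \<odot>\<^bsub>T\<^esub> s \<oplus>\<^bsub>T\<^esub> c \<odot>\<^bsub>T\<^esub> t"
      unfolding u v T_act T_add by (simp add: lin_simps)
  qed
  then show ?thesis using LM.vectorspace_axioms by (simp add: vectorspace_def)
qed

lemma weyl_left_module_T: "weyl_left_module T (lact T)"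
proof (rule weyl_left_module.intro[OF vectorspace_T], rule weyl_left_module_axioms.intro)
  fix a b c s t assume s: "s \<in> carrier T"
  obtain u where u: "u \<in> carrier F" "s = coset u" by (rule T_carrierE[OF s])
  show "lact T a s \<in> carrier T"
    unfolding u T_act by (rule coset_closed[OF lin_closed[OF balanced_gl u(1)]])
  show "lact T (a + b) s = lact T a s \<oplus>\<^bsub>T\<^esub> lact T b s"
    unfolding u T_act
  proof (rule lin_in_K_add[OF u(1)])
    fix x y assume xy: "x \<in> carrier M" "y \<in> carrier N"
    show "lin (gl (a + b)) (frag_of (x, y)) - lin (gl a) (frag_of (x, y)) - lin (gl b) (frag_of (x, y)) \<in> K"
      using tens_add_left[of "lact M a x" "lact M b x" y] xy by (simp add: lin_simps LM.act_add_left LM.act_closed)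
  qed
  show "lact T (a * b) s = lact T a (lact T b s)"
    unfolding u T_act
    by (rule lin_in_K[OF u(1)]) (use K_zero in \<open>simp add: lin_simps LM.act_mult\<close>)
  show "lact T 1 s = s"
  proof -
    have "coset (lin (gl 1) u) = coset (lin (\<lambda>z. z) u)"
      by (rule lin_in_K_eq[OF u(1)]) (use K_zero in \<open>simp add: lin_simps LM.act_one\<close>)
    then show ?thesis unfolding u T_act using lin_id[OF u(1)] by simp
  qed
  show "lact T (weyl_const c) s = c \<odot>\<^bsub>T\<^esub> s"
    unfolding u T_act
    by (rule lin_in_K_eq[OF u(1)]) (use K_zero in \<open>simp add: lin_simps LM.act_const\<close>)
  assume t: "t \<in> carrier T"
  obtain v where v: "v \<in> carrier F" "t = coset v" by (rule T_carrierE[OF t])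
  show "lact T a (s \<oplus>\<^bsub>T\<^esub> t) = lact T a s \<oplus>\<^bsub>T\<^esub> lact T a t"
    unfolding u v T_act T_add by (simp add: lin_simps)
qed

lemma weyl_right_module_T: "weyl_right_module T (ract T)"
proof (rule weyl_right_module.intro[OF vectorspace_T], rule weyl_right_module_axioms.intro)
  fix a b c s t assume s: "s \<in> carrier T"
  obtain u where u: "u \<in> carrier F" "s = coset u" by (rule T_carrierE[OF s])
  show "ract T s a \<in> carrier T"
    unfolding u T_act by (rule coset_closed[OF lin_closed[OF balanced_gr u(1)]])
  show "ract T s (a + b) = ract T s a \<oplus>\<^bsub>T\<^esub> ract T s b"
    unfolding u T_act
  proof (rule lin_in_K_add[OF u(1)])
    fix x y assume xy: "x \<in> carrier M" "y \<in> carrier N"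
    show "lin (gr (a + b)) (frag_of (x, y)) - lin (gr a) (frag_of (x, y)) - lin (gr b) (frag_of (x, y)) \<in> K"
      using tens_add_right[of x "ract N y a" "ract N y b"] xy by (simp add: lin_simps RN.act_add_right RN.act_closed)
  qed
  show "ract T s (a * b) = ract T (ract T s a) b"
    unfolding u T_act
    by (rule lin_in_K[OF u(1)]) (use K_zero in \<open>simp add: lin_simps RN.act_mult\<close>)
  show "ract T s 1 = s"
  proof -
    have "coset (lin (gr 1) u) = coset (lin (\<lambda>z. z) u)"
      by (rule lin_in_K_eq[OF u(1)]) (use K_zero in \<open>simp add: lin_simps RN.act_one\<close>)
    then show ?thesis unfolding u T_act using lin_id[OF u(1)] by simp
  qed
  show "ract T s (weyl_const c) = c \<odot>\<^bsub>T\<^esub> s"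
    unfolding u T_act
  proof (rule lin_in_K_eq[OF u(1)])
    fix x y assume xy: "x \<in> carrier M" "y \<in> carrier N"
    \<comment> \<open>Scalars act on the first factor but right constants on the second; the
      balancing relation for a constant connects them.\<close>
    have "frag_of (ract M x (weyl_const c), y) - frag_of (x, lact N (weyl_const c) y) \<in> K"
      by (rule tens_balanced[OF xy])
    then have "frag_of (x, c \<odot>\<^bsub>N\<^esub> y) - frag_of (c \<odot>\<^bsub>M\<^esub> x, y) \<in> K"
      using xy K_uminus by (fastforce simp: RM.act_const LN.act_const)
    then show "lin (gr (weyl_const c)) (frag_of (x, y)) - lin (gs c) (frag_of (x, y)) \<in> K"
      using xy by (simp add: lin_simps RN.act_const)
  qed
  assume t: "t \<in> carrier T"
  obtain v where v: "v \<in> carrier F" "t = coset v" by (rule T_carrierE[OF t])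
  show "ract T (s \<oplus>\<^bsub>T\<^esub> t) a = ract T s a \<oplus>\<^bsub>T\<^esub> ract T t a"
    unfolding u v T_act T_add by (simp add: lin_simps)
qed

lemma weyl_bimodule_T: "weyl_bimodule T"
  unfolding weyl_bimodule_def
proof (intro conjI ballI allI)
  fix s a b assume s: "s \<in> carrier T"
  obtain u where u: "u \<in> carrier F" "s = coset u" by (rule T_carrierE[OF s])
  have "lin (gr b) (lin (gl a) u) - lin (gl a) (lin (gr b) u) \<in> K"
    by (rule additive_in_K[OF u(1), where \<psi> = "\<lambda>u. lin (gr b) (lin (gl a) u) - lin (gl a) (lin (gr b) u)"])
       (use K_zero in \<open>auto simp: lin_simps\<close>)
  then show "ract T (lact T a s) b = lact T a (ract T s b)"
    unfolding u T_act coset_eq_iff .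
qed (rule weyl_left_module_T weyl_right_module_T)+

lemma tens_simps:
  assumes "x \<in> carrier M" "y \<in> carrier N"
  shows "tens x y \<in> carrier T"
    and "x' \<in> carrier M \<Longrightarrow> tens (x \<oplus>\<^bsub>M\<^esub> x') y = tens x y \<oplus>\<^bsub>T\<^esub> tens x' y"
    and "y' \<in> carrier N \<Longrightarrow> tens x (y \<oplus>\<^bsub>N\<^esub> y') = tens x y \<oplus>\<^bsub>T\<^esub> tens x y'"
    and "tens (ract M x a) y = tens x (lact N a y)"
    and "lact T a (tens x y) = tens (lact M a x) y"
    and "ract T (tens x y) a = tens x (ract N y a)"
    and "c \<odot>\<^bsub>T\<^esub> tens x y = tens x (c \<odot>\<^bsub>N\<^esub> y)"
proof -
  show "tens x y \<in> carrier T" unfolding tens_def by (rule coset_closed) (use assms in simp)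
  show "tens (x \<oplus>\<^bsub>M\<^esub> x') y = tens x y \<oplus>\<^bsub>T\<^esub> tens x' y" if "x' \<in> carrier M"
    unfolding tens_def T_add coset_eq_iff using tens_add_left[OF assms(1) that assms(2)] by (simp add: diff_diff_eq)
  show "tens x (y \<oplus>\<^bsub>N\<^esub> y') = tens x y \<oplus>\<^bsub>T\<^esub> tens x y'" if "y' \<in> carrier N"
    unfolding tens_def T_add coset_eq_iff using tens_add_right[OF assms that] by (simp add: diff_diff_eq)
  show bal: "tens (ract M x a) y = tens x (lact N a y)" for a
    unfolding tens_def coset_eq_iff by (rule tens_balanced[OF assms])
  show "lact T a (tens x y) = tens (lact M a x) y" unfolding tens_def T_act by (simp add: lin_simps)
  show "ract T (tens x y) a = tens x (ract N y a)" unfolding tens_def T_act by (simp add: lin_simps)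
  have "c \<odot>\<^bsub>T\<^esub> tens x y = tens (c \<odot>\<^bsub>M\<^esub> x) y" unfolding tens_def T_act by (simp add: lin_simps)
  then show "c \<odot>\<^bsub>T\<^esub> tens x y = tens x (c \<odot>\<^bsub>N\<^esub> y)"
    using bal[of "weyl_const c"] assms by (simp add: RM.act_const LN.act_const)
qed

text \<open>Pure tensors generate the tensor product as a group. \<open>H\<close> is only an
  additive subgroup, so that a union of filtration steps can take its place.\<close>

lemma tens_induct:
  assumes s: "s \<in> carrier T"
    and f: "\<And>s t. s \<in> carrier T \<Longrightarrow> t \<in> carrier T \<Longrightarrow> f (s \<oplus>\<^bsub>T\<^esub> t) = f s + f t"
    and H: "0 \<in> H" "\<And>v w. v \<in> H \<Longrightarrow> w \<in> H \<Longrightarrow> v - w \<in> H"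
    and tens: "\<And>x y. x \<in> carrier M \<Longrightarrow> y \<in> carrier N \<Longrightarrow> f (tens x y) \<in> H"
  shows "f s \<in> (H :: 'v::ab_group_add set)"
proof -
  obtain u where u: "u \<in> carrier F" "s = coset u" by (rule T_carrierE[OF s])
  have "Poly_Mapping.keys u \<subseteq> supp" using u(1) by simp
  then have "f (coset u) \<in> H \<and> u \<in> carrier F"
  proof (induction rule: frag_induction)
    case zero
    have "f (coset 0) = f (coset 0) + f (coset 0)"
      using f[OF coset_closed coset_closed, OF F_closed(1) F_closed(1)] by (simp add: T_add)
    then show ?case using H(1) F_closed(1) by simp
  next
    case (one z)
    then show ?case using tens[of "fst z" "snd z"] by (auto simp: tens_def)
  next
    case (diff a b)
    have "f (coset ((a - b) + b)) = f (coset (a - b)) + f (coset b)"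
      using diff f[OF coset_closed coset_closed, OF F_closed(3)] by (simp only: T_add)
    then have "f (coset (a - b)) = f (coset a) - f (coset b)" by simp
    then show ?case using diff H(2) F_closed(3) by simp
  qed
  then show ?thesis using u(2) by simp
qed

end

section \<open>The tensor product with a holonomic bimodule\<close>

theorem theorem2p2:
  fixes M :: "('n::finite, 'k::field_char_0, 'm) bimodule"
    and N :: "('n, 'k, 'p) bimodule"
  assumes "weyl_bimodule M"
    and "weyl_bimodule N"
    and "fin_gen_right M"
    and "holonomic_bimodule N"
  shows "holonomic_bimodule (tensor_product M N)"
proof -
  interpret weyl_tensor M N by (rule weyl_tensor.intro) (rule assms)+
  let ?d = "card (UNIV :: ('n + 'n) set)"
  obtain actN where actN: "associated_action N actN" "holonomic N actN"
    using assms(4) by (auto simp: holonomic_bimodule_def)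
  then have "weyl_left_module N actN" by (simp add: associated_action_def)
  then obtain fN eN where "weyl_embed N actN fN eN" by (rule weyl_embed_exists)
  then interpret N: weyl_embed N actN fN eN .
  obtain act where act: "associated_action T act"
    by (rule associated_action_exists[OF weyl_bimodule_T])
  then have "weyl_left_module T act" by (simp add: associated_action_def)
  then obtain f e where "weyl_embed T act f e" by (rule weyl_embed_exists)
  then interpret T: weyl_embed T act f e .
  obtain SN C where SN: "left_gen N actN SN" and C: "\<And>i. pv.dim (N.wm.Gam (fN ` SN) i) \<le> C * (i + 1) ^ ?d"
    by (rule N.holonomic_growth[OF actN(2)], rule that)
  define \<Gamma> where "\<Gamma> = N.wm.Gam (fN ` SN)"
  have SN': "finite SN" "SN \<subseteq> carrier N" "fN ` carrier N \<subseteq> (\<Union>i. \<Gamma> i)" "finite (fN ` SN)" "fN ` SN \<subseteq> fN ` carrier N"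
    using SN by (auto simp: N.left_gen_iff N.wm.GenM_def \<Gamma>_def)
  have \<Gamma>: "N.wm.filtr \<Gamma>" unfolding \<Gamma>_def by (rule N.wm.filtr_Gam[OF SN'(5)])
  note \<Gamma>D = N.wm.filtrD[OF \<Gamma>]
  obtain SM where SM: "finite SM" "SM \<subseteq> carrier M"
    "\<And>m. m \<in> carrier M \<Longrightarrow> \<exists>b. m = (\<Oplus>\<^bsub>M\<^esub>s\<in>SM. ract M s (b s))"
    using assms(3) unfolding fin_gen_right_def by blast
  obtain B where B: "\<And>m. m \<in> carrier M \<Longrightarrow> m = (\<Oplus>\<^bsub>M\<^esub>s\<in>SM. ract M s (B m s))"
    using SM(3) by metis
  \<comment> \<open>Coefficients on the right generators of \<open>M\<close> cross the tensor sign
    and act on \<open>N\<close> from the left.\<close>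
  have expand: "f (tens m y) = (\<Sum>s\<in>SM. f (tens s (lact N (B m s) y)))"
    if m: "m \<in> carrier M" and y: "y \<in> carrier N" for m y
  proof -
    have add: "f (tens (x \<oplus>\<^bsub>M\<^esub> x') y) = f (tens x y) + f (tens x' y)"
      if "x \<in> carrier M" "x' \<in> carrier M" for x x'
      using that y by (simp add: tens_simps T.f_add)
    have "f (tens (\<Oplus>\<^bsub>M\<^esub>s\<in>SM. ract M s (B m s)) y) = (\<Sum>s\<in>SM. f (tens (ract M s (B m s)) y))"
    proof (rule finsum_hom[where f = "\<lambda>x. f (tens x y)", OF LM.abelian_monoid_axioms])
      show "f (tens \<zero>\<^bsub>M\<^esub> y) = 0" using add[of "\<zero>\<^bsub>M\<^esub>" "\<zero>\<^bsub>M\<^esub>"] by simp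
    qed (use SM(2) RM.act_closed add in auto)
    also have "\<dots> = (\<Sum>s\<in>SM. f (tens s (lact N (B m s) y)))"
      using SM(2) y by (intro sum.cong) (auto simp: tens_simps)
    finally show ?thesis using B[OF m] by simp
  qed
  have step_N: "fN (lact N (wgen v) y) \<in> \<Gamma> (Suc k)" if y: "y \<in> carrier N" "fN y \<in> \<Gamma> k" for v k y
  proof (cases v)
    case (GenX i)
    have "fN (actN (wgen (GenX (Inl i))) (eN (fN y))) \<in> \<Gamma> (Suc k)" by (rule \<Gamma>D(4)[OF y(2)])
    then show ?thesis using GenX actN(1) y(1) by (simp add: N.e_f associated_action_def)
  next
    case (GenD i)
    have "fN (actN (wgen (GenD (Inl i))) (eN (fN y))) \<in> \<Gamma> (Suc k)" by (rule \<Gamma>D(4)[OF y(2)])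
    then show ?thesis using GenD actN(1) y(1) by (simp add: N.e_f associated_action_def)
  qed
  \<comment> \<open>The left action on \<open>N\<close> agrees with that of the \<open>Inl\<close>
    generators, and degree bounds on it follow from the generators by
    \<open>bernstein_least\<close>.\<close>
  have lact_N: "fN (lact N a y) \<in> \<Gamma> (m + k)" if a: "a \<in> bernstein m" and y: "y \<in> carrier N" "fN y \<in> \<Gamma> k" for a m k y
  proof -
    let ?R = "\<lambda>m. {a. \<forall>y\<in>carrier N. fN y \<in> \<Gamma> k \<longrightarrow> fN (lact N a y) \<in> \<Gamma> (m + k)}"
    have zero: "fN (lact N 0 y) = 0" if "y \<in> carrier N" for y
      using LN.act_const[OF that, of 0] LN.lmult_0[OF that] by (simp add: weyl_const_0 N.f_zero)
    have "bernstein m \<subseteq> ?R m"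
    proof (rule bernstein_least)
      fix m
      show "weyl.subspace (?R m)"
        by (rule weyl.subspaceI)
           (auto simp: zero LN.act_add_left LN.act_mult LN.act_const LN.act_closed N.f_add N.f_scale
              intro: pv.subspace_0[OF \<Gamma>D(1)] pv.subspace_add[OF \<Gamma>D(1)] pv.subspace_scale[OF \<Gamma>D(1)])
      show "?R m \<subseteq> ?R (Suc m)" using \<Gamma>D(3)[of "m + k" "Suc m + k"] by auto
      show "wgen v * a \<in> ?R (Suc m)" if "a \<in> ?R m" for v a
        using that step_N by (simp add: LN.act_mult LN.act_closed)
    qed (simp add: LN.act_one)
    then show ?thesis using a y by blast
  qed
  \<comment> \<open>Finitely many generators of the algebra and of \<open>M\<close> produce finitely
    many coefficients, so one degree bounds them all.\<close>
  have "\<exists>c. \<forall>v. \<forall>s\<in>SM. \<forall>s'\<in>SM. B (lact M (wgen v) s) s' \<in> bernstein c"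
  proof -
    obtain deg where deg: "\<And>a :: ('n, 'k) weyl. a \<in> bernstein (deg a)" using bernstein_exhaust by metis
    let ?A = "(\<lambda>(v, s, s'). deg (B (lact M (wgen v) s) s')) ` (UNIV \<times> SM \<times> SM)"
    have fin: "finite ?A" using SM(1) by simp
    have "B (lact M (wgen v) s) s' \<in> bernstein (Max ?A)" if "s \<in> SM" "s' \<in> SM" for v s s'
    proof -
      have "deg (B (lact M (wgen v) s) s') \<in> ?A" using that by force
      then have "deg (B (lact M (wgen v) s) s') \<le> Max ?A" using fin by simp
      then show ?thesis using deg bernstein_mono by blast
    qed
    then show ?thesis by blast
  qed
  then obtain c0 where c0: "\<And>v s s'. s \<in> SM \<Longrightarrow> s' \<in> SM \<Longrightarrow> B (lact M (wgen v) s) s' \<in> bernstein c0" by blast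
  \<comment> \<open>\<open>c0\<close> pays for the coefficients of the left action and 1 for the
    single step taken by the right action. It also makes \<open>c\<close> positive, so that the
    stretched filtration exhausts the module.\<close>
  define c where "c = c0 + 1"
  \<comment> \<open>Tensoring with \<open>s\<close>, extended through \<open>eN\<close> to a linear
    map on the whole ambient type.\<close>
  define \<beta> where "\<beta> s v = f (tens s (eN v))" for s v
  have \<beta>_linear: "Vector_Spaces.linear pscale pscale (\<beta> s)" if "s \<in> carrier M" for s
    unfolding Vector_Spaces.linear_iff \<beta>_def
  proof (intro conjI allI)
    fix v w k
    show "f (tens s (eN (v + w))) = f (tens s (eN v)) + f (tens s (eN w))"
      using that by (simp add: N.e_add N.e_closed tens_simps T.f_add)
    show "f (tens s (eN (pscale k v))) = pscale k (f (tens s (eN v)))"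
      unfolding N.e_scale tens_simps(7)[OF that N.e_closed, symmetric]
      by (rule T.f_scale[OF tens_simps(1)[OF that N.e_closed]])
  qed (rule pv.vector_space_axioms)+
  define \<Phi> where "\<Phi> i = pv.span (\<Union>s\<in>SM. \<beta> s ` \<Gamma> (c * i))" for i
  have tens_\<Phi>: "f (tens s y) \<in> \<Phi> i" if "s \<in> SM" "y \<in> carrier N" "fN y \<in> \<Gamma> k" "k \<le> c * i" for s y i k
  proof -
    have "f (tens s y) = \<beta> s (fN y)" using that by (simp add: \<beta>_def N.e_f)
    moreover have "fN y \<in> \<Gamma> (c * i)" using \<Gamma>D(3)[OF that(4)] that(3) by blast
    ultimately show ?thesis unfolding \<Phi>_def using that(1) by (intro pv.span_base) blast
  qed
  have \<Phi>_sub: "pv.subspace (\<Phi> i)" for i by (simp add: \<Phi>_def)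
  have \<Phi>_mono: "\<Phi> i \<subseteq> \<Phi> j" if "i \<le> j" for i j
    unfolding \<Phi>_def by (rule pv.span_mono) (use \<Gamma>D(3)[of "c * i" "c * j"] that in auto)
  have \<Phi>_filtr: "T.wm.filtr \<Phi>"
    unfolding T.wm.filtr_def
  proof (intro allI conjI ballI)
    fix i
    show "pv.subspace (\<Phi> i)" by (rule \<Phi>_sub)
    show "\<Phi> i \<subseteq> f ` carrier T"
      unfolding \<Phi>_def
      by (rule pv.span_minimal[OF _ T.W_subspace]) (use SM(2) in \<open>auto simp: \<beta>_def N.e_closed tens_simps\<close>)
    show "\<Phi> i \<subseteq> \<Phi> (Suc i)" by (rule \<Phi>_mono) simp
    fix v w assume "w \<in> \<Phi> i"
    then show "f (act (wgen v) (e w)) \<in> \<Phi> (Suc i)"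
      unfolding \<Phi>_def[of i]
    proof (induction rule: pv.span_induct_alt)
      case base
      then show ?case using pv.subspace_0[OF \<Phi>_sub] by (simp add: T.wm.act_zero_right)
    next
      case (step k x y)
      obtain s n where s: "s \<in> SM" "n \<in> \<Gamma> (c * i)" "x = \<beta> s n" using step.hyps by auto
      obtain z where z: "z \<in> carrier N" "n = fN z" using s(2) \<Gamma>D(2) by blast
      have sM: "s \<in> carrier M" using s(1) SM(2) by blast
      have x: "x = f (tens s z)" using s(3) z by (simp add: \<beta>_def N.e_f)
      have zG: "fN z \<in> \<Gamma> (c * i)" using s(2) z(2) by simp
      have t: "tens s z \<in> carrier T" by (rule tens_simps(1)[OF sM z(1)])
      \<comment> \<open>The left generator moves \<open>s\<close>; the result is rewritten in the
        generators of \<open>M\<close>, and its coefficients raise the step in \<open>N\<close> by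
        at most \<open>c0\<close>.\<close>
      have left: "f (lact T (wgen v) (tens s z)) \<in> \<Phi> (Suc i)" for v
      proof -
        have "f (lact T (wgen v) (tens s z)) = (\<Sum>s'\<in>SM. f (tens s' (lact N (B (lact M (wgen v) s) s') z)))"
          using expand[OF LM.act_closed[OF sM] z(1)] by (simp add: tens_simps sM z(1))
        also have "\<dots> \<in> \<Phi> (Suc i)"
        proof (rule pv.subspace_sum[OF \<Phi>_sub])
          fix s' assume s': "s' \<in> SM"
          have "fN (lact N (B (lact M (wgen v) s) s') z) \<in> \<Gamma> (c0 + c * i)"
            by (rule lact_N[OF c0[OF s(1) s'] z(1) zG])
          then show "f (tens s' (lact N (B (lact M (wgen v) s) s') z)) \<in> \<Phi> (Suc i)"
            by (rule tens_\<Phi>[OF s' LN.act_closed[OF z(1)]]) (simp add: c_def)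
        qed
        finally show ?thesis .
      qed
      \<comment> \<open>The right action touches \<open>N\<close> only and costs one step; for
        derivatives the sign in the associated action has to be undone.\<close>
      have right: "f (ract T (tens s z) (wgen v)) \<in> \<Phi> (Suc i)" for v
      proof -
        have "fN (ract N z (wgen v)) \<in> \<Gamma> (Suc (c * i))"
        proof (cases v)
          case (GenX j)
          have "fN (actN (wgen (GenX (Inr j))) (eN (fN z))) \<in> \<Gamma> (Suc (c * i))" by (rule \<Gamma>D(4)[OF zG])
          then show ?thesis using GenX actN(1) z(1) by (simp add: N.e_f associated_action_def)
        next
          case (GenD j)
          have "fN (actN (wgen (GenD (Inr j))) (eN (fN z))) \<in> \<Gamma> (Suc (c * i))" by (rule \<Gamma>D(4)[OF zG])
          then have neg: "fN (\<ominus>\<^bsub>N\<^esub> ract N z (weyl_d j)) \<in> \<Gamma> (Suc (c * i))"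
            using actN(1) z(1) by (simp add: N.e_f associated_action_def)
          have "ract N z (weyl_d j) \<in> carrier N" by (rule RN.act_closed[OF z(1)])
          then have "fN (\<ominus>\<^bsub>N\<^esub> ract N z (weyl_d j)) + fN (ract N z (weyl_d j)) = 0"
            using N.f_add[of "\<ominus>\<^bsub>N\<^esub> ract N z (weyl_d j)" "ract N z (weyl_d j)"] by (simp add: LN.l_neg N.f_zero)
          then have "fN (ract N z (weyl_d j)) = - fN (\<ominus>\<^bsub>N\<^esub> ract N z (weyl_d j))"
            by (simp add: add_eq_0_iff)
          then show ?thesis using pv.subspace_neg[OF \<Gamma>D(1) neg] GenD by simp
        qed
        then have "f (tens s (ract N z (wgen v))) \<in> \<Phi> (Suc i)"
          by (rule tens_\<Phi>[OF s(1) RN.act_closed[OF z(1)]]) (simp add: c_def)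
        then show ?thesis by (simp add: tens_simps sM z(1))
      qed
      have neg: "f (\<ominus>\<^bsub>T\<^esub> r) \<in> \<Phi> (Suc i)" if r: "r \<in> carrier T" "f r \<in> \<Phi> (Suc i)" for r
      proof -
        have "f (\<ominus>\<^bsub>T\<^esub> r) + f r = 0"
          using T.f_add[of "\<ominus>\<^bsub>T\<^esub> r" r] r(1) by (simp add: T.l_neg T.f_zero)
        then have "f (\<ominus>\<^bsub>T\<^esub> r) = - f r" by (simp add: add_eq_0_iff2)
        then show ?thesis using pv.subspace_neg[OF \<Phi>_sub r(2)] by simp
      qed
      have "f (act (wgen v) (tens s z)) \<in> \<Phi> (Suc i)"
      proof (cases v)
        case (GenX j)
        show ?thesis
        proof (cases j)
          case (Inl a)
          then show ?thesis using left[of "GenX a"] act t GenX by (simp add: associated_action_def)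
        next
          case (Inr a)
          then show ?thesis using right[of "GenX a"] act t GenX by (simp add: associated_action_def)
        qed
      next
        case (GenD j)
        show ?thesis
        proof (cases j)
          case (Inl a)
          then show ?thesis using left[of "GenD a"] act t GenD by (simp add: associated_action_def)
        next
          case (Inr a)
          have "ract T (tens s z) (weyl_d a) \<in> carrier T"
            by (rule weyl_right_module.act_closed[OF weyl_right_module_T t])
          then show ?thesis using neg right[of "GenD a"] act t GenD Inr by (simp add: associated_action_def)
        qed
      qed
      then have "f (act (wgen v) (e x)) \<in> \<Phi> (Suc i)" using x t by (simp add: T.e_f)
      then show ?case
        using step.IH pv.subspace_add[OF \<Phi>_sub] pv.subspace_scale[OF \<Phi>_sub]
        by (simp add: T.wm.act_plus T.wm.act_scale)
    qed
  qed
  have bound: "(\<exists>G. finite G \<and> \<Phi> i \<subseteq> pv.span G) \<and> pv.dim (\<Phi> i) \<le> (card SM * C * c ^ ?d) * (i + 1) ^ ?d" for i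
  proof -
    interpret pr: vector_space_pair pscale pscale ..
    obtain E where E: "E \<subseteq> \<Gamma> (c * i)" "pv.independent E" "\<Gamma> (c * i) \<subseteq> pv.span E" "card E = pv.dim (\<Gamma> (c * i))"
      by (rule pv.basis_exists)
    have "\<Gamma> (c * i) = pv.span (N.wm.gens (fN ` SN) (c * i))" by (simp add: \<Gamma>_def N.wm.Gam_def)
    then have finE: "finite E"
      using pv.independent_span_bound[OF N.wm.finite_gens[OF SN'(4)] E(2), of "c * i"] E(1) by simp
    \<comment> \<open>Each right generator of \<open>M\<close> contributes a linear image of one
      step in \<open>N\<close>, hence the factor \<open>card SM\<close> in the bound.\<close>
    let ?G = "\<Union>s\<in>SM. \<beta> s ` E"
    have finG: "finite ?G" using SM(1) finE by simp
    have sub: "\<Phi> i \<subseteq> pv.span ?G"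
      unfolding \<Phi>_def
    proof (rule pv.span_minimal)
      show "(\<Union>s\<in>SM. \<beta> s ` \<Gamma> (c * i)) \<subseteq> pv.span ?G"
      proof safe
        fix s n assume s: "s \<in> SM" "n \<in> \<Gamma> (c * i)"
        have "\<beta> s n \<in> \<beta> s ` pv.span E" using s(2) E(3) by blast
        also have "\<dots> = pv.span (\<beta> s ` E)"
          using pr.linear_span_image[OF \<beta>_linear, of s E] s(1) SM(2) by auto
        also have "\<dots> \<subseteq> pv.span ?G" using s(1) by (intro pv.span_mono) auto
        finally show "\<beta> s n \<in> pv.span ?G" .
      qed
    qed simp
    have "pv.dim (\<Phi> i) \<le> card ?G" by (rule pv.dim_le_card[OF sub finG])
    also have "\<dots> \<le> (\<Sum>s\<in>SM. card (\<beta> s ` E))" by (rule card_UN_le[OF SM(1)])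
    also have "\<dots> \<le> card SM * card E"
    proof -
      have "(\<Sum>s\<in>SM. card (\<beta> s ` E)) \<le> (\<Sum>s\<in>SM. card E)"
        by (rule sum_mono) (rule card_image_le[OF finE])
      then show ?thesis by simp
    qed
    also have "\<dots> \<le> card SM * (C * (c * i + 1) ^ ?d)"
      using C[of "c * i"] E(4) by (simp add: \<Gamma>_def)
    also have "\<dots> \<le> card SM * (C * (c * (i + 1)) ^ ?d)"
      by (intro mult_left_mono power_mono) (auto simp: c_def)
    also have "\<dots> = (card SM * C * c ^ ?d) * (i + 1) ^ ?d" by (simp only: power_mult_distrib mult.assoc)
    finally show ?thesis using finG sub by blast
  qed
  have exhaust: "f ` carrier T \<subseteq> (\<Union>i. \<Phi> i)"
  proof safe
    fix t assume t: "t \<in> carrier T"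
    show "f t \<in> (\<Union>i. \<Phi> i)"
    proof (rule tens_induct[OF t])
      show "f (s \<oplus>\<^bsub>T\<^esub> t) = f s + f t" if "s \<in> carrier T" "t \<in> carrier T" for s t by (rule T.f_add[OF that])
      show "0 \<in> (\<Union>i. \<Phi> i)" using pv.subspace_0[OF \<Phi>_sub] by blast
      show "v - w \<in> (\<Union>i. \<Phi> i)" if vw: "v \<in> (\<Union>i. \<Phi> i)" "w \<in> (\<Union>i. \<Phi> i)" for v w
      proof -
        obtain i j where "v \<in> \<Phi> i" "w \<in> \<Phi> j" using vw by auto
        then have "v \<in> \<Phi> (max i j)" "w \<in> \<Phi> (max i j)"
          using \<Phi>_mono[of i "max i j"] \<Phi>_mono[of j "max i j"] by auto
        then have "v - w \<in> \<Phi> (max i j)" by (rule pv.subspace_diff[OF \<Phi>_sub])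
        then show ?thesis by (rule UN_I[OF UNIV_I])
      qed
      fix x y assume xy: "x \<in> carrier M" "y \<in> carrier N"
      have "\<exists>k. fN (lact N (B x s) y) \<in> \<Gamma> k" for s
        using SN'(3) LN.act_closed[OF xy(2)] by blast
      then obtain k where k: "\<And>s. fN (lact N (B x s) y) \<in> \<Gamma> (k s)" by metis
      \<comment> \<open>The sum serves as a common upper bound for the steps reached by the
        individual terms.\<close>
      let ?i = "\<Sum>s\<in>SM. k s"
      have "f (tens s (lact N (B x s) y)) \<in> \<Phi> ?i" if s: "s \<in> SM" for s
      proof (rule tens_\<Phi>[OF s LN.act_closed[OF xy(2)] k])
        have "k s \<le> ?i" using member_le_sum[of s SM k] s SM(1) by simp
        also have "\<dots> \<le> c * ?i" by (simp add: c_def)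
        finally show "k s \<le> c * ?i" .
      qed
      then have "f (tens x y) \<in> \<Phi> ?i" unfolding expand[OF xy] by (intro pv.subspace_sum[OF \<Phi>_sub])
      then show "f (tens x y) \<in> (\<Union>i. \<Phi> i)" by blast
    qed
  qed
  have "holonomic T act"
    by (rule T.holonomicI[OF \<Phi>_filtr _ exhaust]) (use bound in blast)+
  then show ?thesis
    using act weyl_bimodule_T by (auto simp: holonomic_bimodule_def)
qed

end
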